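(* Let $G$ be a second countable locally compact abelian group, let $\Delta$ be a discrete subgroup of $G\times\widehat{G}$ equipped with the counting measure, and let $g\in L^2(G)$. If $\{\pi(\nu)g\}_{\nu\in\Delta}$ is a frame for $L^2(G)$, then $\Delta$ is a uniform lattice with $\mathrm{d}(\Delta)\le 1$.
   Context: $G$ is written multiplicatively and carries a fixed Haar measure; the dual group $\widehat{G}$ carries the dual Haar measure (so that the Plancherel theorem holds), and $G\times\widehat{G}$ the product measure. For $\lambda\in G$, $\gamma\in\widehat{G}$, the operators on $L^2(G)$ are $(T_\lambda f)(x)=f(x\lambda^{-1})$, $(E_\gamma f)(x)=\gamma(x)f(x)$, and $\pi(\nu)=E_\gamma T_\lambda$ for $\nu=(\lambda,\gamma)\in G\times\widehat{G}$. Given the Haar measure $d\nu$ on $\Delta$ (here counting measure), $(G\times\widehat{G})/\Delta$ carries the unique Haar measure $d\dot\chi$ for which Weil's formula $\int_{G\times\widehat{G}}f(\chi)\,d\chi=\int_{(G\times\widehat{G})/\Delta}\int_\Delta f(\chi\nu)\,d\nu\,d\dot\chi$ holds for all $f\in L^1(G\times\widehat{G})$. The size of $\Delta$ is $\mathrm{d}(\Delta):=\int_{(G\times\widehat{G})/\Delta}1\,d\dot\chi\in(0,\infty]$. A uniform lattice is a discrete subgroup $\Delta$ that is co-compact, i.e., $(G\times\widehat{G})/\Delta$ is compact. The system $\{\pi(\nu)g\}_{\nu\in\Delta}$ is a frame for $L^2(G)$ if there are constants $0<A\le B<\infty$ with $A\|f\|^2\le\int_\Delta|\langle f,\pi(\nu)g\rangle|^2\,d\nu\le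 B\|f\|^2$ for all $f\in L^2(G)$. *)

theory Defs
  imports "HOL-Analysis.Analysis"
begin

text \<open>
  A second countable locally compact abelian group is a type in the classes
  \<^class>\<open>topological_ab_group_add\<close>, \<^class>\<open>t2_space\<close> and \<^class>\<open>second_countable_topology\<close>
  whose euclidean topology is locally compact. All abelian groups are written additively,
  including the dual group, whose sum is the pointwise product of characters.
\<close>

section \<open>The dual group\<close>

typedef (overloaded) ('a::topological_ab_group_add) character =
  "{\<gamma> :: 'a \<Rightarrow> complex. continuous_on UNIV \<gamma> \<and> (\<forall>x. cmod (\<gamma> x) = 1) \<and> (\<forall>x y. \<gamma> (x + y) = \<gamma> x * \<gamma> y)}"
  morphisms char_app Abs_character
  by (rule exI[of _ "\<lambda>_. 1"]) simp

setup_lifting type_definition_character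

instantiation character :: (topological_ab_group_add) ab_group_add
begin

lift_definition zero_character :: "'a character" is "\<lambda>_. 1"
  by simp

lift_definition plus_character :: "'a character \<Rightarrow> 'a character \<Rightarrow> 'a character"
  is "\<lambda>\<gamma> \<delta> x. \<gamma> x * \<delta> x"
  by (auto intro!: continuous_intros simp: norm_mult)

lift_definition uminus_character :: "'a character \<Rightarrow> 'a character"
  is "\<lambda>\<gamma> x. cnj (\<gamma> x)"
  by (auto intro!: continuous_intros)

definition minus_character :: "'a character \<Rightarrow> 'a character \<Rightarrow> 'a character"
  where "minus_character \<gamma> \<delta> = \<gamma> + - \<delta>"

instance
proof
  fix a b c :: "'a character"
  show "a + b + c = a + (b + c)"
    by transfer (simp add: mult.assoc)
  show "a + b = b + a"
    by transfer (simp add: mult.commute)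
  show "0 + a = a"
    by transfer simp
  show "- a + a = 0"
  proof transfer
    fix \<gamma> :: "'a \<Rightarrow> complex"
    assume "continuous_on UNIV \<gamma> \<and> (\<forall>x. cmod (\<gamma> x) = 1) \<and> (\<forall>x y. \<gamma> (x + y) = \<gamma> x * \<gamma> y)"
    then have "cnj (\<gamma> x) * \<gamma> x = 1" for x
      using complex_norm_square[of "\<gamma> x"] by (simp add: mult.commute)
    then show "(\<lambda>x. cnj (\<gamma> x) * \<gamma> x) = (\<lambda>_. 1)"
      by simp
  qed
  show "a - b = a + - b"
    by (rule minus_character_def)
qed

end

text \<open>The dual group carries the compact-open topology.\<close>

instantiation character :: (topological_ab_group_add) topological_space
begin

definition open_character :: "'a character set \<Rightarrow> bool"
  where "open_character =
    generate_topology {{\<gamma>. char_app \<gamma> ` K \<subseteq> U} | K U. compact K \<and> open U}"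

instance
  by standard (auto simp: open_character_def
      intro: generate_topology.UNIV generate_topology.Int generate_topology.UN)

end

section \<open>Haar measures\<close>

text \<open>
  A Haar measure on a group with underlying set \<^term>\<open>topspace X\<close>, group operation \<open>+\<close> and
  topology \<open>X\<close>. This is meant for second countable locally compact Hausdorff groups, on which
  every Borel measure that is finite on compact sets is automatically regular, so that regularity
  is not listed. The group is described by \<open>X\<close> rather than by a type class because for a quotient
  group \<open>+\<close> is the setwise sum of cosets.
\<close>

definition haar_measure :: "'b::plus topology \<Rightarrow> 'b measure \<Rightarrow> bool"
  where "haar_measure X \<mu> \<longleftrightarrow>
    space \<mu> = topspace X \<and>
    sets \<mu> = sigma_sets (topspace X) {U. openin X U} \<and>
    emeasure \<mu> (topspace X) \<noteq> 0 \<and>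
    (\<forall>K. compactin X K \<longrightarrow> emeasure \<mu> K < \<infinity>) \<and>
    (\<forall>a \<in> topspace X. \<forall>A \<in> sets \<mu>. emeasure \<mu> ((+) a ` A) = emeasure \<mu> A)"

definition fourier :: "'a::topological_ab_group_add measure \<Rightarrow> ('a \<Rightarrow> complex) \<Rightarrow> 'a character \<Rightarrow> complex"
  where "fourier M f \<gamma> = (\<integral>x. f x * cnj (char_app \<gamma> x) \<partial>M)"

definition L2 :: "'a measure \<Rightarrow> ('a \<Rightarrow> complex) set"
  where "L2 M = {f \<in> borel_measurable M. integrable M (\<lambda>x. (cmod (f x))\<^sup>2)}"

definition L2_inner :: "'a measure \<Rightarrow> ('a \<Rightarrow> complex) \<Rightarrow> ('a \<Rightarrow> complex) \<Rightarrow> complex"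
  where "L2_inner M f h = (\<integral>x. f x * cnj (h x) \<partial>M)"

definition L2_norm :: "'a measure \<Rightarrow> ('a \<Rightarrow> complex) \<Rightarrow> real"
  where "L2_norm M f = sqrt (\<integral>x. (cmod (f x))\<^sup>2 \<partial>M)"

text \<open>
  The dual Haar measure is the Haar measure on the dual group normalised by Plancherel's theorem:
  the Fourier transform is isometric from the integrable functions in \<^term>\<open>L2 M\<close> to \<^term>\<open>L2 N\<close>.
\<close>

definition dual_haar_measure ::
    "'a::topological_ab_group_add measure \<Rightarrow> 'a character measure \<Rightarrow> bool"
  where "dual_haar_measure M N \<longleftrightarrow>
    haar_measure euclidean N \<and>
    (\<forall>f. integrable M f \<and> f \<in> L2 M \<longrightarrow>
       fourier M f \<in> L2 N \<and> L2_norm N (fourier M f) = L2_norm M f)"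

section \<open>Subgroups, quotients and Weil's formula\<close>

definition is_subgroup :: "'b::ab_group_add set \<Rightarrow> bool"
  where "is_subgroup \<Delta> \<longleftrightarrow>
    0 \<in> \<Delta> \<and> (\<forall>x \<in> \<Delta>. \<forall>y \<in> \<Delta>. x + y \<in> \<Delta>) \<and> (\<forall>x \<in> \<Delta>. - x \<in> \<Delta>)"

definition cosets :: "'b::ab_group_add set \<Rightarrow> 'b set set"
  where "cosets \<Delta> = range (\<lambda>z. z +o \<Delta>)"

definition quotient_topology :: "'b::{ab_group_add, topological_space} set \<Rightarrow> 'b set topology"
  where "quotient_topology \<Delta> = topology (\<lambda>U. U \<subseteq> cosets \<Delta> \<and> open {z. z +o \<Delta> \<in> U})"

lemma openin_quotient_topology:
  "openin (quotient_topology \<Delta>) U \<longleftrightarrow> U \<subseteq> cosets \<Delta> \<and> open {z. z +o \<Delta> \<in> U}"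
proof -
  have "istopology (\<lambda>U. U \<subseteq> cosets \<Delta> \<and> open {z. z +o \<Delta> \<in> U})"
  proof -
    have int: "{z. z +o \<Delta> \<in> S \<inter> T} = {z. z +o \<Delta> \<in> S} \<inter> {z. z +o \<Delta> \<in> T}" for S T
      by auto
    have un: "{z. z +o \<Delta> \<in> \<Union>\<K>} = (\<Union>S\<in>\<K>. {z. z +o \<Delta> \<in> S})" for \<K>
      by auto
    show ?thesis
      unfolding istopology_def int un by (auto intro: open_Int)
  qed
  then show ?thesis
    by (simp add: quotient_topology_def topology_inverse')
qed

lemma topspace_quotient_topology: "topspace (quotient_topology \<Delta>) = cosets \<Delta>"
proof
  show "topspace (quotient_topology \<Delta>) \<subseteq> cosets \<Delta>"
    using openin_topspace[of "quotient_topology \<Delta>"] by (simp only: openin_quotient_topology)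
  have "openin (quotient_topology \<Delta>) (cosets \<Delta>)"
    by (simp add: openin_quotient_topology cosets_def)
  then show "cosets \<Delta> \<subseteq> topspace (quotient_topology \<Delta>)"
    by (rule openin_subset)
qed

text \<open>
  The periodization \<open>z \<mapsto> \<integral>\<^sub>\<Delta> f (z + \<nu>) d\<nu>\<close> is constant on cosets and is regarded as a function of
  the coset; \<open>\<Delta>\<close> carries the counting measure.
\<close>

definition periodization :: "'b::ab_group_add set \<Rightarrow> ('b \<Rightarrow> complex) \<Rightarrow> 'b set \<Rightarrow> complex"
  where "periodization \<Delta> f C = the_elem ((\<lambda>z. \<integral>\<nu>. f (z + \<nu>) \<partial>count_space \<Delta>) ` C)"

definition weil_formula :: "'b::ab_group_add measure \<Rightarrow> 'b set \<Rightarrow> 'b set measure \<Rightarrow> bool"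
  where "weil_formula P \<Delta> Q \<longleftrightarrow>
    (\<forall>f. integrable P f \<longrightarrow>
       integrable Q (periodization \<Delta> f) \<and> (\<integral>z. f z \<partial>P) = (\<integral>C. periodization \<Delta> f C \<partial>Q))"

text \<open>
  In \<^const>\<open>haar_measure\<close>, the translation of the quotient by a coset \<open>D\<close> is the setwise sum
  \<open>C \<mapsto> D + C\<close>.
\<close>

definition quotient_haar_measure ::
    "'b::{ab_group_add, topological_space} measure \<Rightarrow> 'b set \<Rightarrow> 'b set measure"
  where "quotient_haar_measure P \<Delta> =
    (THE Q. haar_measure (quotient_topology \<Delta>) Q \<and> weil_formula P \<Delta> Q)"

definition lattice_size :: "'b::{ab_group_add, topological_space} measure \<Rightarrow> 'b set \<Rightarrow> ennreal"
  where "lattice_size P \<Delta> = (\<integral>\<^sup>+C. 1 \<partial>quotient_haar_measure P \<Delta>)"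

definition uniform_lattice :: "'b::{ab_group_add, topological_space} set \<Rightarrow> bool"
  where "uniform_lattice \<Delta> \<longleftrightarrow>
    is_subgroup \<Delta> \<and> discrete \<Delta> \<and> compact_space (quotient_topology \<Delta>)"

section \<open>Gabor frames\<close>

definition translation :: "'a::topological_ab_group_add \<Rightarrow> ('a \<Rightarrow> complex) \<Rightarrow> 'a \<Rightarrow> complex"
  where "translation l f x = f (x - l)"

definition modulation ::
    "'a::topological_ab_group_add character \<Rightarrow> ('a \<Rightarrow> complex) \<Rightarrow> 'a \<Rightarrow> complex"
  where "modulation \<gamma> f x = char_app \<gamma> x * f x"

definition tf_shift ::
    "'a::topological_ab_group_add \<times> 'a character \<Rightarrow> ('a \<Rightarrow> complex) \<Rightarrow> 'a \<Rightarrow> complex"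
  where "tf_shift \<nu> f = modulation (snd \<nu>) (translation (fst \<nu>) f)"

definition gabor_frame ::
    "'a::topological_ab_group_add measure \<Rightarrow> ('a \<times> 'a character) set \<Rightarrow> ('a \<Rightarrow> complex) \<Rightarrow> bool"
  where "gabor_frame M \<Delta> g \<longleftrightarrow>
    (\<exists>A B :: real. 0 < A \<and> A \<le> B \<and>
      (\<forall>f \<in> L2 M.
        ennreal (A * (L2_norm M f)\<^sup>2)
          \<le> (\<integral>\<^sup>+\<nu>. ennreal ((cmod (L2_inner M f (tf_shift \<nu> g)))\<^sup>2) \<partial>count_space \<Delta>) \<and>
        (\<integral>\<^sup>+\<nu>. ennreal ((cmod (L2_inner M f (tf_shift \<nu> g)))\<^sup>2) \<partial>count_space \<Delta>)
          \<le> ennreal (B * (L2_norm M f)\<^sup>2)))"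

end

theory Submission
  imports Defs
begin

text \<open>
  A frame indexed by \<open>\<Delta>\<close> is compared with the continuous system of all time-frequency shifts.
  For fixed \<open>x\<close> the coefficient \<open>\<langle>f, \<pi>(x, \<gamma>) k\<rangle>\<close> is the Fourier transform at \<open>\<gamma>\<close> of
  \<open>y \<mapsto> f y * cnj (k (y - x))\<close>, so Plancherel's theorem in \<open>\<gamma>\<close> followed by integration over \<open>x\<close>
  gives \<open>\<integral> |\<langle>f, \<pi>(\<xi>) k\<rangle>|\<^sup>2 d\<xi> = \<parallel>f\<parallel>\<^sup>2 \<parallel>k\<parallel>\<^sup>2\<close> over the whole phase space (\<open>orthogonality_relation\<close>).
  Weil's formula writes the same integral as the average, over the quotient, of the sums over the
  cosets \<open>\<xi> + \<Delta>\<close>.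

  Let \<open>S\<close> be the frame operator and \<open>h = S\<^sup>-\<^sup>1 g\<close>. Since \<open>S\<close> commutes with \<open>\<pi>(\<nu>)\<close> for \<open>\<nu> \<in> \<Delta>\<close> up to
  phases that cancel, \<open>\<Sum>\<^sub>\<nu> \<langle>f, \<pi>(\<nu>) g\<rangle> cnj \<langle>f, \<pi>(\<nu>) h\<rangle> = \<parallel>f\<parallel>\<^sup>2\<close> for every \<open>f\<close>, and replacing \<open>f\<close> by
  \<open>\<pi>(\<xi>)\<^sup>* f\<close> shows that the sum over the coset of \<open>\<xi>\<close> is \<open>\<parallel>f\<parallel>\<^sup>2\<close> as well. Averaging over the quotient
  gives \<open>\<parallel>f\<parallel>\<^sup>2 d(\<Delta>)\<close>, while the orthogonality relation, polarised in its second argument, gives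
  \<open>\<parallel>f\<parallel>\<^sup>2 Re \<langle>g, h\<rangle>\<close>. Hence \<open>d(\<Delta>) = \<langle>g, h\<rangle>\<close>. On the other hand
  \<open>\<langle>g, h\<rangle> = \<langle>S h, h\<rangle> = \<Sum>\<^sub>\<nu> |\<langle>h, \<pi>(\<nu>) g\<rangle>|\<^sup>2 \<ge> |\<langle>h, g\<rangle>|\<^sup>2\<close>, by keeping the term \<open>\<nu> = 0\<close> only. So
  \<open>d(\<Delta>)\<^sup>2 \<le> d(\<Delta>)\<close>, that is, \<open>d(\<Delta>) \<le> 1\<close>. To stay with nonnegative integrals, the polarised sums are
  written as the difference of the sums for \<open>g + h\<close> and for \<open>g - h\<close> (\<open>coefficient_sums\<close>).

  Three ingredients support this argument. The operator \<open>S\<close> is never formed: \<open>S\<^sup>-\<^sup>1 f\<close> is the minimiser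
  of \<open>u \<mapsto> \<langle>S u, u\<rangle> - 2 Re \<langle>f, u\<rangle>\<close>, where \<open>\<langle>S u, u\<rangle>\<close> is the sum of the squared coefficients
  (\<open>L2_Lax_Milgram\<close>). The dual group is shown to be a second countable locally compact Hausdorff
  group, so that the product measure is an invariant \<open>\<sigma>\<close>-finite Borel measure. Finally the Haar
  measure of the quotient is obtained from a Borel fundamental domain \<open>F\<close>, and \<open>d(\<Delta>)\<close> is the
  measure of \<open>F\<close> (\<open>lattice_size_eq\<close>). Once this is finite, the quotient is compact: only finitely
  many translates of a small open set of positive measure can be disjoint in it
  (\<open>compact_quotient\<close>).
\<close>

section \<open>Square-integrable functions\<close>

text \<open>
  A quadratic polynomial in \<open>t\<close> that stays nonnegative has nonpositive discriminant. This yields the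
  Cauchy--Schwarz inequality and, below, the Euler--Lagrange equation of an approximate minimiser.
\<close>
lemma discriminant_bound:
  fixes a b r :: real
  assumes "\<And>t. 0 \<le> a + 2 * t * r + t\<^sup>2 * b"
  shows "r\<^sup>2 \<le> a * b"
proof (cases "b = 0")
  case True
  have "r = 0"
  proof (rule ccontr)
    assume "r \<noteq> 0"
    then have "a + 2 * (- (a + 1) / (2 * r)) * r = - 1"
      by (simp add: field_simps)
    then show False
      using assms[of "- (a + 1) / (2 * r)"] True by simp
  qed
  then show ?thesis using True by simp
next
  case False
  have "b \<ge> 0"
  proof (rule ccontr)
    assume "\<not> b \<ge> 0"
    then have b: "b < 0" by simp
    define t where "t = 1 + (\<bar>a\<bar> + 2 * \<bar>r\<bar>) / (- b)"
    have t1: "t \<ge> 1" using b by (simp add: t_def divide_nonneg_neg)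
    have "a + 2 * t * r \<le> t * (\<bar>a\<bar> + 2 * \<bar>r\<bar>)"
    proof -
      have "a \<le> t * \<bar>a\<bar>" using t1 mult_right_mono[of 1 t "\<bar>a\<bar>"] by simp
      moreover have "t * r \<le> t * \<bar>r\<bar>" using t1 by (intro mult_left_mono) auto
      ultimately show ?thesis by (simp add: algebra_simps)
    qed
    moreover have "t\<^sup>2 * b = t * (b - (\<bar>a\<bar> + 2 * \<bar>r\<bar>))"
      using b by (simp add: t_def power2_eq_square field_simps)
    ultimately have "a + 2 * t * r + t\<^sup>2 * b \<le> t * b"
      by (simp add: algebra_simps)
    also have "\<dots> < 0" using t1 b by (simp add: mult_pos_neg)
    finally show False using assms[of t] by simp
  qed
  then have "b > 0" using False by simp
  then show ?thesis
    using assms[of "- r / b"] by (simp add: field_simps power2_eq_square)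
qed

lemma L2_measurable: "f \<in> L2 M \<Longrightarrow> f \<in> borel_measurable M"
  by (simp add: L2_def)

lemma L2_I:
  assumes "f \<in> borel_measurable M" "(\<integral>\<^sup>+x. ennreal ((cmod (f x))\<^sup>2) \<partial>M) < \<infinity>"
  shows "f \<in> L2 M"
  using assms by (auto simp: L2_def integrable_iff_bounded)

lemma L2_norm_nonneg: "0 \<le> L2_norm M f"
  by (simp add: L2_norm_def)

lemma L2_norm_sq: "(L2_norm M f)\<^sup>2 = (\<integral>x. (cmod (f x))\<^sup>2 \<partial>M)"
  by (simp add: L2_norm_def)

lemma nn_integral_L2:
  assumes "f \<in> L2 M"
  shows "(\<integral>\<^sup>+x. ennreal ((cmod (f x))\<^sup>2) \<partial>M) = ennreal ((L2_norm M f)\<^sup>2)"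
  using assms unfolding L2_norm_sq by (intro nn_integral_eq_integral) (auto simp: L2_def)

lemma L2_norm_sq_le_nn:
  assumes "f \<in> L2 M" "(\<integral>\<^sup>+x. ennreal ((cmod (f x))\<^sup>2) \<partial>M) \<le> ennreal c" "0 \<le> c"
  shows "(L2_norm M f)\<^sup>2 \<le> c"
  using assms by (simp add: nn_integral_L2)

lemma L2_add:
  assumes "f \<in> L2 M" "h \<in> L2 M"
  shows "(\<lambda>x. f x + h x) \<in> L2 M"
proof -
  have [measurable]: "f \<in> borel_measurable M" "h \<in> borel_measurable M"
    using assms by (auto simp: L2_def)
  have "integrable M (\<lambda>x. (cmod (f x + h x))\<^sup>2)"
  proof (rule Bochner_Integration.integrable_bound)
    show "integrable M (\<lambda>x. 2 * (cmod (f x))\<^sup>2 + 2 * (cmod (h x))\<^sup>2)"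
      using assms by (auto simp: L2_def)
    have "(cmod (f x + h x))\<^sup>2 \<le> 2 * (cmod (f x))\<^sup>2 + 2 * (cmod (h x))\<^sup>2" for x
    proof -
      have "(cmod (f x + h x))\<^sup>2 \<le> (cmod (f x) + cmod (h x))\<^sup>2"
        by (intro power_mono norm_triangle_ineq) simp
      also have "\<dots> \<le> 2 * (cmod (f x))\<^sup>2 + 2 * (cmod (h x))\<^sup>2"
        using sum_squares_bound[of "cmod (f x)" "cmod (h x)"] by (simp add: power2_sum)
      finally show ?thesis .
    qed
    then show "AE x in M. norm ((cmod (f x + h x))\<^sup>2) \<le> norm (2 * (cmod (f x))\<^sup>2 + 2 * (cmod (h x))\<^sup>2)"
      by (intro AE_I2) (simp add: abs_of_nonneg)
  qed simp
  then show ?thesis by (simp add: L2_def)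
qed

lemma L2_scale: "f \<in> L2 M \<Longrightarrow> (\<lambda>x. c * f x) \<in> L2 M"
  by (auto simp: L2_def norm_mult power_mult_distrib)

lemma L2_diff: "f \<in> L2 M \<Longrightarrow> h \<in> L2 M \<Longrightarrow> (\<lambda>x. f x - h x) \<in> L2 M"
  using L2_add[OF _ L2_scale[of h M "- 1"]] by simp

lemma L2_inner_integrable:
  assumes "f \<in> L2 M" "h \<in> L2 M"
  shows "integrable M (\<lambda>x. f x * cnj (h x))"
proof (rule Bochner_Integration.integrable_bound)
  show "integrable M (\<lambda>x. (cmod (f x))\<^sup>2 + (cmod (h x))\<^sup>2)"
    using assms by (auto simp: L2_def)
  have [measurable]: "f \<in> borel_measurable M" "h \<in> borel_measurable M" "cnj \<in> borel_measurable borel"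
    using assms by (auto simp: L2_def intro!: borel_measurable_continuous_onI continuous_intros)
  show "(\<lambda>x. f x * cnj (h x)) \<in> borel_measurable M"
    by measurable
  have "cmod (f x) * cmod (h x) \<le> (cmod (f x))\<^sup>2 + (cmod (h x))\<^sup>2" for x
    using sum_squares_bound[of "cmod (f x)" "cmod (h x)"]
      mult_nonneg_nonneg[OF norm_ge_zero[of "f x"] norm_ge_zero[of "h x"]] by linarith
  then show "AE x in M. norm (f x * cnj (h x)) \<le> norm ((cmod (f x))\<^sup>2 + (cmod (h x))\<^sup>2)"
    by (intro AE_I2) (simp add: norm_mult abs_of_nonneg)
qed

lemma L2_inner_cnj: "cnj (L2_inner M f h) = L2_inner M h f"
  unfolding L2_inner_def by (subst Bochner_Integration.integral_cnj[symmetric]) (simp add: mult.commute)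

lemma L2_inner_self: "L2_inner M f f = of_real ((L2_norm M f)\<^sup>2)"
  unfolding L2_inner_def L2_norm_sq
  by (simp add: complex_norm_square[symmetric] flip: of_real_power)

lemma L2_inner_add_left:
  assumes "f \<in> L2 M" "k \<in> L2 M" "h \<in> L2 M"
  shows "L2_inner M (\<lambda>x. f x + k x) h = L2_inner M f h + L2_inner M k h"
  unfolding L2_inner_def
  by (simp add: distrib_right Bochner_Integration.integral_add L2_inner_integrable assms)

lemma L2_inner_diff_left:
  assumes "f \<in> L2 M" "k \<in> L2 M" "h \<in> L2 M"
  shows "L2_inner M (\<lambda>x. f x - k x) h = L2_inner M f h - L2_inner M k h"
  unfolding L2_inner_def
  by (simp add: left_diff_distrib Bochner_Integration.integral_diff L2_inner_integrable assms)

lemma L2_inner_scale_left: "L2_inner M (\<lambda>x. c * f x) h = c * L2_inner M f h"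
  unfolding L2_inner_def by (simp add: mult.assoc)

lemma L2_inner_add_right:
  assumes "f \<in> L2 M" "k \<in> L2 M" "h \<in> L2 M"
  shows "L2_inner M h (\<lambda>x. f x + k x) = L2_inner M h f + L2_inner M h k"
  using L2_inner_add_left[OF assms] by (metis L2_inner_cnj complex_cnj_add)

lemma L2_inner_diff_right:
  assumes "f \<in> L2 M" "k \<in> L2 M" "h \<in> L2 M"
  shows "L2_inner M h (\<lambda>x. f x - k x) = L2_inner M h f - L2_inner M h k"
  using L2_inner_diff_left[OF assms] by (metis L2_inner_cnj complex_cnj_diff)

lemma L2_inner_scale_right: "L2_inner M h (\<lambda>x. c * f x) = cnj c * L2_inner M h f"
  using L2_inner_scale_left[of M c f h] by (metis L2_inner_cnj complex_cnj_mult)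

lemma L2_norm_add_scaled_sq:
  assumes "f \<in> L2 M" "h \<in> L2 M"
  shows "(L2_norm M (\<lambda>x. f x + of_real t * h x))\<^sup>2
    = (L2_norm M f)\<^sup>2 + 2 * t * Re (L2_inner M f h) + t\<^sup>2 * (L2_norm M h)\<^sup>2"
proof -
  let ?th = "\<lambda>x. complex_of_real t * h x"
  have th: "?th \<in> L2 M" by (rule L2_scale[OF assms(2)])
  have "complex_of_real ((L2_norm M (\<lambda>x. f x + ?th x))\<^sup>2)
      = L2_inner M (\<lambda>x. f x + ?th x) (\<lambda>x. f x + ?th x)"
    by (simp only: L2_inner_self)
  also have "\<dots> = L2_inner M f f + of_real t * L2_inner M f h + of_real t * cnj (L2_inner M f h)
      + of_real t * of_real t * L2_inner M h h"
    by (simp add: L2_inner_add_left L2_inner_add_right L2_add th assms L2_inner_scale_left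
        L2_inner_scale_right L2_inner_cnj algebra_simps)
  finally have "Re (complex_of_real ((L2_norm M (\<lambda>x. f x + ?th x))\<^sup>2))
      = Re (L2_inner M f f + of_real t * L2_inner M f h + of_real t * cnj (L2_inner M f h)
      + of_real t * of_real t * L2_inner M h h)" by (rule arg_cong)
  then show ?thesis
    unfolding L2_inner_self by (simp add: power2_eq_square algebra_simps)
qed

lemma L2_norm_add_sq:
  assumes "f \<in> L2 M" "h \<in> L2 M"
  shows "(L2_norm M (\<lambda>x. f x + h x))\<^sup>2
    = (L2_norm M f)\<^sup>2 + 2 * Re (L2_inner M f h) + (L2_norm M h)\<^sup>2"
  using L2_norm_add_scaled_sq[OF assms, of 1] by simp

lemma L2_norm_diff_sq:
  assumes "f \<in> L2 M" "h \<in> L2 M"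
  shows "(L2_norm M (\<lambda>x. f x - h x))\<^sup>2
    = (L2_norm M f)\<^sup>2 - 2 * Re (L2_inner M f h) + (L2_norm M h)\<^sup>2"
  using L2_norm_add_scaled_sq[OF assms, of "- 1"] by simp

lemma L2_Cauchy_Schwarz_Re:
  assumes "f \<in> L2 M" "h \<in> L2 M"
  shows "\<bar>Re (L2_inner M f h)\<bar> \<le> L2_norm M f * L2_norm M h"
proof -
  have "(Re (L2_inner M f h))\<^sup>2 \<le> (L2_norm M f)\<^sup>2 * (L2_norm M h)\<^sup>2"
    by (rule discriminant_bound) (metis L2_norm_add_scaled_sq[OF assms] zero_le_power2)
  then show ?thesis
    by (metis L2_norm_nonneg abs_le_square_iff abs_of_nonneg mult_nonneg_nonneg power_mult_distrib)
qed

text \<open>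
  Completeness, for sequences that converge at a geometric rate. The integral of
  \<open>\<Sum>n. 4 ^ n * |u (n + 1) - u n|\<^sup>2\<close> is finite, so almost everywhere the increments decay like
  \<open>(1/2) ^ n\<close> and the sequence converges pointwise; Fatou's lemma transfers the Cauchy estimate to
  the limit.
\<close>
lemma L2_complete:
  fixes u :: "nat \<Rightarrow> 'a \<Rightarrow> complex"
  assumes u: "\<And>n. u n \<in> L2 M"
    and Cau: "\<And>n k. n \<le> k \<Longrightarrow> L2_norm M (\<lambda>x. u k x - u n x) \<le> (1/4) ^ n"
  obtains v where "v \<in> L2 M" "\<And>n. L2_norm M (\<lambda>x. v x - u n x) \<le> (1/4) ^ n"
proof -
  have [measurable]: "u n \<in> borel_measurable M" for n using u by (rule L2_measurable)
  define d where "d = (\<lambda>n x. u (Suc n) x - u n x)"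
  have [measurable]: "d n \<in> borel_measurable M" for n by (simp add: d_def)
  have nnC: "(\<integral>\<^sup>+x. ennreal ((cmod (u k x - u n x))\<^sup>2) \<partial>M) \<le> ennreal ((1/16) ^ n)" if "n \<le> k" for n k
  proof -
    have "(L2_norm M (\<lambda>x. u k x - u n x))\<^sup>2 \<le> ((1/4) ^ n)\<^sup>2"
      using Cau[OF that] L2_norm_nonneg by (intro power_mono)
    also have "((1/4) ^ n)\<^sup>2 = (1/16::real) ^ n"
      by (simp add: power2_eq_square flip: power_mult_distrib)
    finally show ?thesis
      by (simp add: nn_integral_L2 L2_diff u)
  qed
  have "(\<integral>\<^sup>+x. (\<Sum>n. ennreal (4 ^ n * (cmod (d n x))\<^sup>2)) \<partial>M)
      = (\<Sum>n. \<integral>\<^sup>+x. ennreal (4 ^ n * (cmod (d n x))\<^sup>2) \<partial>M)"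
    by (rule nn_integral_suminf) simp
  also have "\<dots> \<le> (\<Sum>n. ennreal ((1/4) ^ n))"
  proof (intro suminf_le)
    fix n
    have "(\<integral>\<^sup>+x. ennreal (4 ^ n * (cmod (d n x))\<^sup>2) \<partial>M)
        = ennreal (4 ^ n) * (\<integral>\<^sup>+x. ennreal ((cmod (d n x))\<^sup>2) \<partial>M)"
      by (simp add: ennreal_mult nn_integral_cmult)
    also have "\<dots> \<le> ennreal (4 ^ n) * ennreal ((1/16) ^ n)"
      unfolding d_def by (intro mult_left_mono nnC) auto
    also have "\<dots> = ennreal ((1/4) ^ n)"
      by (simp add: ennreal_mult[symmetric] flip: power_mult_distrib)
    finally show "(\<integral>\<^sup>+x. ennreal (4 ^ n * (cmod (d n x))\<^sup>2) \<partial>M) \<le> ennreal ((1/4) ^ n)" .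
  qed auto
  also have "\<dots> = ennreal (\<Sum>n. (1/4) ^ n)"
    by (rule suminf_ennreal2) (auto intro: summable_geometric)
  also have "\<dots> < \<infinity>" by simp
  finally have fin: "(\<integral>\<^sup>+x. (\<Sum>n. ennreal (4 ^ n * (cmod (d n x))\<^sup>2)) \<partial>M) < \<infinity>" .
  have AEfin: "AE x in M. (\<Sum>n. ennreal (4 ^ n * (cmod (d n x))\<^sup>2)) \<noteq> \<infinity>"
    using fin by (intro nn_integral_PInf_AE) auto
  have conv: "convergent (\<lambda>n. u n x)" if fx: "(\<Sum>n. ennreal (4 ^ n * (cmod (d n x))\<^sup>2)) \<noteq> \<infinity>" for x
  proof -
    define T where "T = (\<Sum>n. ennreal (4 ^ n * (cmod (d n x))\<^sup>2))"
    obtain S where S: "T = ennreal S" "S \<ge> 0"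
      using fx unfolding T_def[symmetric] by (cases T) simp_all
    have bd: "cmod (d n x) \<le> sqrt S * (1/2) ^ n" for n
    proof -
      have "a n \<le> suminf a" for a :: "nat \<Rightarrow> ennreal"
        using sum_le_suminf[OF summableI, of "{n}" a] by simp
      from this[of "\<lambda>n. ennreal (4 ^ n * (cmod (d n x))\<^sup>2)"]
      have "ennreal (4 ^ n * (cmod (d n x))\<^sup>2) \<le> ennreal S"
        unfolding S(1)[symmetric] T_def .
      then have "4 ^ n * (cmod (d n x))\<^sup>2 \<le> S" using S(2) by simp
      moreover have "(2 ^ n)\<^sup>2 = (4::real) ^ n"
        by (simp add: power2_eq_square flip: power_mult_distrib)
      then have "(2 ^ n * cmod (d n x))\<^sup>2 = 4 ^ n * (cmod (d n x))\<^sup>2"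
        by (simp add: power_mult_distrib)
      ultimately have "2 ^ n * cmod (d n x) \<le> sqrt S"
        by (intro real_le_rsqrt) simp
      then show ?thesis by (simp add: field_simps)
    qed
    have "summable (\<lambda>n. d n x)"
      by (rule summable_comparison_test[where g = "\<lambda>n. sqrt S * (1/2) ^ n"])
        (use bd in \<open>auto intro!: summable_mult summable_geometric\<close>)
    then have "convergent (\<lambda>n. \<Sum>k<n. d k x)"
      by (simp add: summable_iff_convergent)
    moreover have "(\<Sum>k<n. d k x) = u n x - u 0 x" for n
      by (simp add: d_def sum_lessThan_telescope[of "\<lambda>k. u k x"])
    ultimately have "convergent (\<lambda>n. u n x - u 0 x)" by simp
    from convergent_add[OF this convergent_const[of "u 0 x"]] show ?thesis by simp
  qed
  define v where "v = (\<lambda>x. lim (\<lambda>n. u n x))"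
  have [measurable]: "v \<in> borel_measurable M" unfolding v_def by measurable
  have AElim: "AE x in M. (\<lambda>n. u n x) \<longlonglongrightarrow> v x"
    using AEfin
  proof eventually_elim
    case (elim x)
    then show ?case using conv[of x] unfolding v_def by (simp add: convergent_LIMSEQ_iff)
  qed
  have nnv: "(\<integral>\<^sup>+x. ennreal ((cmod (v x - u n x))\<^sup>2) \<partial>M) \<le> ennreal ((1/16) ^ n)" for n
  proof -
    have "(\<integral>\<^sup>+x. ennreal ((cmod (v x - u n x))\<^sup>2) \<partial>M)
       = (\<integral>\<^sup>+x. liminf (\<lambda>k. ennreal ((cmod (u k x - u n x))\<^sup>2)) \<partial>M)"
    proof (rule nn_integral_cong_AE, use AElim in eventually_elim)
      case (elim x)
      then have "(\<lambda>k. ennreal ((cmod (u k x - u n x))\<^sup>2)) \<longlonglongrightarrow> ennreal ((cmod (v x - u n x))\<^sup>2)"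
        by (intro tendsto_intros)
      then show ?case by (rule lim_imp_Liminf[OF sequentially_bot, symmetric])
    qed
    also have "\<dots> \<le> liminf (\<lambda>k. \<integral>\<^sup>+x. ennreal ((cmod (u k x - u n x))\<^sup>2) \<partial>M)"
      by (rule nn_integral_liminf) simp
    also have "\<dots> \<le> liminf (\<lambda>k. ennreal ((1/16) ^ n))"
      by (rule Liminf_mono) (use nnC in \<open>auto simp: eventually_at_top_linorder\<close>)
    also have "\<dots> = ennreal ((1/16) ^ n)" by (simp add: Liminf_const)
    finally show ?thesis .
  qed
  have dL2: "(\<lambda>x. v x - u n x) \<in> L2 M" for n
    using nnv[of n] by (intro L2_I) (auto intro: le_less_trans)
  show ?thesis
  proof
    show "v \<in> L2 M" using L2_add[OF dL2[of 0] u[of 0]] by simp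
    fix n
    have "(L2_norm M (\<lambda>x. v x - u n x))\<^sup>2 \<le> (1/16) ^ n"
      by (rule L2_norm_sq_le_nn[OF dL2 nnv]) simp
    also have "\<dots> = ((1/4) ^ n)\<^sup>2"
      by (simp add: power2_eq_square flip: power_mult_distrib)
    finally show "L2_norm M (\<lambda>x. v x - u n x) \<le> (1/4) ^ n"
      by (rule power2_le_imp_le) simp
  qed
qed

text \<open>
  The equation \<open>C\<^sup>* C u = f\<close> in weak form. The functional \<open>J u = \<parallel>C u\<parallel>\<^sup>2 - 2 Re \<langle>f, u\<rangle>\<close> is bounded
  below because \<open>C\<close> is, and the parallelogram identity makes every fast minimising sequence Cauchy.
  Instead of showing that the limit minimises \<open>J\<close>, the proof compares \<open>J\<close> at an approximate
  minimiser with its values on a line, which gives the equation up to an error that vanishes in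
  the limit.
\<close>
lemma L2_Lax_Milgram:
  fixes C :: "('a \<Rightarrow> complex) \<Rightarrow> 'b \<Rightarrow> complex"
  assumes mem: "\<And>f. f \<in> L2 M \<Longrightarrow> C f \<in> L2 N"
    and lin: "\<And>f h c. f \<in> L2 M \<Longrightarrow> h \<in> L2 M \<Longrightarrow> C (\<lambda>x. f x + c * h x) = (\<lambda>y. C f y + c * C h y)"
    and A: "0 < A" "\<And>f. f \<in> L2 M \<Longrightarrow> A * (L2_norm M f)\<^sup>2 \<le> (L2_norm N (C f))\<^sup>2"
    and B: "\<And>f. f \<in> L2 M \<Longrightarrow> (L2_norm N (C f))\<^sup>2 \<le> B * (L2_norm M f)\<^sup>2"
    and f: "f \<in> L2 M"
  obtains u where "u \<in> L2 M" "\<And>w. w \<in> L2 M \<Longrightarrow> L2_inner N (C u) (C w) = L2_inner M f w"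
proof -
  define J where "J = (\<lambda>u. (L2_norm N (C u))\<^sup>2 - 2 * Re (L2_inner M f u))"
  define b where "b = (\<lambda>u w. Re (L2_inner N (C u) (C w)))"
  have Jlin: "J (\<lambda>x. u x + of_real t * w x)
      = J u + 2 * t * (b u w - Re (L2_inner M f w)) + t\<^sup>2 * (L2_norm N (C w))\<^sup>2"
    if "u \<in> L2 M" "w \<in> L2 M" for u w t
    using that f by (simp add: J_def lin L2_norm_add_scaled_sq mem L2_inner_add_right L2_scale
        L2_inner_scale_right b_def algebra_simps)
  have Jlow: "- ((L2_norm M f)\<^sup>2 / A) \<le> J u" if "u \<in> L2 M" for u
  proof -
    let ?n = "L2_norm M u" and ?m = "L2_norm M f"
    have "2 * Re (L2_inner M f u) \<le> 2 * (?m * ?n)"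
      using L2_Cauchy_Schwarz_Re[OF f that] by simp
    moreover have "A * (?n - ?m / A)\<^sup>2 = A * ?n\<^sup>2 - 2 * (?m * ?n) + ?m\<^sup>2 / A"
      using A(1) by (simp add: power2_eq_square field_simps)
    then have "2 * (?m * ?n) \<le> A * ?n\<^sup>2 + ?m\<^sup>2 / A"
      using A(1) zero_le_mult_iff[of A "(?n - ?m / A)\<^sup>2"] by simp
    ultimately show ?thesis using A(2)[OF that] by (simp add: J_def)
  qed
  define m where "m = Inf (J ` L2 M)"
  have bdd: "bdd_below (J ` L2 M)" using Jlow by (auto simp: bdd_below_def)
  have mle: "m \<le> J u" if "u \<in> L2 M" for u
    unfolding m_def using that bdd by (intro cInf_lower) auto
  \<comment> \<open>the accuracy for which the parallelogram identity gives distances at most \<open>(1/4) ^ n\<close>\<close>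
  define e where "e = (\<lambda>n. A / 4 * (1/16) ^ n :: real)"
  have epos: "e n > 0" for n using A by (simp add: e_def)
  have "\<exists>u \<in> L2 M. J u < m + e n" for n
  proof -
    have "Inf (J ` L2 M) < m + e n" using epos by (simp add: m_def)
    moreover have "J ` L2 M \<noteq> {}" using f by blast
    ultimately show ?thesis using bdd by (auto simp: cInf_less_iff)
  qed
  then obtain u where u: "\<And>n. u n \<in> L2 M" "\<And>n. J (u n) < m + e n" by metis
  have Cau: "L2_norm M (\<lambda>x. u k x - u n x) \<le> (1/4) ^ n" if "n \<le> k" for n k
  proof -
    let ?d = "\<lambda>x. u k x - u n x"
    have d: "?d \<in> L2 M" by (intro L2_diff u)
    \<comment> \<open>parallelogram identity, with midpoint \<open>u n + d/2\<close>\<close>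
    have 1: "J (u k) = J (u n) + 2 * (b (u n) ?d - Re (L2_inner M f ?d)) + (L2_norm N (C ?d))\<^sup>2"
      using Jlin[OF u(1) d, of n 1] by simp
    have 2: "J (\<lambda>x. u n x + of_real (1/2) * ?d x)
        = J (u n) + (b (u n) ?d - Re (L2_inner M f ?d)) + (L2_norm N (C ?d))\<^sup>2 / 4"
      using Jlin[OF u(1) d, of n "1/2"] by (simp only: power2_eq_square) simp
    have "m \<le> J (\<lambda>x. u n x + of_real (1/2) * ?d x)"
      by (intro mle L2_add L2_scale d u)
    moreover have "W \<le> 2 * en + 2 * ek"
      if "jk = jn + 2 * L + W" "j = jn + L + W / 4" "m \<le> j" "jn < m + en" "jk < m + ek"
      for W jk jn L j en ek :: real
      using that by (simp add: field_simps)
    ultimately have "(L2_norm N (C ?d))\<^sup>2 \<le> 2 * e n + 2 * e k"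
      using 1 2 u(2)[of n] u(2)[of k] by blast
    moreover have "e k \<le> e n"
      using that A unfolding e_def by (intro mult_left_mono power_decreasing) auto
    ultimately have "A * (L2_norm M ?d)\<^sup>2 \<le> A * (1/16) ^ n"
      using A(2)[OF d] by (simp add: e_def)
    then have "(L2_norm M ?d)\<^sup>2 \<le> (1/16) ^ n" using A by simp
    also have "\<dots> = ((1/4) ^ n)\<^sup>2"
      by (simp add: power2_eq_square flip: power_mult_distrib)
    finally show ?thesis by (rule power2_le_imp_le) simp
  qed
  obtain v where v: "v \<in> L2 M" "\<And>n. L2_norm M (\<lambda>x. v x - u n x) \<le> (1/4) ^ n"
    using L2_complete[OF u(1) Cau] by blast
  have re: "Re (L2_inner N (C v) (C w)) = Re (L2_inner M f w)" if w: "w \<in> L2 M" for w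
  proof -
    let ?W = "L2_norm N (C w)"
    have est: "\<bar>b v w - Re (L2_inner M f w)\<bar> \<le> sqrt (e n) * ?W + sqrt \<bar>B\<bar> * (1/4) ^ n * ?W" for n
    proof -
      have "(b (u n) w - Re (L2_inner M f w))\<^sup>2 \<le> e n * ?W\<^sup>2"
      proof (rule discriminant_bound)
        fix t
        have "m \<le> J (\<lambda>x. u n x + of_real t * w x)" by (intro mle L2_add L2_scale u w)
        then show "0 \<le> e n + 2 * t * (b (u n) w - Re (L2_inner M f w)) + t\<^sup>2 * ?W\<^sup>2"
          using u(2)[of n] unfolding Jlin[OF u(1) w] by linarith
      qed
      then have 1: "\<bar>b (u n) w - Re (L2_inner M f w)\<bar> \<le> sqrt (e n) * ?W"
        by (metis L2_norm_nonneg abs_of_nonneg real_sqrt_abs real_sqrt_le_iff real_sqrt_mult)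
      let ?d = "\<lambda>x. v x - u n x"
      have d: "?d \<in> L2 M" by (intro L2_diff u v)
      have "C v = C (\<lambda>x. u n x + 1 * ?d x)" by simp
      also have "\<dots> = (\<lambda>y. C (u n) y + C ?d y)" using lin[OF u(1) d, of n 1] by simp
      finally have "b v w = b (u n) w + b ?d w"
        using d u w by (simp add: b_def L2_inner_add_left mem)
      moreover have "\<bar>b ?d w\<bar> \<le> L2_norm N (C ?d) * ?W"
        unfolding b_def by (intro L2_Cauchy_Schwarz_Re mem d w)
      moreover have "L2_norm N (C ?d) \<le> sqrt \<bar>B\<bar> * (1/4) ^ n"
      proof -
        have "(L2_norm N (C ?d))\<^sup>2 \<le> \<bar>B\<bar> * (L2_norm M ?d)\<^sup>2"
          using B[OF d] mult_right_mono[OF abs_ge_self zero_le_power2, of B "L2_norm M ?d"] by linarith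
        also have "\<dots> \<le> \<bar>B\<bar> * ((1/4) ^ n)\<^sup>2"
          using v(2)[of n] L2_norm_nonneg by (intro mult_left_mono power_mono) auto
        also have "\<dots> = (sqrt \<bar>B\<bar> * (1/4) ^ n)\<^sup>2"
          by (simp add: power_mult_distrib)
        finally show ?thesis by (rule power2_le_imp_le) simp
      qed
      then have "L2_norm N (C ?d) * ?W \<le> sqrt \<bar>B\<bar> * (1/4) ^ n * ?W"
        by (intro mult_right_mono L2_norm_nonneg)
      ultimately show ?thesis using 1 by linarith
    qed
    have "(\<lambda>n. sqrt (e n) * ?W + sqrt \<bar>B\<bar> * (1/4) ^ n * ?W) \<longlonglongrightarrow> sqrt (A / 4 * 0) * ?W + sqrt \<bar>B\<bar> * 0 * ?W"
      unfolding e_def by (intro tendsto_intros LIMSEQ_power_zero) auto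
    then have "(\<lambda>n. sqrt (e n) * ?W + sqrt \<bar>B\<bar> * (1/4) ^ n * ?W) \<longlonglongrightarrow> 0" by simp
    then have "\<bar>b v w - Re (L2_inner M f w)\<bar> \<le> 0"
      by (rule LIMSEQ_le_const) (use est in auto)
    then show ?thesis by (simp add: b_def)
  qed
  show ?thesis
  proof
    show "v \<in> L2 M" by fact
    fix w assume w: "w \<in> L2 M"
    have zero: "(\<lambda>x. 0) \<in> L2 M" using L2_scale[OF w, of 0] by simp
    \<comment> \<open>the imaginary parts agree because the real parts agree at \<open>\<i> w\<close>\<close>
    have "C (\<lambda>x. \<i> * w x) = (\<lambda>y. \<i> * C w y)"
    proof -
      have "C (\<lambda>x. 0) = (\<lambda>y. 0)"
        using lin[OF zero zero, of "-1"] by (simp add: fun_eq_iff)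
      then show ?thesis using lin[OF zero w, of \<i>] by simp
    qed
    then have "Re (L2_inner N (C v) (\<lambda>y. \<i> * C w y)) = Re (L2_inner M f (\<lambda>x. \<i> * w x))"
      using re[OF L2_scale[OF w, of \<i>]] by simp
    then show "L2_inner N (C v) (C w) = L2_inner M f w"
      using re[OF w] by (simp add: L2_inner_scale_right complex_eq_iff)
  qed
qed

section \<open>Topological groups and translation-invariant measures\<close>

text \<open>
  Phase space is a product of two topological groups, and the theory of quotients below speaks of
  one group; these instances connect the two.
\<close>
instance prod :: (topological_monoid_add, topological_monoid_add) topological_monoid_add
proof
  fix a b :: "'a \<times> 'b"
  have "((\<lambda>x. (fst (fst x) + fst (snd x), snd (fst x) + snd (snd x))) \<longlongrightarrow> (fst a + fst b, snd a + snd b)) (nhds a \<times>\<^sub>F nhds b)"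
    unfolding nhds_prod[symmetric]
    by (intro tendsto_Pair tendsto_add) (auto intro!: tendsto_eq_intros filterlim_ident)
  then show "LIM x (nhds a \<times>\<^sub>F nhds b). fst x + snd x :> nhds (a + b)"
    by (simp add: plus_prod_def)
qed

instance prod :: (topological_group_add, topological_group_add) topological_group_add
proof
  fix a :: "'a \<times> 'b"
  have "((\<lambda>x. (- fst x, - snd x)) \<longlongrightarrow> (- fst a, - snd a)) (nhds a)"
    by (intro tendsto_Pair tendsto_minus) (auto intro!: tendsto_eq_intros filterlim_ident)
  then show "(uminus \<longlongrightarrow> - a) (nhds a)"
    by (simp add: uminus_prod_def[abs_def])
qed

instance prod :: (topological_ab_group_add, topological_ab_group_add) topological_ab_group_add ..

text \<open>
  Locally compact Hausdorff spaces are regular, so the compact neighbourhoods may be taken closed and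
  arbitrarily small.
\<close>
lemma compact_closed_neighbourhood:
  fixes x :: "'a::t2_space"
  assumes lc: "locally_compact_space (euclidean :: 'a topology)" and "open W" "x \<in> W"
  obtains U K where "open U" "x \<in> U" "U \<subseteq> K" "compact K" "closed K" "K \<subseteq> W"
proof -
  have "Hausdorff_space (euclidean :: 'a topology)"
    unfolding Hausdorff_space_def using hausdorff by (auto simp: disjnt_def)
  then have "neighbourhood_base_of (\<lambda>C. compactin euclidean C \<and> closedin euclidean C) (euclidean :: 'a topology)"
    using locally_compact_space_neighbourhood_base_closedin lc by blast
  then have "\<exists>U V. openin euclidean U \<and> (compactin euclidean V \<and> closedin euclidean V) \<and> x \<in> U \<and> U \<subseteq> V \<and> V \<subseteq> W"
    using assms unfolding neighbourhood_base_of by fastforce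
  then show ?thesis using that by auto
qed

lemma vimage_add_uminus:
  fixes a :: "'b::ab_group_add"
  shows "(\<lambda>x. x + - a) -` A = (+) a ` A"
proof (intro set_eqI iffI)
  fix x assume "x \<in> (\<lambda>x. x + - a) -` A"
  then show "x \<in> (+) a ` A" by (intro image_eqI[of _ _ "x + - a"]) auto
qed auto

lemma symmetric_difference_nhd:
  fixes T :: "'b::topological_ab_group_add set"
  assumes "open T" "0 \<in> T"
  obtains V where "open V" "0 \<in> V" "\<And>x y. x \<in> V \<Longrightarrow> y \<in> V \<Longrightarrow> x - y \<in> T"
proof -
  have "open ((\<lambda>p. fst p - snd p :: 'b) -` T)"
    using assms(1) by (intro open_vimage continuous_intros)
  moreover have "(0, 0) \<in> (\<lambda>p. fst p - snd p :: 'b) -` T" using assms by simp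
  ultimately obtain A B where AB: "open A" "open B" "0 \<in> A" "0 \<in> B" "A \<times> B \<subseteq> (\<lambda>p. fst p - snd p) -` T"
    by (auto elim!: open_prod_elim)
  show ?thesis
    by (rule that[of "A \<inter> B"]) (use AB in auto)
qed

lemma second_countable_base:
  assumes "second_countable (euclidean :: 'a::topological_space topology)"
  obtains B where "countable B" "\<And>V :: 'a set. V \<in> B \<Longrightarrow> open V"
    "\<And>U x. open U \<Longrightarrow> x \<in> U \<Longrightarrow> \<exists>V\<in>B. x \<in> V \<and> V \<subseteq> U"
proof -
  obtain B :: "'a set set" where B: "countable B" "\<forall>V\<in>B. openin euclidean V"
    "\<forall>U x. openin euclidean U \<and> x \<in> U \<longrightarrow> (\<exists>V\<in>B. x \<in> V \<and> V \<subseteq> U)"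
    using assms unfolding second_countable_def by blast
  show ?thesis
  proof (rule that[OF B(1)])
    show "open V" if "V \<in> B" for V using B(2) that by simp
    show "\<exists>V\<in>B. x \<in> V \<and> V \<subseteq> U" if "open U" "x \<in> U" for U x
      using B(3)[rule_format, of U x] that by simp
  qed
qed

lemma second_countable_euclidean:
  "second_countable (euclidean :: 'a::second_countable_topology topology)"
proof -
  obtain B :: "'a set set" where B: "countable B" "topological_basis B"
    using ex_countable_basis by blast
  then show ?thesis
    unfolding second_countable_def
    by (metis open_openin topological_basisE topological_basis_open)
qed

lemma second_countable_euclidean_prod:
  assumes "second_countable (euclidean :: 'a::topological_space topology)"
    and "second_countable (euclidean :: 'b::topological_space topology)"
  shows "second_countable (euclidean :: ('a \<times> 'b) topology)"
proof -
  obtain B :: "'a set set" where B: "countable B" "\<And>V. V \<in> B \<Longrightarrow> open V"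
    "\<And>U x. open U \<Longrightarrow> x \<in> U \<Longrightarrow> \<exists>V\<in>B. x \<in> V \<and> V \<subseteq> U"
    using second_countable_base[OF assms(1)] by metis
  obtain C :: "'b set set" where C: "countable C" "\<And>V. V \<in> C \<Longrightarrow> open V"
    "\<And>U x. open U \<Longrightarrow> x \<in> U \<Longrightarrow> \<exists>V\<in>C. x \<in> V \<and> V \<subseteq> U"
    using second_countable_base[OF assms(2)] by metis
  have "\<exists>V\<in>(\<lambda>p. fst p \<times> snd p) ` (B \<times> C). q \<in> V \<and> V \<subseteq> S" if S: "open S" "q \<in> S" for S q
  proof -
    obtain U W where UW: "open U" "open W" "q \<in> U \<times> W" "U \<times> W \<subseteq> S"
      using open_prod_elim[OF S] by blast
    obtain V where V: "V \<in> B" "fst q \<in> V" "V \<subseteq> U" using B(3)[OF UW(1), of "fst q"] UW(3) by auto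
    obtain X where X: "X \<in> C" "snd q \<in> X" "X \<subseteq> W" using C(3)[OF UW(2), of "snd q"] UW(3) by auto
    show ?thesis
      by (rule bexI[of _ "V \<times> X"]) (use V X UW(4) in \<open>auto simp: mem_Times_iff image_iff\<close>)
  qed
  then show ?thesis
    unfolding second_countable_def using B(1,2) C(1,2)
    by (intro exI[of _ "(\<lambda>p. fst p \<times> snd p) ` (B \<times> C)"]) (auto intro!: open_Times)
qed

lemma sets_borel_prod:
  assumes "second_countable (euclidean :: 'a::topological_space topology)"
    and "second_countable (euclidean :: 'b::topological_space topology)"
  shows "sets (borel \<Otimes>\<^sub>M borel) = sets (borel :: ('a \<times> 'b) measure)"
proof
  obtain B :: "'a set set" where B: "countable B" "\<And>V. V \<in> B \<Longrightarrow> open V"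
    "\<And>U x. open U \<Longrightarrow> x \<in> U \<Longrightarrow> \<exists>V\<in>B. x \<in> V \<and> V \<subseteq> U"
    using second_countable_base[OF assms(1)] by metis
  obtain C :: "'b set set" where C: "countable C" "\<And>V. V \<in> C \<Longrightarrow> open V"
    "\<And>U x. open U \<Longrightarrow> x \<in> U \<Longrightarrow> \<exists>V\<in>C. x \<in> V \<and> V \<subseteq> U"
    using second_countable_base[OF assms(2)] by metis
  show "sets (borel \<Otimes>\<^sub>M borel) \<subseteq> sets (borel :: ('a \<times> 'b) measure)"
    unfolding sets_pair_measure
    by (rule sets.sigma_sets_subset'[where M = "borel :: ('a \<times> 'b) measure", simplified]) (auto intro: borel_Times)
  have "S \<in> sets (borel \<Otimes>\<^sub>M borel)" if S: "open S" for S :: "('a \<times> 'b) set"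
  proof -
    let ?R = "{p \<in> B \<times> C. fst p \<times> snd p \<subseteq> S}"
    have "S \<subseteq> (\<Union>p\<in>?R. fst p \<times> snd p)"
    proof
      fix q assume q: "q \<in> S"
      obtain U W where UW: "open U" "open W" "q \<in> U \<times> W" "U \<times> W \<subseteq> S"
        using open_prod_elim[OF S q] by blast
      obtain V where V: "V \<in> B" "fst q \<in> V" "V \<subseteq> U" using B(3)[OF UW(1), of "fst q"] UW(3) by auto
      obtain X where X: "X \<in> C" "snd q \<in> X" "X \<subseteq> W" using C(3)[OF UW(2), of "snd q"] UW(3) by auto
      have "(V, X) \<in> ?R" using V X UW(4) by auto
      moreover have "q \<in> fst (V, X) \<times> snd (V, X)" using V X by (simp add: mem_Times_iff)
      ultimately show "q \<in> (\<Union>p\<in>?R. fst p \<times> snd p)" by blast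
    qed
    then have eq: "S = (\<Union>p\<in>?R. fst p \<times> snd p)" by blast
    have "countable ?R" using B(1) C(1) by (auto intro: countable_subset[OF _ countable_SIGMA])
    then have "(\<Union>p\<in>?R. fst p \<times> snd p) \<in> sets (borel \<Otimes>\<^sub>M borel)"
      using B(2) C(2) by (intro sets.countable_UN'') (auto intro!: pair_measureI)
    then show ?thesis using eq by simp
  qed
  then show "sets (borel :: ('a \<times> 'b) measure) \<subseteq> sets (borel \<Otimes>\<^sub>M borel)"
    unfolding sets_borel[where 'a = "'a \<times> 'b"]
    by (intro sets.sigma_sets_subset'[where M = "borel \<Otimes>\<^sub>M borel", simplified space_pair_measure space_borel UNIV_Times_UNIV])
      auto
qed

text \<open>
  Second countability enters measure theory through this lemma: a statement about one neighbourhood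
  of zero extends to the group by countable additivity.
\<close>
lemma Lindelof_translates:
  fixes V :: "'b::topological_ab_group_add set"
  assumes sc: "second_countable (euclidean :: 'b topology)" and V: "open V" "0 \<in> V"
  obtains z :: "nat \<Rightarrow> 'b" where "\<And>x. \<exists>n. x - z n \<in> V"
proof -
  have op: "open {x. x - a \<in> V}" for a
    using open_vimage[OF V(1), of "\<lambda>x. x - a"] by (simp add: vimage_def continuous_intros)
  have "Lindelof_space (euclidean :: 'b topology)"
    by (rule second_countable_imp_Lindelof_space[OF sc])
  moreover have "\<forall>U \<in> range (\<lambda>a. {x. x - a \<in> V}). openin euclidean U"
    using op by auto
  moreover have "\<Union>(range (\<lambda>a. {x. x - a \<in> V})) = topspace euclidean"
    using V(2) by (auto intro!: exI[of _ "_ :: 'b"])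
  ultimately obtain \<V> where \<V>: "countable \<V>" "\<V> \<subseteq> range (\<lambda>a. {x. x - a \<in> V})" "\<Union>\<V> = UNIV"
    unfolding Lindelof_space_def by (metis topspace_euclidean)
  obtain Z where Z: "countable Z" "\<V> = (\<lambda>a. {x. x - a \<in> V}) ` Z"
    using \<V> by (meson countable_image_eq countable_subset_image)
  have "Z \<noteq> {}" using \<V>(3) Z by auto
  show ?thesis
  proof
    fix x
    obtain a where "a \<in> Z" "x - a \<in> V" using \<V>(3) Z by blast
    then show "\<exists>n. x - from_nat_into Z n \<in> V"
      using from_nat_into_surj[OF Z(1)] by metis
  qed
qed

lemma distr_translate:
  fixes \<mu> :: "'b::topological_ab_group_add measure"
  assumes sets: "sets \<mu> = sets borel"
    and inv: "\<And>a A. A \<in> sets borel \<Longrightarrow> emeasure \<mu> ((+) a ` A) = emeasure \<mu> A"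
  shows "distr \<mu> borel (\<lambda>x. x + a) = \<mu>"
proof (rule measure_eqI)
  have sp: "space \<mu> = UNIV" using sets_eq_imp_space_eq[OF sets] by simp
  have m: "(\<lambda>x. x + a) \<in> measurable \<mu> borel"
    unfolding measurable_cong_sets[OF sets refl]
    by (intro borel_measurable_continuous_onI continuous_intros)
  show "sets (distr \<mu> borel (\<lambda>x. x + a)) = sets \<mu>" by (simp add: sets)
  fix A assume "A \<in> sets (distr \<mu> borel (\<lambda>x. x + a))"
  then have A: "A \<in> sets borel" by simp
  have "(\<lambda>x. x + a) -` A = (+) (- a) ` A"
    using vimage_add_uminus[of "- a" A] by simp
  then show "emeasure (distr \<mu> borel (\<lambda>x. x + a)) A = emeasure \<mu> A"
    using emeasure_distr[OF m A] inv[OF A, of "- a"] by (simp only: sp Int_UNIV_right)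
qed

lemma nn_integral_translate:
  fixes \<mu> :: "'b::topological_ab_group_add measure"
  assumes sets: "sets \<mu> = sets borel"
    and inv: "\<And>a A. A \<in> sets borel \<Longrightarrow> emeasure \<mu> ((+) a ` A) = emeasure \<mu> A"
    and \<phi>: "\<phi> \<in> borel_measurable borel"
  shows "(\<integral>\<^sup>+x. \<phi> (x + a) \<partial>\<mu>) = (\<integral>\<^sup>+x. \<phi> x \<partial>\<mu>)"
proof -
  have m: "(\<lambda>x. x + a) \<in> measurable \<mu> borel"
    unfolding measurable_cong_sets[OF sets refl]
    by (intro borel_measurable_continuous_onI continuous_intros)
  have "(\<integral>\<^sup>+x. \<phi> x \<partial>\<mu>) = (\<integral>\<^sup>+x. \<phi> x \<partial>distr \<mu> borel (\<lambda>x. x + a))"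
    by (subst distr_translate[OF sets]) (simp_all add: inv)
  also have "\<dots> = (\<integral>\<^sup>+x. \<phi> (x + a) \<partial>\<mu>)"
    by (rule nn_integral_distr[OF m]) (use \<phi> in simp)
  finally show ?thesis ..
qed

lemma haar_sets:
  assumes "haar_measure euclidean \<mu>"
  shows "sets \<mu> = sets borel" "space \<mu> = UNIV"
  using assms by (auto simp: haar_measure_def sets_borel)

lemma haar_translate:
  assumes "haar_measure euclidean \<mu>" "A \<in> sets borel"
  shows "emeasure \<mu> ((+) a ` A) = emeasure \<mu> A"
  using assms haar_sets(1)[OF assms(1)] unfolding haar_measure_def topspace_euclidean by blast

lemma haar_shift:
  fixes \<mu> :: "'b::topological_ab_group_add measure"
  assumes "haar_measure euclidean \<mu>"
  shows "distr \<mu> borel (\<lambda>x. x + a) = \<mu>"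
  by (rule distr_translate) (simp_all add: haar_sets[OF assms] haar_translate[OF assms])

text \<open>
  Countably many translates of an open set inside a compact set cover the group, and all have the same
  finite measure.
\<close>
lemma haar_sigma_finite:
  fixes \<mu> :: "'b::{topological_ab_group_add, t2_space} measure"
  assumes h: "haar_measure euclidean \<mu>" and sc: "second_countable (euclidean :: 'b topology)"
    and U: "open U" "0 \<in> U" "U \<subseteq> W" "compact W"
  shows "sigma_finite_measure \<mu>" "emeasure \<mu> U < \<infinity>"
proof -
  have "emeasure \<mu> W < \<infinity>" using h U(4) by (simp add: haar_measure_def)
  moreover have "emeasure \<mu> U \<le> emeasure \<mu> W"
    using U by (intro emeasure_mono) (auto simp: haar_sets[OF h] compact_imp_closed)
  ultimately show fin: "emeasure \<mu> U < \<infinity>" by (rule le_less_trans[rotated])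
  obtain z where z: "\<And>x. \<exists>n :: nat. x - z n \<in> U"
    using Lindelof_translates[OF sc U(1,2)] by blast
  show "sigma_finite_measure \<mu>"
  proof
    have "emeasure \<mu> ((+) a ` U) \<noteq> \<infinity>" for a
      using haar_translate[OF h, of U a] U(1) fin by simp
    moreover have "(+) a ` U \<in> sets \<mu>" for a
    proof -
      have "(+) a ` U = (\<lambda>x. x - a) -` U" by (force simp: image_iff)
      also have "open \<dots>" using U(1) by (intro open_vimage continuous_intros)
      finally show ?thesis by (simp add: haar_sets[OF h])
    qed
    moreover have "(\<Union>n. (+) (z n) ` U) = space \<mu>"
    proof -
      have "x \<in> (\<Union>n. (+) (z n) ` U)" for x
      proof -
        obtain n where "x - z n \<in> U" using z by blast
        then have "x \<in> (+) (z n) ` U" by (intro image_eqI[of _ _ "x - z n"]) auto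
        then show ?thesis by blast
      qed
      then show ?thesis by (auto simp: haar_sets[OF h])
    qed
    ultimately show "\<exists>A. countable A \<and> A \<subseteq> sets \<mu> \<and> \<Union> A = space \<mu> \<and> (\<forall>a\<in>A. emeasure \<mu> a \<noteq> \<infinity>)"
      by (intro exI[of _ "range (\<lambda>n. (+) (z n) ` U)"]) auto
  qed
qed

section \<open>The dual group\<close>

lemma char_app_continuous: "continuous_on S (char_app \<gamma>)"
  and cmod_char_app [simp]: "cmod (char_app \<gamma> x) = 1"
  and char_app_add_arg: "char_app \<gamma> (x + y) = char_app \<gamma> x * char_app \<gamma> y"
  using char_app[of \<gamma>] by (auto intro: continuous_on_subset)

lemma char_app_plus: "char_app (\<gamma> + \<delta>) x = char_app \<gamma> x * char_app \<delta> x"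
  and char_app_uminus: "char_app (- \<gamma>) x = cnj (char_app \<gamma> x)"
  and char_app_zero: "char_app 0 x = 1"
  by (simp_all add: plus_character.rep_eq uminus_character.rep_eq zero_character.rep_eq)

lemma char_app_mult_cnj [simp]: "char_app \<gamma> x * cnj (char_app \<gamma> x) = 1"
  using complex_norm_square[of "char_app \<gamma> x"] by simp

lemma char_app_zero_arg [simp]: "char_app \<gamma> 0 = 1"
  using char_app_add_arg[of \<gamma> 0 0] cmod_char_app[of \<gamma> 0]
  by (metis add_0 mult_cancel_right2 norm_zero zero_neq_one)

lemma char_app_minus_arg: "char_app \<gamma> (- x) = cnj (char_app \<gamma> x)"
proof -
  have "char_app \<gamma> (- x) * char_app \<gamma> x = 1"
    using char_app_add_arg[of \<gamma> "- x" x] by simp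
  then have "char_app \<gamma> (- x) * (char_app \<gamma> x * cnj (char_app \<gamma> x)) = cnj (char_app \<gamma> x)"
    by (metis mult.assoc mult_1)
  then show ?thesis by simp
qed

text \<open>
  By \<open>char_nhd_subset_open\<close> and \<open>char_nhd_contains_open\<close> these sets form a neighbourhood base of \<open>\<gamma>\<close>
  in the compact-open topology, which is thus the topology of uniform convergence on compact sets.
\<close>
definition char_nhd :: "'a::topological_ab_group_add character \<Rightarrow> 'a set \<Rightarrow> real \<Rightarrow> 'a character set"
  where "char_nhd \<gamma> K e = {\<delta>. \<forall>x\<in>K. cmod (char_app \<delta> x - char_app \<gamma> x) < e}"

lemma open_compact_open: "compact K \<Longrightarrow> open U \<Longrightarrow> open {\<gamma>. char_app \<gamma> ` K \<subseteq> U}"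
  unfolding open_character_def by (rule generate_topology.Basis) blast

lemma char_nhd_subset_open:
  assumes "open S" "\<gamma> \<in> S"
  shows "\<exists>K e. compact K \<and> e > 0 \<and> char_nhd \<gamma> K e \<subseteq> S"
  using assms unfolding open_character_def
proof (induction S rule: generate_topology.induct)
  case UNIV
  then show ?case by (intro exI[of _ "{}"] exI[of _ 1]) auto
next
  case (Int a b)
  then obtain K e L d where Kd: "compact K" "e > 0" "char_nhd \<gamma> K e \<subseteq> a"
    "compact L" "d > 0" "char_nhd \<gamma> L d \<subseteq> b" by blast
  have "char_nhd \<gamma> (K \<union> L) (min e d) \<subseteq> char_nhd \<gamma> K e \<inter> char_nhd \<gamma> L d"
    by (auto simp: char_nhd_def)
  then show ?case using Kd by (intro exI[of _ "K \<union> L"] exI[of _ "min e d"]) auto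
next
  case (UN \<K>)
  then obtain S where "S \<in> \<K>" "\<gamma> \<in> S" by blast
  then show ?case using UN.IH[of S] by (meson Union_upper order_trans)
next
  case (Basis s)
  then obtain K U where s: "s = {\<gamma>. char_app \<gamma> ` K \<subseteq> U}" "compact K" "open U" by blast
  have "compact (char_app \<gamma> ` K)"
    using s(2) by (intro compact_continuous_image char_app_continuous)
  moreover have "char_app \<gamma> ` K \<subseteq> U" using Basis s by blast
  ultimately obtain e where e: "e > 0" "(\<Union>z\<in>char_app \<gamma> ` K. ball z e) \<subseteq> U"
    using compact_subset_open_imp_ball_epsilon_subset s(3) by metis
  have "char_nhd \<gamma> K e \<subseteq> s"
  proof
    fix \<delta> assume \<delta>: "\<delta> \<in> char_nhd \<gamma> K e"
    have "char_app \<delta> x \<in> U" if "x \<in> K" for x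
    proof -
      have "char_app \<delta> x \<in> ball (char_app \<gamma> x) e"
        using \<delta> that by (auto simp: char_nhd_def dist_norm norm_minus_commute)
      then show ?thesis using e(2) that by blast
    qed
    then show "\<delta> \<in> s" by (auto simp: s)
  qed
  then show ?case using s(2) e(1) by blast
qed

text \<open>
  Finitely many compact pieces of \<open>K\<close>, on each of which \<open>\<gamma>\<close> is nearly constant, cover \<open>K\<close>. A character
  that maps each piece into a small ball around the value of \<open>\<gamma>\<close> there is uniformly close to \<open>\<gamma>\<close>.
\<close>
lemma char_nhd_contains_open:
  assumes K: "compact K" and e: "e > 0"
  shows "\<exists>S. open S \<and> \<gamma> \<in> S \<and> S \<subseteq> char_nhd \<gamma> K e"
proof -
  define D where "D = (\<lambda>x. {y. cmod (char_app \<gamma> y - char_app \<gamma> x) < e / 3})"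
  have "open (D x)" for x
    unfolding D_def by (intro open_Collect_less continuous_intros char_app_continuous)
  moreover have "K \<subseteq> (\<Union>x\<in>K. D x)" using e by (auto simp: D_def)
  ultimately obtain F where F: "F \<subseteq> K" "finite F" "K \<subseteq> (\<Union>x\<in>F. D x)"
    using K by (metis compactE_image)
  define C where "C = (\<lambda>x. K \<inter> {y. cmod (char_app \<gamma> y - char_app \<gamma> x) \<le> e / 3})"
  have "compact (C x)" for x
    unfolding C_def using K
    by (intro compact_Int_closed closed_Collect_le continuous_intros char_app_continuous)
  then have "open (\<Inter>x\<in>F. {\<delta>. char_app \<delta> ` C x \<subseteq> ball (char_app \<gamma> x) (e / 2)})"
    using F(2) by (intro open_INT ballI open_compact_open) auto
  moreover have "\<gamma> \<in> (\<Inter>x\<in>F. {\<delta>. char_app \<delta> ` C x \<subseteq> ball (char_app \<gamma> x) (e / 2)})"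
    using e by (auto simp: C_def dist_norm norm_minus_commute)
  moreover have "(\<Inter>x\<in>F. {\<delta>. char_app \<delta> ` C x \<subseteq> ball (char_app \<gamma> x) (e / 2)}) \<subseteq> char_nhd \<gamma> K e"
  proof
    fix \<delta> assume \<delta>: "\<delta> \<in> (\<Inter>x\<in>F. {\<delta>. char_app \<delta> ` C x \<subseteq> ball (char_app \<gamma> x) (e / 2)})"
    have "cmod (char_app \<delta> y - char_app \<gamma> y) < e" if y: "y \<in> K" for y
    proof -
      obtain x where x: "x \<in> F" "cmod (char_app \<gamma> y - char_app \<gamma> x) < e / 3"
        using F(3) y by (auto simp: D_def)
      then have "char_app \<delta> y \<in> ball (char_app \<gamma> x) (e / 2)"
        using \<delta> y by (auto simp: C_def image_subset_iff)
      then have "cmod (char_app \<delta> y - char_app \<gamma> x) < e / 2"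
        by (simp add: dist_norm norm_minus_commute)
      then have "cmod ((char_app \<delta> y - char_app \<gamma> x) - (char_app \<gamma> y - char_app \<gamma> x)) < e / 2 + e / 3"
        using x(2) norm_triangle_ineq4[of "char_app \<delta> y - char_app \<gamma> x" "char_app \<gamma> y - char_app \<gamma> x"]
        by linarith
      then show ?thesis using e by simp
    qed
    then show "\<delta> \<in> char_nhd \<gamma> K e" by (simp add: char_nhd_def)
  qed
  ultimately show ?thesis by blast
qed

lemma eventually_nhds_character:
  "eventually R (nhds \<gamma>) \<longleftrightarrow> (\<exists>K e. compact K \<and> e > 0 \<and> (\<forall>\<delta>\<in>char_nhd \<gamma> K e. R \<delta>))"
proof
  assume "eventually R (nhds \<gamma>)"
  then obtain S where "open S" "\<gamma> \<in> S" "\<forall>\<delta>\<in>S. R \<delta>" by (auto simp: eventually_nhds)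
  then show "\<exists>K e. compact K \<and> e > 0 \<and> (\<forall>\<delta>\<in>char_nhd \<gamma> K e. R \<delta>)"
    using char_nhd_subset_open[of S \<gamma>] by blast
next
  assume "\<exists>K e. compact K \<and> e > 0 \<and> (\<forall>\<delta>\<in>char_nhd \<gamma> K e. R \<delta>)"
  then obtain K e where "compact K" "e > 0" "\<forall>\<delta>\<in>char_nhd \<gamma> K e. R \<delta>" by blast
  then show "eventually R (nhds \<gamma>)"
    using char_nhd_contains_open[of K e \<gamma>] unfolding eventually_nhds by blast
qed

instance character :: (topological_ab_group_add) topological_ab_group_add
proof
  fix a b :: "'a character"
  show "LIM x (nhds a \<times>\<^sub>F nhds b). fst x + snd x :> nhds (a + b)"
    unfolding filterlim_iff
  proof (intro allI impI)
    fix R assume "eventually R (nhds (a + b))"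
    then obtain K e where Ke: "compact K" "e > 0" "\<forall>\<delta>\<in>char_nhd (a + b) K e. R \<delta>"
      by (auto simp: eventually_nhds_character)
    have "eventually (\<lambda>\<gamma>. \<gamma> \<in> char_nhd a K (e/2)) (nhds a)" "eventually (\<lambda>\<gamma>. \<gamma> \<in> char_nhd b K (e/2)) (nhds b)"
      using Ke by (auto simp: eventually_nhds_character intro!: exI[of _ K] exI[of _ "e/2"])
    then have "eventually (\<lambda>p. fst p \<in> char_nhd a K (e/2) \<and> snd p \<in> char_nhd b K (e/2)) (nhds a \<times>\<^sub>F nhds b)"
      by (auto simp: eventually_prod_filter)
    then show "eventually (\<lambda>x. R (fst x + snd x)) (nhds a \<times>\<^sub>F nhds b)"
    proof (rule eventually_mono)
      fix p :: "'a character \<times> 'a character"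
      assume p: "fst p \<in> char_nhd a K (e/2) \<and> snd p \<in> char_nhd b K (e/2)"
      have "cmod (char_app (fst p + snd p) x - char_app (a + b) x) < e" if "x \<in> K" for x
      proof -
        have "char_app (fst p + snd p) x - char_app (a + b) x
          = (char_app (fst p) x - char_app a x) * char_app (snd p) x + char_app a x * (char_app (snd p) x - char_app b x)"
          by (simp add: char_app_plus algebra_simps)
        also have "cmod \<dots> \<le> cmod (char_app (fst p) x - char_app a x) + cmod (char_app (snd p) x - char_app b x)"
          by (rule order_trans[OF norm_triangle_ineq]) (simp add: norm_mult)
        also have "\<dots> < e / 2 + e / 2"
          using p that by (intro add_strict_mono) (auto simp: char_nhd_def)
        finally show ?thesis by simp
      qed
      then show "R (fst p + snd p)" using Ke(3) by (simp add: char_nhd_def)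
    qed
  qed
  show "(uminus \<longlongrightarrow> - a) (nhds a)"
    unfolding filterlim_iff
  proof (intro allI impI)
    fix R assume "eventually R (nhds (- a))"
    then obtain K e where Ke: "compact K" "e > 0" "\<forall>\<delta>\<in>char_nhd (- a) K e. R \<delta>"
      by (auto simp: eventually_nhds_character)
    have "- \<gamma> \<in> char_nhd (- a) K e" if "\<gamma> \<in> char_nhd a K e" for \<gamma>
    proof -
      have "cmod (cnj (char_app \<gamma> x) - cnj (char_app a x)) = cmod (char_app \<gamma> x - char_app a x)" for x
        by (metis complex_cnj_diff complex_mod_cnj)
      then show ?thesis using that by (simp add: char_nhd_def char_app_uminus)
    qed
    then show "\<forall>\<^sub>F x in nhds a. R (- x)"
      using Ke by (auto simp: eventually_nhds_character)
  qed
qed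

instance character :: (topological_ab_group_add) t2_space
proof
  fix \<gamma> \<delta> :: "'a character" assume "\<gamma> \<noteq> \<delta>"
  then obtain x where "char_app \<gamma> x \<noteq> char_app \<delta> x"
    by (metis char_app_inject ext)
  then obtain U W where UW: "open U" "open W" "char_app \<gamma> x \<in> U" "char_app \<delta> x \<in> W" "U \<inter> W = {}"
    using hausdorff by metis
  show "\<exists>U V. open U \<and> open V \<and> \<gamma> \<in> U \<and> \<delta> \<in> V \<and> U \<inter> V = {}"
  proof (intro exI conjI)
    show "open {\<gamma>. char_app \<gamma> ` {x} \<subseteq> U}" "open {\<gamma>. char_app \<gamma> ` {x} \<subseteq> W}"
      using UW by (intro open_compact_open; simp)+
  qed (use UW in auto)
qed

text \<open>
  Local compactness supplies a compact neighbourhood of the point, on which nearby characters are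
  uniformly close. The lemma makes the coefficients measurable functions on phase space.
\<close>
lemma char_app_jointly_continuous:
  assumes lc: "locally_compact_space (euclidean :: 'a::{topological_ab_group_add, t2_space} topology)"
  shows "continuous_on UNIV (\<lambda>p :: 'a \<times> 'a character. char_app (snd p) (fst p))"
  unfolding continuous_on_def
proof
  fix p :: "'a \<times> 'a character"
  show "((\<lambda>p. char_app (snd p) (fst p)) \<longlongrightarrow> char_app (snd p) (fst p)) (at p)"
  proof (rule tendstoI)
    fix e :: real assume e: "e > 0"
    obtain x \<gamma> where p: "p = (x, \<gamma>)" by (cases p)
    obtain U K where UK: "open U" "x \<in> U" "U \<subseteq> K" "compact K"
      using compact_closed_neighbourhood[OF lc open_UNIV UNIV_I[of x]] by metis
    have "((char_app \<gamma>) \<longlongrightarrow> char_app \<gamma> x) (nhds x)"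
      using char_app_continuous[of UNIV \<gamma>]
      by (simp add: continuous_on_def tendsto_at_iff_tendsto_nhds)
    then have "eventually (\<lambda>y. dist (char_app \<gamma> y) (char_app \<gamma> x) < e/2) (nhds x)"
      using e by (intro tendstoD) auto
    moreover have "eventually (\<lambda>y. y \<in> K) (nhds x)"
      using UK by (auto simp: eventually_nhds)
    ultimately have "eventually (\<lambda>y. dist (char_app \<gamma> y) (char_app \<gamma> x) < e/2 \<and> y \<in> K) (nhds x)"
      by (rule eventually_conj)
    moreover have "eventually (\<lambda>\<delta>. \<delta> \<in> char_nhd \<gamma> K (e/2)) (nhds \<gamma>)"
      using UK e by (auto simp: eventually_nhds_character intro!: exI[of _ K] exI[of _ "e/2"])
    ultimately have "eventually (\<lambda>q. (dist (char_app \<gamma> (fst q)) (char_app \<gamma> x) < e/2 \<and> fst q \<in> K) \<and> snd q \<in> char_nhd \<gamma> K (e/2)) (nhds x \<times>\<^sub>F nhds \<gamma>)"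
      by (auto simp: eventually_prod_filter)
    then have "eventually (\<lambda>q. dist (char_app (snd q) (fst q)) (char_app \<gamma> x) < e) (nhds x \<times>\<^sub>F nhds \<gamma>)"
    proof (rule eventually_mono)
      fix q assume q: "(dist (char_app \<gamma> (fst q)) (char_app \<gamma> x) < e/2 \<and> fst q \<in> K) \<and> snd q \<in> char_nhd \<gamma> K (e/2)"
      then have "dist (char_app (snd q) (fst q)) (char_app \<gamma> (fst q)) < e/2"
        by (auto simp: char_nhd_def dist_norm)
      then show "dist (char_app (snd q) (fst q)) (char_app \<gamma> x) < e"
        using q dist_triangle[of "char_app (snd q) (fst q)" "char_app \<gamma> x" "char_app \<gamma> (fst q)"] by linarith
    qed
    then show "eventually (\<lambda>q. dist (char_app (snd q) (fst q)) (char_app (snd p) (fst p)) < e) (at p)"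
      unfolding p by (simp add: nhds_prod[symmetric] eventually_nhds_conv_at)
  qed
qed

text \<open>
  The subbasic sets given by the compact closures of members of a countable base of the group, and by
  members of a countable base of the complex plane, already generate the topology.
\<close>
lemma second_countable_character:
  assumes lc: "locally_compact_space (euclidean :: 'a topology)"
  shows "second_countable (euclidean :: 'a::{topological_ab_group_add, t2_space, second_countable_topology} character topology)"
proof -
  obtain B :: "'a set set" where B: "countable B" "topological_basis B"
    using ex_countable_basis by blast
  obtain C :: "complex set set" where C: "countable C" "topological_basis C"
    using ex_countable_basis by blast
  define sub where "sub = (\<lambda>(b, U). {\<gamma> :: 'a character. char_app \<gamma> ` closure b \<subseteq> U}) ` ({b \<in> B. compact (closure b)} \<times> C)"
  have csub: "countable sub"
    unfolding sub_def using B(1) C(1) by (intro countable_image countable_SIGMA) (auto intro: countable_subset)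
  have osub: "open s" if s: "s \<in> sub" for s
  proof -
    obtain b U where "s = {\<gamma>. char_app \<gamma> ` closure b \<subseteq> U}" "compact (closure b)" "U \<in> C"
      using s by (auto simp: sub_def)
    then show ?thesis using open_compact_open topological_basis_open[OF C(2)] by metis
  qed
  let ?Base = "Inter ` {F. finite F \<and> F \<subseteq> sub}"
  have c: "countable ?Base"
    using csub by (intro countable_image countable_Collect_finite_subset)
  have o: "\<forall>s\<in>?Base. openin euclidean s"
    using osub by (auto intro!: open_Inter)
  have nb: "\<exists>s\<in>?Base. \<gamma> \<in> s \<and> s \<subseteq> S" if S: "open S" "\<gamma> \<in> S" for S \<gamma>
  proof -
    obtain K e where Ke: "compact K" "e > 0" "char_nhd \<gamma> K e \<subseteq> S"
      using char_nhd_subset_open[OF S] by blast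
    have "\<exists>b U. b \<in> B \<and> U \<in> C \<and> x \<in> b \<and> compact (closure b) \<and> char_app \<gamma> ` closure b \<subseteq> U
        \<and> U \<subseteq> ball (char_app \<gamma> x) (e / 2)" for x
    proof -
      obtain U where U: "U \<in> C" "char_app \<gamma> x \<in> U" "U \<subseteq> ball (char_app \<gamma> x) (e/2)"
        using topological_basisE[OF C(2) open_ball, of "char_app \<gamma> x" "char_app \<gamma> x" "e/2"] Ke(2) by auto
      have "open (char_app \<gamma> -` U)"
        using topological_basis_open[OF C(2) U(1)] by (intro open_vimage char_app_continuous)
      then obtain W L where W: "open W" "x \<in> W" "W \<subseteq> L" "compact L" "closed L" "L \<subseteq> char_app \<gamma> -` U"
        using compact_closed_neighbourhood[OF lc, of "char_app \<gamma> -` U" x] U(2) by auto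
      obtain b where b: "b \<in> B" "x \<in> b" "b \<subseteq> W"
        using topological_basisE[OF B(2) W(1,2)] by blast
      have cb: "closure b \<subseteq> L" using b W by (intro closure_minimal) auto
      moreover have "compact (closure b)"
        using compact_Int_closed[OF W(4) closed_closure[of b]] cb by (simp add: Int_absorb1)
      ultimately show ?thesis using b U W(6) by (intro exI[of _ b] exI[of _ U]) auto
    qed
    then obtain b U where bU: "\<And>x. b x \<in> B" "\<And>x. U x \<in> C" "\<And>x. x \<in> b x" "\<And>x. compact (closure (b x))"
      "\<And>x. char_app \<gamma> ` closure (b x) \<subseteq> U x" "\<And>x. U x \<subseteq> ball (char_app \<gamma> x) (e / 2)"
      by metis
    have "open (b x)" for x using topological_basis_open[OF B(2) bU(1)] .
    moreover have "K \<subseteq> (\<Union>x\<in>K. b x)" using bU(3) by blast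
    ultimately obtain F where F: "F \<subseteq> K" "finite F" "K \<subseteq> (\<Union>x\<in>F. b x)"
      using Ke(1) by (metis compactE_image)
    let ?s = "\<lambda>x. {\<delta> :: 'a character. char_app \<delta> ` closure (b x) \<subseteq> U x}"
    have inB: "\<Inter>(?s ` F) \<in> ?Base"
      using F(2) bU(1,2,4) by (intro image_eqI[OF refl]) (auto simp: sub_def)
    have mem: "\<gamma> \<in> \<Inter>(?s ` F)" using bU(5) by blast
    have sub: "\<Inter>(?s ` F) \<subseteq> char_nhd \<gamma> K e"
    proof
      fix \<delta> assume \<delta>: "\<delta> \<in> \<Inter>(?s ` F)"
      have "cmod (char_app \<delta> y - char_app \<gamma> y) < e" if y: "y \<in> K" for y
      proof -
        obtain x where x: "x \<in> F" "y \<in> b x" using F(3) y by blast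
        then have y': "y \<in> closure (b x)" using closure_subset by blast
        have "char_app \<delta> y \<in> ball (char_app \<gamma> x) (e / 2)" "char_app \<gamma> y \<in> ball (char_app \<gamma> x) (e / 2)"
          using \<delta> x y' bU(5,6)[of x] by blast+
        then have "dist (char_app \<delta> y) (char_app \<gamma> y) < e"
          using dist_triangle_half_r[of "char_app \<gamma> x"] by auto
        then show ?thesis by (simp add: dist_norm)
      qed
      then show "\<delta> \<in> char_nhd \<gamma> K e" by (simp add: char_nhd_def)
    qed
    show ?thesis
      by (intro bexI[OF _ inB] conjI mem order_trans[OF sub Ke(3)])
  qed
  show ?thesis
    unfolding second_countable_def
  proof (intro exI[of _ ?Base] conjI c o allI impI)
    fix S :: "'a character set" and \<gamma>
    assume "openin euclidean S \<and> \<gamma> \<in> S"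
    then show "\<exists>s\<in>?Base. \<gamma> \<in> s \<and> s \<subseteq> S" by (intro nb) auto
  qed
qed

text \<open>
  Since \<open>z\<^sup>2 - 1 = (z - 1) (z + 1)\<close> and \<open>|z + 1| \<ge> 3/2\<close>, halving the argument of a multiplicative
  function that stays near \<open>1\<close> brings its value closer to \<open>1\<close> by the factor \<open>2/3\<close>.
\<close>
lemma doubling_contraction:
  fixes z :: complex
  assumes "cmod (z - 1) \<le> 1 / 2"
  shows "cmod (z - 1) \<le> 2 / 3 * cmod (z * z - 1)"
proof -
  have "2 - cmod (z - 1) \<le> cmod (z + 1)"
    using norm_triangle_ineq4[of "z + 1" "z - 1"] by simp
  then have "3 / 2 \<le> cmod (z + 1)" using assms by simp
  then have "cmod (z - 1) * (3 / 2) \<le> cmod (z - 1) * cmod (z + 1)"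
    by (intro mult_left_mono) auto
  also have "\<dots> = cmod (z * z - 1)"
    by (simp add: norm_mult[symmetric] algebra_simps)
  finally show ?thesis by simp
qed

definition multiplicative_near_one :: "'a::plus set \<Rightarrow> ('a \<Rightarrow> complex) set"
  where "multiplicative_near_one S =
    {f. (\<forall>x y. f (x + y) = f x * f y) \<and> (\<forall>x\<in>S. cmod (f x - 1) \<le> 1 / 2)}"

text \<open>
  Take \<open>S\<close> to consist of the points whose first \<open>n\<close> doublings stay in \<open>O0\<close>, and apply
  \<open>doubling_contraction\<close> \<open>n\<close> times. The same \<open>S\<close> serves all \<open>f\<close>, so the unimodular functions among them
  are equicontinuous; this is what makes pointwise limits of characters continuous.
\<close>
lemma equicontinuity_at_zero:
  fixes O0 :: "'a::topological_ab_group_add set"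
  assumes "open O0" "0 \<in> O0"
  shows "\<exists>S. open S \<and> 0 \<in> S \<and> S \<subseteq> O0 \<and>
    (\<forall>f\<in>multiplicative_near_one O0. \<forall>x\<in>S. cmod (f x - 1) \<le> (2 / 3) ^ n / 2)"
proof (induction n)
  case 0
  show ?case by (rule exI[of _ O0]) (use assms in \<open>auto simp: multiplicative_near_one_def\<close>)
next
  case (Suc n)
  then obtain S where S: "open S" "0 \<in> S" "S \<subseteq> O0"
    "\<And>f x. f \<in> multiplicative_near_one O0 \<Longrightarrow> x \<in> S \<Longrightarrow> cmod (f x - 1) \<le> (2 / 3) ^ n / 2" by blast
  show ?case
  proof (intro exI[of _ "S \<inter> (\<lambda>x. x + x) -` S"] conjI allI impI ballI)
    show "open (S \<inter> (\<lambda>x. x + x) -` S)"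
      using S(1) by (intro open_Int open_vimage continuous_intros)
    fix f :: "'a \<Rightarrow> complex" and x
    assume f: "f \<in> multiplicative_near_one O0"
      and x: "x \<in> S \<inter> (\<lambda>x. x + x) -` S"
    have "cmod (f x - 1) \<le> 2 / 3 * cmod (f x * f x - 1)"
      using f x S(3) by (intro doubling_contraction) (auto simp: multiplicative_near_one_def)
    also have "f x * f x = f (x + x)" using f by (simp add: multiplicative_near_one_def)
    also have "2 / 3 * cmod (f (x + x) - 1) \<le> 2 / 3 * ((2 / 3) ^ n / 2)"
      using S(4)[of f "x + x"] f x by (intro mult_left_mono) auto
    finally show "cmod (f x - 1) \<le> (2 / 3) ^ Suc n / 2" by simp
  qed (use S in auto)
qed

text \<open>
  The dual group is locally compact. The multiplicative functions into the unit circle that stay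
  within \<open>1/2\<close> of \<open>1\<close> on a compact neighbourhood \<open>K\<close> of zero form a closed subset of a product of
  circles, which is compact by Tychonoff's theorem. By equicontinuity they are all continuous, and
  pointwise convergence among them is locally uniform; so this compact set maps continuously into
  the dual group, onto a neighbourhood of the trivial character.
\<close>
lemma compact_neighbourhood_character:
  assumes lc: "locally_compact_space (euclidean :: 'a topology)"
  obtains U W :: "'a::{topological_ab_group_add, t2_space} character set"
  where "open U" "0 \<in> U" "U \<subseteq> W" "compact W"
proof -
  obtain O0 K where OK: "open O0" "(0::'a) \<in> O0" "O0 \<subseteq> K" "compact K"
    using compact_closed_neighbourhood[OF lc open_UNIV UNIV_I[of 0]] by metis
  define X where "X = {f :: 'a \<Rightarrow> complex. (\<forall>x y. f (x + y) = f x * f y) \<and> (\<forall>x. cmod (f x) = 1)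
    \<and> (\<forall>x\<in>K. cmod (f x - 1) \<le> 1 / 2)}"
  have equi: "\<exists>S. open S \<and> 0 \<in> S \<and> (\<forall>f\<in>X. \<forall>x\<in>S. cmod (f x - 1) < e)" if e: "e > 0" for e
  proof -
    obtain n where n: "(2 / 3 :: real) ^ n < e"
      using real_arch_pow_inv[OF e, of "2/3"] by auto
    obtain S where S: "open S" "0 \<in> S" "\<And>f x. f \<in> multiplicative_near_one O0 \<Longrightarrow> x \<in> S \<Longrightarrow> cmod (f x - 1) \<le> (2 / 3) ^ n / 2"
      using equicontinuity_at_zero[OF OK(1,2), of n] by blast
    have "cmod (f x - 1) < e" if "f \<in> X" "x \<in> S" for f x
    proof -
      have "cmod (f x - 1) \<le> (2 / 3) ^ n / 2"
        using that OK(3) by (intro S(3)) (auto simp: X_def multiplicative_near_one_def)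
      also have "\<dots> \<le> (2 / 3) ^ n" by simp
      finally show ?thesis using n by simp
    qed
    then show ?thesis using S(1,2) by blast
  qed
  have diff: "cmod (f (x + s) - f x) = cmod (f s - 1)" if "f \<in> X" for f x s
  proof -
    have "f (x + s) - f x = f x * (f s - 1)" using that by (simp add: X_def algebra_simps)
    then show ?thesis using that by (simp add: norm_mult X_def)
  qed
  have cont: "continuous_on UNIV f" if f: "f \<in> X" for f
    unfolding continuous_on_def
  proof
    fix x
    show "(f \<longlongrightarrow> f x) (at x)"
    proof (rule tendstoI)
      fix e :: real assume "e > 0"
      then obtain S where S: "open S" "0 \<in> S" "\<And>s. s \<in> S \<Longrightarrow> cmod (f s - 1) < e"
        using equi f by metis
      have "open ((\<lambda>y. y - x) -` S)" using S(1) by (intro open_vimage continuous_intros)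
      moreover have "dist (f y) (f x) < e" if "y \<in> (\<lambda>y. y - x) -` S" for y
        using diff[OF f, of x "y - x"] S(3)[of "y - x"] that by (simp add: dist_norm)
      ultimately show "\<forall>\<^sub>F y in at x. dist (f y) (f x) < e"
        unfolding eventually_at_topological using S(2) by (intro exI[of _ "(\<lambda>y. y - x) -` S"]) auto
    qed
  qed
  have char: "char_app (Abs_character f) = f" if "f \<in> X" for f
    using cont[OF that] that by (intro Abs_character_inverse) (auto simp: X_def)
  have coord: "continuous_on UNIV (\<lambda>f :: 'a \<Rightarrow> complex. f x)" for x
    by (rule continuous_on_product_coordinates)
  have "closed X"
  proof -
    have X: "X = (\<Inter>x. \<Inter>y. {f. f (x + y) = f x * f y}) \<inter> (\<Inter>x. {f. cmod (f x) = 1})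
      \<inter> (\<Inter>x\<in>K. {f. cmod (f x - 1) \<le> 1 / 2})"
      by (auto simp: X_def)
    show ?thesis unfolding X
      by (intro closed_Int closed_INT ballI closed_Collect_eq closed_Collect_le continuous_intros coord)
  qed
  moreover have "compact (PiE UNIV (\<lambda>_::'a. sphere (0::complex) 1))"
    using compactin_PiE[of "\<lambda>_::'a. euclidean :: complex topology" UNIV "\<lambda>_. sphere 0 1"]
    by (simp add: euclidean_product_topology)
  moreover have "X \<subseteq> PiE UNIV (\<lambda>_. sphere 0 1)" by (auto simp: X_def)
  ultimately have "compact X" by (metis closed_Int_compact inf.absorb_iff1)
  moreover have "continuous_on X Abs_character"
    unfolding continuous_on_topological
  proof (intro ballI allI impI)
    fix f B assume f: "f \<in> X" and B: "open B" "Abs_character f \<in> B"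
    obtain L e where Le: "compact L" "e > 0" "char_nhd (Abs_character f) L e \<subseteq> B"
      using char_nhd_subset_open[OF B] by blast
    obtain S where S: "open S" "0 \<in> S" "\<And>f s. f \<in> X \<Longrightarrow> s \<in> S \<Longrightarrow> cmod (f s - 1) < e / 3"
      using equi[of "e / 3"] Le(2) by auto
    have "open ((\<lambda>y. y - x) -` S)" for x using S(1) by (intro open_vimage continuous_intros)
    moreover have "L \<subseteq> (\<Union>x\<in>L. (\<lambda>y. y - x) -` S)" using S(2) by auto
    ultimately obtain F where F: "F \<subseteq> L" "finite F" "L \<subseteq> (\<Union>x\<in>F. (\<lambda>y. y - x) -` S)"
      using Le(1) by (metis compactE_image)
    let ?A = "{h. \<forall>x\<in>F. h x \<in> ball (f x) (e / 3)}"
    have "open ?A" using product_topology_basis'[OF F(2), of "\<lambda>x. ball (f x) (e/3)" "\<lambda>x. x"] by simp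
    moreover have "f \<in> ?A" using Le(2) by simp
    moreover have "Abs_character h \<in> B" if h: "h \<in> X" "h \<in> ?A" for h
    proof -
      have "cmod (h y - f y) < e" if y: "y \<in> L" for y
      proof -
        obtain x where x: "x \<in> F" "y - x \<in> S" using F(3) y by auto
        have "cmod (h y - h x) < e / 3" "cmod (f y - f x) < e / 3"
          using diff[OF h(1), of x "y - x"] diff[OF f, of x "y - x"] S(3)[OF h(1) x(2)] S(3)[OF f x(2)]
          by auto
        moreover have "cmod (h x - f x) < e / 3"
          using h(2) x(1) by (auto simp: dist_norm norm_minus_commute)
        moreover have "cmod (h y - f y) \<le> cmod (h y - h x) + cmod (h x - f x) + cmod (f y - f x)"
          using norm_triangle_ineq4[of "(h y - h x) + (h x - f x)" "f y - f x"]
            norm_triangle_ineq[of "h y - h x" "h x - f x"] by simp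
        ultimately show ?thesis by linarith
      qed
      then have "Abs_character h \<in> char_nhd (Abs_character f) L e"
        by (simp add: char_nhd_def char f h)
      then show ?thesis using Le(3) by blast
    qed
    ultimately show "\<exists>A. open A \<and> f \<in> A \<and> (\<forall>y\<in>X. y \<in> A \<longrightarrow> Abs_character y \<in> B)" by blast
  qed
  ultimately have comp: "compact (Abs_character ` X)" by (intro compact_continuous_image)
  obtain U where U: "open U" "0 \<in> U" "U \<subseteq> char_nhd 0 K (1 / 2)"
    using char_nhd_contains_open[OF OK(4), of "1 / 2" 0] by auto
  have "\<gamma> \<in> Abs_character ` X" if "\<gamma> \<in> U" for \<gamma>
  proof (rule image_eqI)
    show "\<gamma> = Abs_character (char_app \<gamma>)" by (simp add: char_app_inverse)
    show "char_app \<gamma> \<in> X"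
      using that U(3) by (auto simp: X_def char_app_add_arg char_nhd_def char_app_zero intro: less_imp_le)
  qed
  then show ?thesis using that[OF U(1,2) _ comp] by blast
qed

section \<open>The quotient by a discrete subgroup\<close>

text \<open>
  The part of the theory of Haar measure on quotients that is needed here works for any discrete
  subgroup of a second countable locally compact group with a given invariant measure \<open>P\<close>.
\<close>
locale discrete_quotient =
  fixes P :: "'b::topological_ab_group_add measure" and \<Delta> :: "'b set"
  assumes sets_P [measurable_cong]: "sets P = sets borel"
    and sigma_finite_P: "sigma_finite_measure P"
    and translate: "\<And>a A. A \<in> sets borel \<Longrightarrow> emeasure P ((+) a ` A) = emeasure P A"
    and nonzero: "emeasure P UNIV \<noteq> 0"
    and second_countable: "second_countable (euclidean :: 'b topology)"
    and compact_nhd: "\<exists>U K. open U \<and> 0 \<in> U \<and> U \<subseteq> K \<and> compact K \<and> emeasure P U < \<infinity>"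
    and subgroup: "is_subgroup \<Delta>"
    and discrete: "discrete \<Delta>"
begin

sublocale sigma_finite_measure P by (rule sigma_finite_P)

lemma space_P: "space P = UNIV"
  using sets_eq_imp_space_eq[OF sets_P] by simp

lemma zero_mem: "0 \<in> \<Delta>" and add_mem: "x \<in> \<Delta> \<Longrightarrow> y \<in> \<Delta> \<Longrightarrow> x + y \<in> \<Delta>"
  and minus_mem: "x \<in> \<Delta> \<Longrightarrow> - x \<in> \<Delta>"
  using subgroup by (auto simp: is_subgroup_def)

lemma diff_mem: "x \<in> \<Delta> \<Longrightarrow> y \<in> \<Delta> \<Longrightarrow> x - y \<in> \<Delta>"
  using add_mem minus_mem by (metis diff_conv_add_uminus)

lemma mem_coset: "x \<in> z +o \<Delta> \<longleftrightarrow> x - z \<in> \<Delta>"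
  by (force simp: elt_set_plus_def)

lemma coset_eq: "z +o \<Delta> = w +o \<Delta> \<longleftrightarrow> z - w \<in> \<Delta>"
proof
  assume "z +o \<Delta> = w +o \<Delta>"
  then show "z - w \<in> \<Delta>" using mem_coset zero_mem by (metis diff_self)
next
  assume zw: "z - w \<in> \<Delta>"
  show "z +o \<Delta> = w +o \<Delta>"
  proof (intro set_eqI)
    fix x
    have "x - w = (x - z) + (z - w)" "x - z = (x - w) - (z - w)" by simp_all
    then show "x \<in> z +o \<Delta> \<longleftrightarrow> x \<in> w +o \<Delta>"
      unfolding mem_coset using zw add_mem diff_mem by metis
  qed
qed

text \<open>
  The setwise sum of cosets, by which \<open>haar_measure\<close> translates the quotient, is the group operation
  of the quotient.
\<close>
lemma coset_add: "(a +o \<Delta>) + (c +o \<Delta>) = (a + c) +o \<Delta>"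
proof (intro set_eqI)
  fix x
  have "x - (a + c) \<in> \<Delta>" if "x = y + w" "y - a \<in> \<Delta>" "w - c \<in> \<Delta>" for y w
  proof -
    have "x - (a + c) = (y - a) + (w - c)" using that by simp
    then show ?thesis using add_mem[OF that(2,3)] by metis
  qed
  moreover have "\<exists>y w. x = y + w \<and> y - a \<in> \<Delta> \<and> w - c \<in> \<Delta>" if "x - (a + c) \<in> \<Delta>"
    by (rule exI[of _ a], rule exI[of _ "x - a"]) (use that zero_mem in \<open>simp add: diff_diff_add\<close>)
  moreover have "x \<in> (a +o \<Delta>) + (c +o \<Delta>) \<longleftrightarrow> (\<exists>y w. x = y + w \<and> y - a \<in> \<Delta> \<and> w - c \<in> \<Delta>)"
    unfolding set_plus_def Bex_def mem_Collect_eq mem_coset by blast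
  ultimately show "x \<in> (a +o \<Delta>) + (c +o \<Delta>) \<longleftrightarrow> x \<in> (a + c) +o \<Delta>"
    unfolding mem_coset by blast
qed

text \<open>
  A neighbourhood of zero so small that every translate of it injects into the quotient. It exists
  because \<open>0\<close> is isolated in \<open>\<Delta>\<close>.
\<close>
definition V :: "'b set"
  where "V = (SOME V. open V \<and> 0 \<in> V \<and> (\<forall>x\<in>V. \<forall>y\<in>V. x - y \<in> \<Delta> \<longrightarrow> x = y))"

lemma V: "open V" "0 \<in> V" "x \<in> V \<Longrightarrow> y \<in> V \<Longrightarrow> x - y \<in> \<Delta> \<Longrightarrow> x = y"
proof -
  obtain T where T: "open T" "T \<inter> \<Delta> = {0}"
    using discrete zero_mem by (meson discreteD isolated_inE)
  obtain W where W: "open W" "0 \<in> W" "\<And>x y. x \<in> W \<Longrightarrow> y \<in> W \<Longrightarrow> x - y \<in> T"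
    using symmetric_difference_nhd[of T] T by blast
  have ex: "\<exists>V. open V \<and> 0 \<in> V \<and> (\<forall>x\<in>V. \<forall>y\<in>V. x - y \<in> \<Delta> \<longrightarrow> x = y)"
  proof (rule exI[of _ W], intro conjI ballI impI W)
    fix x y assume "x \<in> W" "y \<in> W" "x - y \<in> \<Delta>"
    then have "x - y \<in> T \<inter> \<Delta>" using W by blast
    then show "x = y" using T by simp
  qed
  show "open V" "0 \<in> V" "x \<in> V \<Longrightarrow> y \<in> V \<Longrightarrow> x - y \<in> \<Delta> \<Longrightarrow> x = y"
    using someI_ex[OF ex, folded V_def] by blast+
qed

definition centre :: "nat \<Rightarrow> 'b"
  where "centre = (SOME z. \<forall>x. \<exists>n. x - z n \<in> V)"

lemma centre: "\<exists>n. x - centre n \<in> V"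
proof -
  have "\<exists>z :: nat \<Rightarrow> 'b. \<forall>x. \<exists>n. x - z n \<in> V"
    using Lindelof_translates[OF second_countable V(1,2)] by metis
  from someI_ex[OF this, folded centre_def] show ?thesis by blast
qed

lemma open_shift: "open A \<Longrightarrow> open {x. x - a \<in> A}" "open A \<Longrightarrow> open {x. x + a \<in> A}"
  for A :: "'b set"
  using open_vimage[of A "\<lambda>x. x - a"] open_vimage[of A "\<lambda>x. x + a"]
  by (simp_all add: vimage_def continuous_intros)

lemma countable_\<Delta>: "countable \<Delta>"
proof -
  define i where "i = (\<lambda>x. LEAST n. x - centre n \<in> V)"
  have i: "x - centre (i x) \<in> V" for x
    unfolding i_def using centre[of x] by (rule LeastI_ex)
  have "inj_on i \<Delta>"
  proof (rule inj_onI)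
    fix x y assume xy: "x \<in> \<Delta>" "y \<in> \<Delta>" "i x = i y"
    have "(x - centre (i x)) - (y - centre (i x)) \<in> \<Delta>" using diff_mem[OF xy(1,2)] by simp
    then have "x - centre (i x) = y - centre (i x)" using V(3) i xy(3) by metis
    then show "x = y" by simp
  qed
  then show ?thesis by (rule countableI)
qed

text \<open>
  A Borel fundamental domain: from the \<open>n\<close>-th translate of \<open>V\<close> only those points are kept whose coset
  has not met an earlier translate.
\<close>
definition F :: "'b set"
  where "F = (\<Union>n. {x. x - centre n \<in> V} \<inter> (\<Inter>m\<in>{..<n}. \<Inter>\<nu>\<in>\<Delta>. {x. x + \<nu> - centre m \<notin> V}))"

lemma shift_measurable [measurable]: "(\<lambda>x. x + a) \<in> borel_measurable (borel :: 'b measure)"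
  "(\<lambda>x. x - a) \<in> borel_measurable (borel :: 'b measure)"
  by (intro borel_measurable_continuous_onI continuous_intros)+

lemma F_borel [measurable]: "F \<in> sets borel"
proof -
  have 1: "{x. x - centre n \<in> V} \<in> sets borel" for n
    using open_shift(1)[OF V(1)] by simp
  have "closed {x. x + \<nu> - centre m \<notin> V}" for \<nu> m
    using open_shift(2)[OF V(1), of "\<nu> - centre m"] by (simp add: closed_def Compl_eq add_diff_eq)
  then have 2: "(\<Inter>m\<in>{..<n}. \<Inter>\<nu>\<in>\<Delta>. {x. x + \<nu> - centre m \<notin> V}) \<in> sets borel" for n
    by (intro borel_closed closed_INT ballI)
  show ?thesis unfolding F_def by (intro sets.countable_UN image_subsetI sets.Int 1 2)
qed

text \<open>
  Existence: choose the least \<open>n\<close> for which the coset of \<open>x\<close> meets the \<open>n\<close>-th translate of \<open>V\<close>.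
  Uniqueness: two points of a coset in \<open>F\<close> come from the same translate, which injects into the
  quotient.
\<close>
lemma F_ex1: "\<exists>!\<nu>. \<nu> \<in> \<Delta> \<and> x + \<nu> \<in> F"
proof -
  let ?Q = "\<lambda>n. \<exists>\<nu>\<in>\<Delta>. x + \<nu> - centre n \<in> V"
  have "\<exists>n. ?Q n" using centre[of x] zero_mem by (metis add.right_neutral)
  then have ex: "?Q (Least ?Q)" by (rule LeastI_ex)
  then obtain \<nu> where \<nu>: "\<nu> \<in> \<Delta>" "x + \<nu> - centre (Least ?Q) \<in> V" by blast
  have "x + \<nu> + \<mu> - centre m \<notin> V" if "m < Least ?Q" "\<mu> \<in> \<Delta>" for m \<mu>
    using not_less_Least[OF that(1)] add_mem[OF \<nu>(1) that(2)] by (auto simp: add.assoc)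
  then have mem: "x + \<nu> \<in> F"
    unfolding F_def using \<nu> by blast
  show ?thesis
  proof (rule ex1I[of _ \<nu>])
    show "\<nu> \<in> \<Delta> \<and> x + \<nu> \<in> F" using \<nu> mem by blast
    fix \<mu> assume \<mu>: "\<mu> \<in> \<Delta> \<and> x + \<mu> \<in> F"
    obtain n where n: "x + \<nu> - centre n \<in> V" "\<And>m \<rho>. m < n \<Longrightarrow> \<rho> \<in> \<Delta> \<Longrightarrow> x + \<nu> + \<rho> - centre m \<notin> V"
      using mem unfolding F_def by blast
    obtain k where k: "x + \<mu> - centre k \<in> V" "\<And>m \<rho>. m < k \<Longrightarrow> \<rho> \<in> \<Delta> \<Longrightarrow> x + \<mu> + \<rho> - centre m \<notin> V"
      using \<mu> unfolding F_def by blast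
    have "\<not> k < n" using n(2)[of k "\<mu> - \<nu>"] diff_mem \<mu> \<nu>(1) k(1) by (auto simp: algebra_simps)
    moreover have "\<not> n < k" using k(2)[of n "\<nu> - \<mu>"] diff_mem \<mu> \<nu>(1) n(1) by (auto simp: algebra_simps)
    ultimately have "n = k" by simp
    moreover have "(x + \<mu> - centre k) - (x + \<nu> - centre k) \<in> \<Delta>" using diff_mem \<mu> \<nu>(1) by simp
    ultimately have "x + \<mu> - centre k = x + \<nu> - centre k" using V(3) n(1) k(1) by blast
    then show "\<mu> = \<nu>" by simp
  qed
qed

lemma nn_integral_shift:
  "\<phi> \<in> borel_measurable borel \<Longrightarrow> (\<integral>\<^sup>+x. \<phi> (x + a) \<partial>P) = (\<integral>\<^sup>+x. \<phi> x \<partial>P)"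
  by (rule nn_integral_translate) (simp_all add: sets_P translate)

lemma nn_integral_F_unique:
  "(\<integral>\<^sup>+\<nu>. a * indicator F (x + \<nu>) \<partial>count_space \<Delta>) = a"
proof -
  obtain \<nu> where \<nu>: "\<nu> \<in> \<Delta>" "x + \<nu> \<in> F" "\<And>\<mu>. \<mu> \<in> \<Delta> \<Longrightarrow> x + \<mu> \<in> F \<Longrightarrow> \<mu> = \<nu>"
    using F_ex1[of x] by blast
  have "(\<integral>\<^sup>+\<nu>. a * indicator F (x + \<nu>) \<partial>count_space \<Delta>) = (\<integral>\<^sup>+\<mu>. a * indicator {\<nu>} \<mu> \<partial>count_space \<Delta>)"
  proof (rule nn_integral_cong)
    fix \<mu> assume "\<mu> \<in> space (count_space \<Delta>)"
    then have "\<mu> \<in> \<Delta>" by simp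
    then have "x + \<mu> \<in> F \<longleftrightarrow> \<mu> = \<nu>" using \<nu>(2) \<nu>(3)[of \<mu>] by metis
    then show "a * indicator F (x + \<mu>) = a * indicator {\<nu>} \<mu>"
      by (simp add: indicator_def)
  qed
  also have "\<dots> = a" using \<nu>(1) by (simp add: nn_integral_cmult_indicator)
  finally show ?thesis .
qed

lemma nn_integral_F_unique_minus:
  "(\<integral>\<^sup>+\<nu>. a * indicator F (x - \<nu>) \<partial>count_space \<Delta>) = a"
proof -
  have "bij_betw uminus \<Delta> \<Delta>"
    by (rule bij_betw_byWitness[where f' = uminus]) (auto simp: minus_mem)
  from nn_integral_bij_count_space[OF this, of "\<lambda>\<nu>. a * indicator F (x + \<nu>)"]
  show ?thesis by (simp add: nn_integral_F_unique)
qed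

text \<open>
  Weil's formula for nonnegative functions, with the quotient replaced by \<open>F\<close>. Since \<open>x - \<nu> \<in> F\<close> for
  exactly one \<open>\<nu> \<in> \<Delta>\<close>, the factor \<open>\<Sum>\<nu>. indicator F (x - \<nu>)\<close> may be inserted into the integral; exchange
  sum and integral and translate by \<open>\<nu>\<close>.
\<close>
lemma nn_integral_periodize:
  assumes [measurable]: "\<phi> \<in> borel_measurable borel"
  shows "(\<integral>\<^sup>+x. \<phi> x \<partial>P) = (\<integral>\<^sup>+x. indicator F x * (\<integral>\<^sup>+\<nu>. \<phi> (x + \<nu>) \<partial>count_space \<Delta>) \<partial>P)"
proof -
  have "(\<integral>\<^sup>+x. \<phi> x \<partial>P) = (\<integral>\<^sup>+x. \<integral>\<^sup>+\<nu>. \<phi> x * indicator F (x - \<nu>) \<partial>count_space \<Delta> \<partial>P)"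
    by (simp add: nn_integral_F_unique_minus)
  also have "\<dots> = (\<integral>\<^sup>+\<nu>. \<integral>\<^sup>+x. \<phi> x * indicator F (x - \<nu>) \<partial>P \<partial>count_space \<Delta>)"
    by (intro nn_integral_count_space_nn_integral countable_\<Delta>) measurable
  also have "\<dots> = (\<integral>\<^sup>+\<nu>. \<integral>\<^sup>+x. indicator F x * \<phi> (x + \<nu>) \<partial>P \<partial>count_space \<Delta>)"
  proof (rule nn_integral_cong)
    fix \<nu>
    have "(\<integral>\<^sup>+x. \<phi> x * indicator F (x - \<nu>) \<partial>P) = (\<integral>\<^sup>+x. \<phi> (x + \<nu>) * indicator F (x + \<nu> - \<nu>) \<partial>P)"
      by (rule nn_integral_shift[symmetric]) measurable
    then show "(\<integral>\<^sup>+x. \<phi> x * indicator F (x - \<nu>) \<partial>P) = (\<integral>\<^sup>+x. indicator F x * \<phi> (x + \<nu>) \<partial>P)"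
      by (simp add: mult.commute)
  qed
  also have "\<dots> = (\<integral>\<^sup>+x. \<integral>\<^sup>+\<nu>. indicator F x * \<phi> (x + \<nu>) \<partial>count_space \<Delta> \<partial>P)"
    by (intro nn_integral_count_space_nn_integral[symmetric] countable_\<Delta>) measurable
  finally show ?thesis by (simp add: nn_integral_cmult)
qed

lemma periodized_measurable:
  assumes [measurable]: "\<phi> \<in> borel_measurable borel"
  shows "(\<lambda>x. \<integral>\<^sup>+\<nu>. \<phi> (x + \<nu>) \<partial>count_space \<Delta>) \<in> borel_measurable (borel :: 'b measure)"
proof -
  interpret D: sigma_finite_measure "count_space \<Delta>"
    by (rule sigma_finite_measure_count_space_countable[OF countable_\<Delta>])
  have "(\<lambda>p. \<phi> (fst p + snd p)) \<in> borel_measurable ((borel :: 'b measure) \<Otimes>\<^sub>M count_space \<Delta>)"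
    by (rule measurable_compose_countable'[where f = "\<lambda>\<nu> p. \<phi> (fst p + \<nu>)" and g = snd, OF _ _ countable_\<Delta>])
      measurable
  from D.borel_measurable_nn_integral_fst[OF this] show ?thesis by simp
qed

text \<open>
  The form of Weil's formula used for the frame. It is stated with sums rather than differences so
  that it makes sense while the measure of \<open>F\<close> may still be infinite.
\<close>
lemma nn_integral_periodize_add:
  assumes [measurable]: "\<phi> \<in> borel_measurable borel" "\<psi> \<in> borel_measurable borel"
    and eq: "\<And>x. (\<integral>\<^sup>+\<nu>. \<psi> (x + \<nu>) \<partial>count_space \<Delta>) = (\<integral>\<^sup>+\<nu>. \<phi> (x + \<nu>) \<partial>count_space \<Delta>) + a"
  shows "(\<integral>\<^sup>+x. \<psi> x \<partial>P) = (\<integral>\<^sup>+x. \<phi> x \<partial>P) + a * emeasure P F"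
proof -
  note periodized_measurable [measurable]
  have "(\<integral>\<^sup>+x. \<psi> x \<partial>P) = (\<integral>\<^sup>+x. indicator F x * ((\<integral>\<^sup>+\<nu>. \<phi> (x + \<nu>) \<partial>count_space \<Delta>) + a) \<partial>P)"
    by (simp only: nn_integral_periodize[OF assms(2)] eq)
  also have "\<dots> = (\<integral>\<^sup>+x. indicator F x * (\<integral>\<^sup>+\<nu>. \<phi> (x + \<nu>) \<partial>count_space \<Delta>) + a * indicator F x \<partial>P)"
    by (simp add: distrib_left mult.commute)
  also have "\<dots> = (\<integral>\<^sup>+x. indicator F x * (\<integral>\<^sup>+\<nu>. \<phi> (x + \<nu>) \<partial>count_space \<Delta>) \<partial>P) + (\<integral>\<^sup>+x. a * indicator F x \<partial>P)"
    by (rule nn_integral_add) measurable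
  finally show ?thesis
    by (simp add: nn_integral_periodize[OF assms(1)] nn_integral_cmult_indicator sets_P)
qed

text \<open>
  Both \<open>F\<close> and its translate by \<open>a\<close> are fundamental domains, and a \<open>\<Delta>\<close>-invariant set has the same
  measure in each of them. This becomes the translation invariance of the quotient measure.
\<close>
lemma emeasure_F_invariant_shift:
  assumes [measurable]: "E \<in> sets borel" and inv: "\<And>x \<nu>. \<nu> \<in> \<Delta> \<Longrightarrow> x + \<nu> \<in> E \<longleftrightarrow> x \<in> E"
  shows "emeasure P (F \<inter> {x. x - a \<in> E}) = emeasure P (F \<inter> E)"
proof -
  have "emeasure P (F \<inter> E) = (\<integral>\<^sup>+x. indicator F x * indicator E x \<partial>P)"
    by (simp add: indicator_inter_arith[symmetric])
  also have "\<dots> = (\<integral>\<^sup>+x. indicator F (x + - a) * indicator E (x + - a) \<partial>P)"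
    by (rule nn_integral_shift[symmetric]) measurable
  also have "\<dots> = (\<integral>\<^sup>+x. indicator F x * (\<integral>\<^sup>+\<nu>. indicator F (x + \<nu> + - a) * indicator E (x + \<nu> + - a)
       \<partial>count_space \<Delta>) \<partial>P)"
    by (rule nn_integral_periodize) measurable
  also have "\<dots> = (\<integral>\<^sup>+x. indicator F x * indicator E (x - a) \<partial>P)"
  proof (intro nn_integral_cong arg_cong2[where f = "(*)"] refl)
    fix x
    have "(\<integral>\<^sup>+\<nu>. indicator F (x + \<nu> + - a) * indicator E (x + \<nu> + - a) \<partial>count_space \<Delta>)
      = (\<integral>\<^sup>+\<nu>. indicator E (x - a) * indicator F (x - a + \<nu>) \<partial>count_space \<Delta>)"
    proof (intro nn_integral_cong)
      fix \<nu> assume "\<nu> \<in> space (count_space \<Delta>)"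
      then have "x - a + \<nu> \<in> E \<longleftrightarrow> x - a \<in> E" by (intro inv) simp
      moreover have "x + \<nu> + - a = x - a + \<nu>" by simp
      ultimately show "indicator F (x + \<nu> + - a) * indicator E (x + \<nu> + - a)
        = (indicator E (x - a) * indicator F (x - a + \<nu>) :: ennreal)"
        by (simp only:) (simp add: indicator_def)
    qed
    then show "(\<integral>\<^sup>+\<nu>. indicator F (x + \<nu> + - a) * indicator E (x + \<nu> + - a) \<partial>count_space \<Delta>)
      = (indicator E (x - a) :: ennreal)"
      by (simp only: nn_integral_F_unique)
  qed
  also have "\<dots> = (\<integral>\<^sup>+x. indicator (F \<inter> {x. x - a \<in> E}) x \<partial>P)"
    by (intro nn_integral_cong) (auto simp: indicator_def)
  also have "\<dots> = emeasure P (F \<inter> {x. x - a \<in> E})"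
  proof (rule nn_integral_indicator)
    have "(\<lambda>x. x - a) -` E \<inter> space borel \<in> sets borel" by measurable
    then show "F \<inter> {x. x - a \<in> E} \<in> sets P" by (simp add: sets_P vimage_def)
  qed
  finally show ?thesis ..
qed

definition \<Sigma> :: "'b set measure"
  where "\<Sigma> = sigma (cosets \<Delta>) {U. openin (quotient_topology \<Delta>) U}"

lemma opens_sub: "{U. openin (quotient_topology \<Delta>) U} \<subseteq> Pow (cosets \<Delta>)"
  by (auto simp: openin_quotient_topology)

lemma space_\<Sigma>: "space \<Sigma> = cosets \<Delta>"
  and sets_\<Sigma>: "sets \<Sigma> = sigma_sets (cosets \<Delta>) {U. openin (quotient_topology \<Delta>) U}"
  unfolding \<Sigma>_def using opens_sub by (auto simp: space_measure_of sets_measure_of)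

lemma coset_measurable: "(\<lambda>z. z +o \<Delta>) \<in> measurable borel \<Sigma>"
  unfolding \<Sigma>_def
proof (rule measurable_measure_of[OF opens_sub])
  show "(\<lambda>z. z +o \<Delta>) \<in> space borel \<rightarrow> cosets \<Delta>" by (auto simp: cosets_def)
  fix U assume "U \<in> {U. openin (quotient_topology \<Delta>) U}"
  then show "(\<lambda>z. z +o \<Delta>) -` U \<inter> space borel \<in> sets borel"
    by (auto simp: openin_quotient_topology vimage_def)
qed

lemma coset_image_open:
  assumes "open A"
  shows "openin (quotient_topology \<Delta>) ((\<lambda>z. z +o \<Delta>) ` A)"
proof -
  have "{z. z +o \<Delta> \<in> (\<lambda>z. z +o \<Delta>) ` A} = (\<Union>\<nu>\<in>\<Delta>. {z. z + \<nu> \<in> A})"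
  proof (intro set_eqI)
    fix z
    have "(\<exists>a\<in>A. z - a \<in> \<Delta>) \<longleftrightarrow> (\<exists>\<nu>\<in>\<Delta>. z + \<nu> \<in> A)"
    proof
      assume "\<exists>a\<in>A. z - a \<in> \<Delta>"
      then obtain a where "a \<in> A" "z - a \<in> \<Delta>" by blast
      then show "\<exists>\<nu>\<in>\<Delta>. z + \<nu> \<in> A" using minus_mem[of "z - a"] by (intro bexI[of _ "- (z - a)"]) auto
    next
      assume "\<exists>\<nu>\<in>\<Delta>. z + \<nu> \<in> A"
      then obtain \<nu> where "\<nu> \<in> \<Delta>" "z + \<nu> \<in> A" by blast
      then show "\<exists>a\<in>A. z - a \<in> \<Delta>" using minus_mem by (intro bexI[of _ "z + \<nu>"]) auto
    qed
    then show "z \<in> {z. z +o \<Delta> \<in> (\<lambda>z. z +o \<Delta>) ` A} \<longleftrightarrow> z \<in> (\<Union>\<nu>\<in>\<Delta>. {z. z + \<nu> \<in> A})"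
      by (auto simp: image_iff coset_eq)
  qed
  moreover have "open (\<Union>\<nu>\<in>\<Delta>. {z. z + \<nu> \<in> A})"
    using assms by (intro open_UN ballI open_shift)
  ultimately show ?thesis
    by (auto simp: openin_quotient_topology cosets_def)
qed

text \<open>
  On each translate of \<open>V\<close> the quotient map is injective and open, hence it sends Borel subsets to
  Borel sets, and countably many translates cover the group. Measurability in the quotient can thus
  be tested on preimages.
\<close>
lemma \<Sigma>_iff:
  assumes A: "A \<subseteq> cosets \<Delta>" and E: "{z. z +o \<Delta> \<in> A} \<in> sets borel"
  shows "A \<in> sets \<Sigma>"
proof -
  let ?q = "\<lambda>z. z +o \<Delta>"
  define B where "B = (\<lambda>n. {x. x - centre n \<in> V})"
  have oB: "open (B n)" for n unfolding B_def by (rule open_shift(1)[OF V(1)])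
  have opn: "?q ` U \<in> sets \<Sigma>" if "open U" for U
    unfolding sets_\<Sigma> using coset_image_open[OF that] by (intro sigma_sets.Basic) simp
  have inj: "x = y" if "x \<in> B n" "y \<in> B n" "?q x = ?q y" for x y n
  proof -
    have "(x - centre n) - (y - centre n) \<in> \<Delta>" using that(3) by (simp add: coset_eq)
    then have "x - centre n = y - centre n" using V(3) that by (auto simp: B_def)
    then show ?thesis by simp
  qed
  have img: "?q ` (E \<inter> B n) \<in> sets \<Sigma>" if "E \<in> sets borel" for E n
    using that unfolding sets_borel
  proof (induction E)
    case (Basic U)
    then show ?case using oB by (intro opn open_Int) auto
  next
    case Empty
    then show ?case by simp
  next
    case (Compl E)
    have "?q ` ((UNIV - E) \<inter> B n) = ?q ` (B n) - ?q ` (E \<inter> B n)"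
      using inj by blast
    then show ?case using Compl.IH opn[OF oB] by auto
  next
    case (Union a)
    have "?q ` (\<Union>(range a) \<inter> B n) = (\<Union>i. ?q ` (a i \<inter> B n))" by blast
    then show ?case using Union.IH by auto
  qed
  have "A = (\<Union>n. ?q ` ({z. z +o \<Delta> \<in> A} \<inter> B n))"
  proof
    show "A \<subseteq> (\<Union>n. ?q ` ({z. z +o \<Delta> \<in> A} \<inter> B n))"
    proof
      fix C assume C: "C \<in> A"
      then obtain z where z: "C = z +o \<Delta>" using A by (auto simp: cosets_def)
      obtain n where "z \<in> B n" using centre[of z] by (auto simp: B_def)
      then show "C \<in> (\<Union>n. ?q ` ({z. z +o \<Delta> \<in> A} \<inter> B n))" using z C by blast
    qed
  qed auto
  also have "\<dots> \<in> sets \<Sigma>" using img[OF E] by auto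
  finally show ?thesis .
qed

lemma periodization_coset:
  "periodization \<Delta> f (x +o \<Delta>) = (\<integral>\<nu>. f (x + \<nu>) \<partial>count_space \<Delta>)"
proof -
  have "(\<integral>\<nu>. f (z + \<nu>) \<partial>count_space \<Delta>) = (\<integral>\<nu>. f (x + \<nu>) \<partial>count_space \<Delta>)" if "z \<in> x +o \<Delta>" for z
  proof -
    have zx: "z - x \<in> \<Delta>" using that by (simp add: mem_coset)
    have "bij_betw (\<lambda>\<nu>. z - x + \<nu>) \<Delta> \<Delta>"
    proof (rule bij_betw_byWitness[where f' = "\<lambda>\<nu>. \<nu> - (z - x)"])
      show "(\<lambda>\<nu>. z - x + \<nu>) ` \<Delta> \<subseteq> \<Delta>" using add_mem[OF zx] by blast
      show "(\<lambda>\<nu>. \<nu> - (z - x)) ` \<Delta> \<subseteq> \<Delta>" using diff_mem[OF _ zx] by blast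
    qed auto
    from integral_bij_count_space[OF this, of "\<lambda>\<nu>. f (x + \<nu>)"]
    show ?thesis by (simp add: algebra_simps)
  qed
  moreover have "x \<in> x +o \<Delta>" by (simp add: mem_coset zero_mem)
  ultimately have "(\<lambda>z. \<integral>\<nu>. f (z + \<nu>) \<partial>count_space \<Delta>) ` (x +o \<Delta>) = {\<integral>\<nu>. f (x + \<nu>) \<partial>count_space \<Delta>}"
    by (subst image_cong[OF refl]) (assumption, blast)
  then show ?thesis by (simp add: periodization_def)
qed

definition PF :: "'b measure" where "PF = density P (indicator F)"

lemma sets_PF [measurable_cong]: "sets PF = sets borel"
  by (simp add: PF_def sets_P)

lemma nn_integral_PF:
  assumes [measurable]: "\<phi> \<in> borel_measurable borel"
  shows "(\<integral>\<^sup>+x. \<phi> x \<partial>PF) = (\<integral>\<^sup>+x. indicator F x * \<phi> x \<partial>P)"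
  unfolding PF_def by (rule nn_integral_density) measurable

lemma emeasure_PF: "E \<in> sets borel \<Longrightarrow> emeasure PF E = emeasure P (F \<inter> E)"
  unfolding PF_def by (subst emeasure_density) (auto simp: sets_P indicator_inter_arith[symmetric])

lemma sigma_finite_PF: "sigma_finite_measure PF"
proof -
  have "sigma_finite_measure PF \<longleftrightarrow> (AE x in P. indicator F x \<noteq> (\<infinity> :: ennreal))"
    unfolding PF_def by (rule sigma_finite_iff_density_finite) measurable
  then show ?thesis by (simp add: indicator_def)
qed

sublocale PFxD: pair_sigma_finite PF "count_space \<Delta>"
  by (intro pair_sigma_finite.intro sigma_finite_PF sigma_finite_measure_count_space_countable countable_\<Delta>)

lemma plus_measurable: "(\<lambda>p. fst p + snd p) \<in> measurable (PF \<Otimes>\<^sub>M count_space \<Delta>) borel"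
  by (rule measurable_compose_countable'[where f = "\<lambda>\<nu> p. fst p + \<nu>" and g = snd, OF _ _ countable_\<Delta>])
    measurable

text \<open>
  As a measure space the group is the product of \<open>F\<close> and \<open>\<Delta>\<close>, so that Fubini's theorem gives Weil's
  formula for complex integrable functions.
\<close>
lemma P_eq_distr: "P = distr (PF \<Otimes>\<^sub>M count_space \<Delta>) borel (\<lambda>p. fst p + snd p)"
proof (rule measure_eqI)
  fix A assume "A \<in> sets P"
  then have [measurable]: "A \<in> sets borel" by (simp add: sets_P)
  note plus_measurable [measurable]
  have "emeasure (distr (PF \<Otimes>\<^sub>M count_space \<Delta>) borel (\<lambda>p. fst p + snd p)) A
      = (\<integral>\<^sup>+y. indicator A y \<partial>distr (PF \<Otimes>\<^sub>M count_space \<Delta>) borel (\<lambda>p. fst p + snd p))"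
    by simp
  also have "\<dots> = (\<integral>\<^sup>+p. indicator A (fst p + snd p) \<partial>(PF \<Otimes>\<^sub>M count_space \<Delta>))"
    by (rule nn_integral_distr) measurable
  also have "\<dots> = (\<integral>\<^sup>+x. \<integral>\<^sup>+\<nu>. indicator A (fst (x, \<nu>) + snd (x, \<nu>)) \<partial>count_space \<Delta> \<partial>PF)"
    by (rule PFxD.M2.nn_integral_fst[symmetric, where f = "\<lambda>p. indicator A (fst p + snd p)"]) measurable
  also have "\<dots> = (\<integral>\<^sup>+x. indicator F x * (\<integral>\<^sup>+\<nu>. indicator A (x + \<nu>) \<partial>count_space \<Delta>) \<partial>P)"
    using nn_integral_PF[OF periodized_measurable, of "indicator A"] by simp
  also have "\<dots> = (\<integral>\<^sup>+x. indicator A x \<partial>P)"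
    by (rule nn_integral_periodize[symmetric]) measurable
  finally show "emeasure P A = emeasure (distr (PF \<Otimes>\<^sub>M count_space \<Delta>) borel (\<lambda>p. fst p + snd p)) A"
    by (simp add: sets_P)
qed (simp add: sets_P)

text \<open>
  The Haar measure of the quotient: each coset is represented by its point in \<open>F\<close>.
\<close>
definition Q :: "'b set measure" where "Q = distr PF \<Sigma> (\<lambda>z. z +o \<Delta>)"

lemma space_Q: "space Q = cosets \<Delta>" and sets_Q: "sets Q = sets \<Sigma>"
  by (simp_all add: Q_def space_\<Sigma>)

lemma coset_measurable_PF: "(\<lambda>z. z +o \<Delta>) \<in> measurable PF \<Sigma>"
  using coset_measurable by (simp add: measurable_cong_sets[OF sets_PF refl])

lemma preimage_borel: "A \<in> sets \<Sigma> \<Longrightarrow> {z. z +o \<Delta> \<in> A} \<in> sets borel"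
  using measurable_sets[OF coset_measurable, of A] by (simp add: vimage_def)

lemma emeasure_Q: "A \<in> sets \<Sigma> \<Longrightarrow> emeasure Q A = emeasure P (F \<inter> {z. z +o \<Delta> \<in> A})"
  using preimage_borel[of A] sets_eq_imp_space_eq[OF sets_PF]
  unfolding Q_def by (simp add: emeasure_distr coset_measurable_PF emeasure_PF vimage_def)

lemma weil_Q: "weil_formula P \<Delta> Q"
  unfolding weil_formula_def
proof (intro allI impI)
  fix f :: "'b \<Rightarrow> complex" assume f: "integrable P f"
  then have fm: "f \<in> borel_measurable borel"
    using measurable_cong_sets[OF sets_P refl] by auto
  let ?g = "\<lambda>p. f (fst p + snd p)"
  let ?h = "\<lambda>x. \<integral>\<nu>. f (x + \<nu>) \<partial>count_space \<Delta>"
  have ig: "integrable (PF \<Otimes>\<^sub>M count_space \<Delta>) ?g"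
    using f fm by (subst (asm) P_eq_distr) (simp add: integrable_distr_eq plus_measurable)
  have If: "integral\<^sup>L P f = integral\<^sup>L (PF \<Otimes>\<^sub>M count_space \<Delta>) ?g"
    by (subst P_eq_distr) (simp add: integral_distr plus_measurable fm)
  have ih: "integrable PF ?h" using PFxD.integrable_fst'[OF ig] by simp
  have Ih: "integral\<^sup>L PF ?h = integral\<^sup>L P f" using PFxD.integral_fst'[OF ig] If by simp
  have hm: "?h \<in> borel_measurable borel"
    using ih measurable_cong_sets[OF sets_PF refl] by auto
  have pm: "periodization \<Delta> f \<in> borel_measurable \<Sigma>"
  proof (rule measurableI)
    fix S :: "complex set" assume S: "S \<in> sets borel"
    have "?h -` S \<inter> space borel \<in> sets borel" using hm S by (rule measurable_sets)
    moreover have "{z. z +o \<Delta> \<in> periodization \<Delta> f -` S \<inter> space \<Sigma>} = ?h -` S \<inter> space borel"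
      by (auto simp: periodization_coset space_\<Sigma> cosets_def)
    ultimately show "periodization \<Delta> f -` S \<inter> space \<Sigma> \<in> sets \<Sigma>"
      by (intro \<Sigma>_iff) (auto simp: space_\<Sigma>)
  qed simp
  show "integrable Q (periodization \<Delta> f) \<and> integral\<^sup>L P f = integral\<^sup>L Q (periodization \<Delta> f)"
    unfolding Q_def using ih Ih
    by (simp add: integrable_distr_eq integral_distr coset_measurable_PF pm periodization_coset)
qed

lemma emeasure_F_nonzero: "emeasure P F \<noteq> 0"
proof
  assume 0: "emeasure P F = 0"
  have "emeasure P UNIV = (\<integral>\<^sup>+x. 1 \<partial>P)" by (simp add: space_P)
  also have "\<dots> = (\<integral>\<^sup>+x. indicator F x * (\<integral>\<^sup>+\<nu>. 1 \<partial>count_space \<Delta>) \<partial>P)"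
    by (rule nn_integral_periodize) simp
  also have "\<dots> = 0" using 0 by (subst nn_integral_multc) (simp_all add: sets_P)
  finally show False using nonzero by simp
qed

lemma open_positive:
  assumes "open A" "0 \<in> A"
  shows "emeasure P A \<noteq> 0"
proof
  assume 0: "emeasure P A = 0"
  obtain z where z: "\<And>x. \<exists>n :: nat. x - z n \<in> A"
    using Lindelof_translates[OF second_countable assms] by blast
  have "emeasure P {x. x - a \<in> A} = 0" for a
  proof -
    have "{x. x - a \<in> A} = (+) a ` A" by (force simp: image_iff)
    then show ?thesis using 0 assms by (simp add: translate)
  qed
  then have "emeasure P (\<Union>n. {x. x - z n \<in> A}) = 0"
    using open_shift[OF assms(1)] by (intro emeasure_UN_eq_0) (auto simp: sets_P)
  moreover have "(\<Union>n. {x. x - z n \<in> A}) = UNIV" using z by auto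
  ultimately show False using nonzero by simp
qed

text \<open>
  By Weil's formula the measure of \<open>A\<close> counts each coset as often as it meets \<open>A\<close>.
\<close>
lemma emeasure_saturation_le:
  assumes [measurable]: "A \<in> sets borel"
  shows "emeasure P (F \<inter> {x. \<exists>\<nu>\<in>\<Delta>. x + \<nu> \<in> A}) \<le> emeasure P A"
    and "emeasure P A \<noteq> 0 \<Longrightarrow> emeasure P (F \<inter> {x. \<exists>\<nu>\<in>\<Delta>. x + \<nu> \<in> A}) \<noteq> 0"
proof -
  let ?S = "{x. \<exists>\<nu>\<in>\<Delta>. x + \<nu> \<in> A}"
  have "?S = (\<Union>\<nu>\<in>\<Delta>. (\<lambda>x. x + \<nu>) -` A \<inter> space borel)" by auto
  also have "\<dots> \<in> sets borel" by (rule sets.countable_UN''[OF countable_\<Delta>]) measurable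
  finally have [measurable]: "?S \<in> sets borel" .
  have eq: "emeasure P A = (\<integral>\<^sup>+x. indicator F x * (\<integral>\<^sup>+\<nu>. indicator A (x + \<nu>) \<partial>count_space \<Delta>) \<partial>P)"
    using nn_integral_periodize[of "indicator A"] by (simp add: sets_P)
  have 1: "emeasure P (F \<inter> ?S) = (\<integral>\<^sup>+x. indicator F x * indicator ?S x \<partial>P)"
    by (simp add: indicator_inter_arith[symmetric] sets_P)
  show "emeasure P (F \<inter> ?S) \<le> emeasure P A"
    unfolding eq 1
  proof (intro nn_integral_mono mult_left_mono)
    fix x
    show "indicator ?S x \<le> (\<integral>\<^sup>+\<nu>. indicator A (x + \<nu>) \<partial>count_space \<Delta>)"
    proof (cases "x \<in> ?S")
      case True
      then obtain \<nu> where \<nu>: "\<nu> \<in> \<Delta>" "x + \<nu> \<in> A" by blast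
      have "1 = (\<integral>\<^sup>+\<mu>. indicator {\<nu>} \<mu> \<partial>count_space \<Delta>)" using \<nu>(1) by simp
      also have "\<dots> \<le> (\<integral>\<^sup>+\<nu>. indicator A (x + \<nu>) \<partial>count_space \<Delta>)"
        using \<nu> by (intro nn_integral_mono) (auto simp: indicator_def)
      finally show ?thesis using True by simp
    qed simp
  qed simp
  show "emeasure P (F \<inter> ?S) \<noteq> 0" if A0: "emeasure P A \<noteq> 0"
  proof
    assume 0: "emeasure P (F \<inter> ?S) = 0"
    have "emeasure P A = (\<integral>\<^sup>+x. 0 \<partial>P)"
      unfolding eq
    proof (rule nn_integral_cong_AE)
      have "AE x in P. x \<notin> F \<inter> ?S" using 0 by (intro AE_not_in) (auto simp: sets_P null_sets_def)
      then show "AE x in P. indicator F x * (\<integral>\<^sup>+\<nu>. indicator A (x + \<nu>) \<partial>count_space \<Delta>) = 0"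
      proof eventually_elim
        case (elim x)
        show ?case
        proof (cases "x \<in> F")
          case True
          then have "(\<integral>\<^sup>+\<nu>. indicator A (x + \<nu>) \<partial>count_space \<Delta>) = (\<integral>\<^sup>+\<nu>. 0 \<partial>count_space \<Delta>)"
            using elim by (intro nn_integral_cong) (auto simp: indicator_def)
          then show ?thesis by simp
        qed simp
      qed
    qed
    then show False using A0 by simp
  qed
qed

lemma saturation_eq: "{z. z +o \<Delta> \<in> (\<lambda>z. z +o \<Delta>) ` A} = {x. \<exists>\<nu>\<in>\<Delta>. x + \<nu> \<in> A}"
proof (intro set_eqI)
  fix z
  have "z + \<nu> \<in> A \<longleftrightarrow> (\<exists>a \<in> A. a = z + \<nu>)" for \<nu> by blast
  moreover have "z - a \<in> \<Delta> \<longleftrightarrow> (\<exists>\<nu>\<in>\<Delta>. a = z + \<nu>)" for a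
    using minus_mem by (metis add.commute add_uminus_conv_diff diff_add_cancel minus_diff_eq)
  ultimately show "z \<in> {z. z +o \<Delta> \<in> (\<lambda>z. z +o \<Delta>) ` A} \<longleftrightarrow> z \<in> {x. \<exists>\<nu>\<in>\<Delta>. x + \<nu> \<in> A}"
    by (auto simp: image_iff coset_eq)
qed

lemma coset_translate_image:
  assumes A: "A \<in> sets \<Sigma>"
  shows "(+) (a +o \<Delta>) ` A \<in> sets \<Sigma>"
    and "{z. z +o \<Delta> \<in> (+) (a +o \<Delta>) ` A} = {z. z - a \<in> {z. z +o \<Delta> \<in> A}}"
proof -
  have sub: "A \<subseteq> cosets \<Delta>" using sets.sets_into_space[OF A] by (simp add: space_\<Sigma>)
  show eq: "{z. z +o \<Delta> \<in> (+) (a +o \<Delta>) ` A} = {z. z - a \<in> {z. z +o \<Delta> \<in> A}}"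
  proof (intro set_eqI)
    fix z
    have "z +o \<Delta> \<in> (+) (a +o \<Delta>) ` A \<longleftrightarrow> (\<exists>d. d +o \<Delta> \<in> A \<and> z +o \<Delta> = (a + d) +o \<Delta>)"
    proof
      assume "z +o \<Delta> \<in> (+) (a +o \<Delta>) ` A"
      then obtain C where C: "C \<in> A" "z +o \<Delta> = (a +o \<Delta>) + C" by (rule imageE)
      then obtain d where "C = d +o \<Delta>" using sub by (auto simp: cosets_def)
      then show "\<exists>d. d +o \<Delta> \<in> A \<and> z +o \<Delta> = (a + d) +o \<Delta>"
        using C by (intro exI[of _ d]) (simp add: coset_add)
    next
      assume "\<exists>d. d +o \<Delta> \<in> A \<and> z +o \<Delta> = (a + d) +o \<Delta>"
      then obtain d where "d +o \<Delta> \<in> A" "z +o \<Delta> = (a +o \<Delta>) + (d +o \<Delta>)"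
        by (auto simp: coset_add)
      then show "z +o \<Delta> \<in> (+) (a +o \<Delta>) ` A" by (intro image_eqI)
    qed
    also have "\<dots> \<longleftrightarrow> (z - a) +o \<Delta> \<in> A"
    proof
      assume "\<exists>d. d +o \<Delta> \<in> A \<and> z +o \<Delta> = (a + d) +o \<Delta>"
      then obtain d where d: "d +o \<Delta> \<in> A" "z - (a + d) \<in> \<Delta>" by (auto simp: coset_eq)
      then have "(z - a) +o \<Delta> = d +o \<Delta>" by (simp add: coset_eq diff_diff_add)
      then show "(z - a) +o \<Delta> \<in> A" using d by simp
    next
      assume "(z - a) +o \<Delta> \<in> A"
      then show "\<exists>d. d +o \<Delta> \<in> A \<and> z +o \<Delta> = (a + d) +o \<Delta>"
        by (intro exI[of _ "z - a"]) simp
    qed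
    finally show "z \<in> {z. z +o \<Delta> \<in> (+) (a +o \<Delta>) ` A} \<longleftrightarrow> z \<in> {z. z - a \<in> {z. z +o \<Delta> \<in> A}}"
      by simp
  qed
  show "(+) (a +o \<Delta>) ` A \<in> sets \<Sigma>"
  proof (rule \<Sigma>_iff)
    show "(+) (a +o \<Delta>) ` A \<subseteq> cosets \<Delta>"
    proof
      fix D assume "D \<in> (+) (a +o \<Delta>) ` A"
      then obtain C where C: "C \<in> A" "D = (a +o \<Delta>) + C" by (rule imageE)
      then obtain d where "C = d +o \<Delta>" using sub by (auto simp: cosets_def)
      then show "D \<in> cosets \<Delta>" using C by (simp add: coset_add cosets_def)
    qed
    have "(\<lambda>z. z - a) -` {z. z +o \<Delta> \<in> A} \<inter> space borel \<in> sets borel"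
      by (rule measurable_sets[OF shift_measurable(2) preimage_borel[OF A]])
    then show "{z. z +o \<Delta> \<in> (+) (a +o \<Delta>) ` A} \<in> sets borel"
      unfolding eq by (simp add: vimage_def)
  qed
qed

lemma haar_Q: "haar_measure (quotient_topology \<Delta>) Q"
  unfolding haar_measure_def topspace_quotient_topology
proof (intro conjI allI impI ballI)
  show "space Q = cosets \<Delta>" by (rule space_Q)
  show "sets Q = sigma_sets (cosets \<Delta>) {U. openin (quotient_topology \<Delta>) U}"
    by (simp add: sets_Q sets_\<Sigma>)
  have "cosets \<Delta> \<in> sets \<Sigma>" using sets.top[of \<Sigma>] by (simp add: space_\<Sigma>)
  then show "emeasure Q (cosets \<Delta>) \<noteq> 0"
    using emeasure_F_nonzero by (simp add: emeasure_Q cosets_def)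
next
  fix K assume K: "compactin (quotient_topology \<Delta>) K"
  obtain U where U: "open U" "0 \<in> U" "emeasure P U < \<infinity>" using compact_nhd by blast
  let ?W = "\<lambda>a. (\<lambda>z. z +o \<Delta>) ` {x. x - a \<in> U}"
  have oW: "openin (quotient_topology \<Delta>) (?W a)" for a
    by (intro coset_image_open open_shift U)
  have "K \<subseteq> \<Union>(range ?W)"
  proof
    fix C assume "C \<in> K"
    then have "C \<in> cosets \<Delta>"
      using compactin_subset_topspace[OF K] by (auto simp: topspace_quotient_topology)
    then obtain z where "C = z +o \<Delta>" by (auto simp: cosets_def)
    then have "C \<in> ?W z" using U(2) by auto
    then show "C \<in> \<Union>(range ?W)" by blast
  qed
  then obtain \<F> where F: "finite \<F>" "\<F> \<subseteq> range ?W" "K \<subseteq> \<Union>\<F>"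
    using K oW unfolding compactin_def by (metis (no_types, lifting) imageE)
  have Wfin: "emeasure Q (?W a) < \<infinity>" for a
  proof -
    have b: "{x. x - a \<in> U} \<in> sets borel" using open_shift[OF U(1)] by simp
    have "?W a \<in> sets \<Sigma>" using oW by (auto simp: sets_\<Sigma>)
    then have "emeasure Q (?W a) \<le> emeasure P {x. x - a \<in> U}"
      using emeasure_saturation_le(1)[OF b] by (simp only: emeasure_Q saturation_eq)
    also have "\<dots> = emeasure P ((+) a ` U)"
      by (rule arg_cong[where f = "emeasure P"]) (force simp: image_iff)
    also have "\<dots> = emeasure P U" using U by (intro translate) simp
    finally show ?thesis using U(3) by simp
  qed
  have FS: "\<F> \<subseteq> sets Q" using F(2) oW by (auto simp: sets_Q sets_\<Sigma>)
  have "emeasure Q K \<le> emeasure Q (\<Union>\<F>)"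
    using FS F(1,3) by (intro emeasure_mono sets.finite_Union) auto
  also have "\<dots> \<le> (\<Sum>B\<in>\<F>. emeasure Q B)"
    using emeasure_subadditive_finite[OF F(1), of "\<lambda>x. x" Q] FS by simp
  also have "\<dots> < \<infinity>"
    using F Wfin by (auto simp: less_top)
  finally show "emeasure Q K < \<infinity>" .
next
  fix D A assume D: "D \<in> cosets \<Delta>" and A: "A \<in> sets Q"
  obtain a where a: "D = a +o \<Delta>" using D by (auto simp: cosets_def)
  have A': "A \<in> sets \<Sigma>" using A by (simp add: sets_Q)
  have "emeasure Q ((+) D ` A) = emeasure P (F \<inter> {z. z - a \<in> {z. z +o \<Delta> \<in> A}})"
    unfolding a by (simp only: emeasure_Q coset_translate_image[OF A'])
  also have "\<dots> = emeasure P (F \<inter> {z. z +o \<Delta> \<in> A})"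
  proof (rule emeasure_F_invariant_shift[OF preimage_borel[OF A']])
    fix x \<nu> assume "\<nu> \<in> \<Delta>"
    then have "(x + \<nu>) +o \<Delta> = x +o \<Delta>" by (simp add: coset_eq)
    then show "x + \<nu> \<in> {z. z +o \<Delta> \<in> A} \<longleftrightarrow> x \<in> {z. z +o \<Delta> \<in> A}" by simp
  qed
  also have "\<dots> = emeasure Q A" using A' by (simp add: emeasure_Q)
  finally show "emeasure Q ((+) D ` A) = emeasure Q A" .
qed

text \<open>
  Weil's formula determines the quotient measure. For a Borel set \<open>E \<subseteq> F\<close> the periodization of its
  indicator function is the indicator function of the image of \<open>E\<close>, whose measure is therefore that of
  \<open>E\<close>; \<open>\<sigma>\<close>-finiteness of \<open>P\<close> removes the restriction to sets of finite measure.
\<close>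
lemma weil_emeasure:
  assumes sR: "sets R = sets \<Sigma>" and w: "weil_formula P \<Delta> R" and A: "A \<in> sets \<Sigma>"
  shows "emeasure R A = emeasure P (F \<inter> {z. z +o \<Delta> \<in> A})"
proof -
  let ?q = "\<lambda>z. z +o \<Delta>"
  have spR: "space R = cosets \<Delta>" using sets_eq_imp_space_eq[OF sR] by (simp add: space_\<Sigma>)
  have step: "?q ` E \<in> sets \<Sigma> \<and> emeasure R (?q ` E) = emeasure P E"
    if E [measurable]: "E \<in> sets borel" "E \<subseteq> F" "emeasure P E < \<infinity>" for E
  proof -
    have S: "{x. \<exists>\<nu>\<in>\<Delta>. x + \<nu> \<in> E} \<in> sets borel"
    proof -
      have "{x. \<exists>\<nu>\<in>\<Delta>. x + \<nu> \<in> E} = (\<Union>\<nu>\<in>\<Delta>. (\<lambda>x. x + \<nu>) -` E \<inter> space borel)" by auto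
      also have "\<dots> \<in> sets borel" by (rule sets.countable_UN''[OF countable_\<Delta>]) measurable
      finally show ?thesis .
    qed
    have qE: "?q ` E \<in> sets \<Sigma>"
      by (rule \<Sigma>_iff) (use S in \<open>auto simp: saturation_eq cosets_def\<close>)
    let ?f = "\<lambda>x. complex_of_real (indicator E x)"
    have f: "integrable P ?f"
      using that(3) by (intro integrable_of_real integrable_real_indicator) (auto simp: sets_P)
    have per: "periodization \<Delta> ?f C = complex_of_real (indicator (?q ` E) C)" if C: "C \<in> cosets \<Delta>" for C
    proof -
      obtain x where x: "C = x +o \<Delta>" using C by (auto simp: cosets_def)
      obtain \<nu> where \<nu>: "\<nu> \<in> \<Delta>" "x + \<nu> \<in> F" "\<And>\<mu>. \<mu> \<in> \<Delta> \<Longrightarrow> x + \<mu> \<in> F \<Longrightarrow> \<mu> = \<nu>"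
        using F_ex1[of x] by blast
      have C_iff: "C \<in> ?q ` E \<longleftrightarrow> x + \<nu> \<in> E"
        using saturation_eq[of E] \<nu> \<open>E \<subseteq> F\<close> x by blast
      have "periodization \<Delta> ?f C = (\<integral>\<mu>. complex_of_real (indicator (?q ` E) C) * indicator {\<nu>} \<mu> \<partial>count_space \<Delta>)"
        unfolding x periodization_coset
      proof (rule Bochner_Integration.integral_cong[OF refl])
        fix \<mu> assume "\<mu> \<in> space (count_space \<Delta>)"
        then have "\<mu> \<in> \<Delta>" by simp
        then have "x + \<mu> \<in> E \<longleftrightarrow> x + \<nu> \<in> E \<and> \<mu> = \<nu>"
          using \<nu>(3)[of \<mu>] \<open>E \<subseteq> F\<close> by (metis subsetD)
        then have "x + \<mu> \<in> E \<longleftrightarrow> x +o \<Delta> \<in> ?q ` E \<and> \<mu> = \<nu>"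
          using C_iff unfolding x by metis
        then show "complex_of_real (indicator E (x + \<mu>)) = complex_of_real (indicator (?q ` E) (x +o \<Delta>)) * indicator {\<nu>} \<mu>"
          by (simp add: indicator_def)
      qed
      also have "\<dots> = complex_of_real (indicator (?q ` E) C) * (\<integral>\<mu>. complex_of_real (indicator {\<nu>} \<mu>) \<partial>count_space \<Delta>)"
        by (simp add: indicator_def of_bool_def if_distrib[of complex_of_real] cong: if_cong)
      also have "(\<integral>\<mu>. complex_of_real (indicator {\<nu>} \<mu>) \<partial>count_space \<Delta>) = 1"
        using \<nu>(1) by (simp only: integral_complex_of_real) simp
      finally show ?thesis by simp
    qed
    have iR: "integrable R (periodization \<Delta> ?f)"
      and eR: "integral\<^sup>L P ?f = integral\<^sup>L R (periodization \<Delta> ?f)"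
      using w f unfolding weil_formula_def by blast+
    have iR': "integrable R (\<lambda>C. complex_of_real (indicator (?q ` E) C))"
      using iR by (subst (asm) Bochner_Integration.integrable_cong[OF refl per]) (auto simp: spR)
    then have "integrable R (indicator (?q ` E) :: _ \<Rightarrow> real)"
      by (simp only: complex_of_real_integrable_eq)
    then have finR: "emeasure R (?q ` E) < \<infinity>"
      using qE by (simp add: integrable_indicator_iff sR sets.Int_space_eq2)
    have "complex_of_real (measure P E) = integral\<^sup>L P ?f"
      by (simp add: sets_P space_P)
    also have "\<dots> = (\<integral>C. complex_of_real (indicator (?q ` E) C) \<partial>R)"
      unfolding eR by (rule Bochner_Integration.integral_cong) (auto simp: spR per)
    also have "\<dots> = complex_of_real (measure R (?q ` E))"
      using sets.sets_into_space[OF qE] by (simp add: sR spR space_\<Sigma> Int_absorb2)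
    finally have "measure P E = measure R (?q ` E)" by simp
    then have "emeasure R (?q ` E) = emeasure P E"
      using finR that(3) by (simp add: emeasure_eq_ennreal_measure less_top)
    then show ?thesis using qE by blast
  qed
  obtain B where B: "range B \<subseteq> sets P" "(\<Union>i. B i) = space P" "\<And>i. emeasure P (B i) \<noteq> \<infinity>" "incseq B"
    using sigma_finite_incseq by metis
  define E where "E = (\<lambda>i :: nat. F \<inter> {z. z +o \<Delta> \<in> A} \<inter> B i)"
  have EB: "E i \<in> sets borel" for i
    unfolding E_def using B(1) preimage_borel[OF A] by (auto simp: sets_P)
  have Efin: "emeasure P (E i) < \<infinity>" for i
  proof -
    have "emeasure P (E i) \<le> emeasure P (B i)"
      using B(1) by (intro emeasure_mono) (auto simp: E_def)
    then show ?thesis using B(3)[of i] by (simp add: less_top top.extremum_uniqueI)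
  qed
  have st: "?q ` E i \<in> sets \<Sigma>" "emeasure R (?q ` E i) = emeasure P (E i)" for i
    using step[OF EB _ Efin, of i] by (auto simp: E_def)
  have UE: "(\<Union>i. E i) = F \<inter> {z. z +o \<Delta> \<in> A}" using B(2) by (auto simp: E_def space_P)
  have "A = (\<Union>i. ?q ` E i)"
  proof
    show "(\<Union>i. ?q ` E i) \<subseteq> A" by (auto simp: E_def)
    show "A \<subseteq> (\<Union>i. ?q ` E i)"
    proof
      fix C assume C: "C \<in> A"
      then obtain x where x: "C = x +o \<Delta>"
        using sets.sets_into_space[OF A] by (auto simp: cosets_def space_\<Sigma>)
      obtain \<nu> where \<nu>: "\<nu> \<in> \<Delta>" "x + \<nu> \<in> F" using F_ex1[of x] by blast
      have Cx: "C = (x + \<nu>) +o \<Delta>" using \<nu>(1) minus_mem unfolding x coset_eq by simp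
      then have "x + \<nu> \<in> (\<Union>i. E i)" unfolding UE using \<nu> C by simp
      then show "C \<in> (\<Union>i. ?q ` E i)" using Cx by blast
    qed
  qed
  then have "emeasure R A = emeasure R (\<Union>i. ?q ` E i)" by simp
  also have "\<dots> = (SUP i. emeasure R (?q ` E i))"
  proof (rule SUP_emeasure_incseq[symmetric])
    show "range (\<lambda>i. ?q ` E i) \<subseteq> sets R" using st(1) by (auto simp: sR)
    show "incseq (\<lambda>i. ?q ` E i)"
      using B(4) unfolding incseq_def E_def by (intro allI impI image_mono Int_mono) auto
  qed
  also have "\<dots> = (SUP i. emeasure P (E i))" by (simp add: st(2))
  also have "\<dots> = emeasure P (\<Union>i. E i)"
  proof (rule SUP_emeasure_incseq)
    show "range E \<subseteq> sets P" using EB by (auto simp: sets_P)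
    show "incseq E" using B(4) unfolding incseq_def E_def by (intro allI impI Int_mono) auto
  qed
  finally show ?thesis unfolding UE .
qed

lemma quotient_haar_measure_eq: "quotient_haar_measure P \<Delta> = Q"
  unfolding quotient_haar_measure_def
proof (rule the_equality)
  show "haar_measure (quotient_topology \<Delta>) Q \<and> weil_formula P \<Delta> Q"
    using haar_Q weil_Q by blast
  fix R assume R: "haar_measure (quotient_topology \<Delta>) R \<and> weil_formula P \<Delta> R"
  have sR: "sets R = sets \<Sigma>"
    using R unfolding haar_measure_def topspace_quotient_topology sets_\<Sigma> by blast
  show "R = Q"
  proof (rule measure_eqI)
    show "sets R = sets Q" by (simp add: sR sets_Q)
    fix A assume "A \<in> sets R"
    then show "emeasure R A = emeasure Q A"
      using weil_emeasure[OF sR] R sR by (simp add: emeasure_Q)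
  qed
qed

lemma lattice_size_eq: "lattice_size P \<Delta> = emeasure P F"
proof -
  have "cosets \<Delta> \<in> sets \<Sigma>" using sets.top[of \<Sigma>] by (simp add: space_\<Sigma>)
  then show ?thesis
    by (simp add: lattice_size_def quotient_haar_measure_eq space_Q emeasure_Q cosets_def)
qed

text \<open>
  Let \<open>S a\<close> be the saturation under \<open>\<Delta>\<close> of the translate by \<open>a\<close> of a small open set \<open>W\<close>. All these sets
  have the same positive measure within \<open>F\<close>, which bounds the size of a disjoint family of them. If
  \<open>Z\<close> indexes a largest disjoint family, every \<open>S x\<close> meets some \<open>S a\<close> with \<open>a \<in> Z\<close>, so the compact
  sets \<open>a + K\<close> with \<open>a \<in> Z\<close> cover the quotient.
\<close>
lemma compact_quotient:
  assumes fin: "emeasure P F < \<infinity>"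
  shows "compact_space (quotient_topology \<Delta>)"
proof -
  let ?q = "\<lambda>z. z +o \<Delta>"
  obtain U K :: "'b set" where UK: "open U" "0 \<in> U" "U \<subseteq> K" "compact K"
    using compact_nhd by blast
  obtain W where W: "open W" "0 \<in> W" "\<And>x y. x \<in> W \<Longrightarrow> y \<in> W \<Longrightarrow> x - y \<in> U"
    using symmetric_difference_nhd[OF UK(1,2)] by blast
  define S where "S = (\<lambda>a. {x. \<exists>\<nu>\<in>\<Delta>. x + \<nu> - a \<in> W})"
  have S_eq: "S a = (\<Union>\<nu>\<in>\<Delta>. {x. x + (\<nu> - a) \<in> W})" for a
    by (auto simp: S_def add_diff_eq)
  have SB [measurable]: "S a \<in> sets borel" for a
    unfolding S_eq using W(1) by (intro borel_open open_UN ballI open_shift)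
  have Sc: "emeasure P (F \<inter> S a) = emeasure P (F \<inter> S 0)" for a
  proof -
    have "S a = {x. x - a \<in> S 0}" by (auto simp: S_def algebra_simps)
    moreover have "emeasure P (F \<inter> {x. x - a \<in> S 0}) = emeasure P (F \<inter> S 0)"
    proof (rule emeasure_F_invariant_shift[OF SB])
      fix x \<nu> assume \<nu>: "\<nu> \<in> \<Delta>"
      show "x + \<nu> \<in> S 0 \<longleftrightarrow> x \<in> S 0"
      proof
        assume "x + \<nu> \<in> S 0"
        then obtain \<mu> where "\<mu> \<in> \<Delta>" "x + \<nu> + \<mu> \<in> W" by (auto simp: S_def)
        then show "x \<in> S 0" using add_mem[OF \<nu>] by (auto simp: S_def add.assoc)
      next
        assume "x \<in> S 0"
        then obtain \<mu> where "\<mu> \<in> \<Delta>" "x + \<mu> \<in> W" by (auto simp: S_def)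
        then show "x + \<nu> \<in> S 0" using diff_mem[OF _ \<nu>]
          by (auto simp: S_def intro!: bexI[of _ "\<mu> - \<nu>"])
      qed
    qed
    ultimately show ?thesis by simp
  qed
  have S0: "emeasure P (F \<inter> S 0) \<noteq> 0"
    using emeasure_saturation_le(2)[OF borel_open[OF W(1)] open_positive[OF W(1,2)]]
    by (simp add: S_def)
  define m where "m = measure P (F \<inter> S 0)"
  have fm: "emeasure P (F \<inter> S a) < \<infinity>" for a
    using emeasure_mono[of "F \<inter> S a" F P] fin by (auto simp: sets_P intro: le_less_trans)
  have m: "emeasure P (F \<inter> S a) = ennreal m" for a
    using Sc[of a] fm[of 0] by (simp add: m_def emeasure_eq_ennreal_measure less_top)
  have mpos: "m > 0" using S0 m[of 0] by (metis ennreal_0 m_def measure_nonneg order_le_less)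
  define packing where "packing = (\<lambda>Z. finite Z \<and> disjoint_family_on S Z)"
  have bound: "real (card Z) \<le> measure P F / m" if "packing Z" for Z
  proof -
    have Z: "finite Z" "disjoint_family_on S Z" using that by (auto simp: packing_def)
    have "(\<Sum>a\<in>Z. emeasure P (F \<inter> S a)) = emeasure P (\<Union>a\<in>Z. F \<inter> S a)"
      using Z by (intro sum_emeasure) (auto simp: sets_P disjoint_family_on_def)
    also have "\<dots> \<le> emeasure P F" by (intro emeasure_mono) (auto simp: sets_P)
    finally have "(\<Sum>a\<in>Z. ennreal m) \<le> ennreal (measure P F)"
      using fin by (simp add: m emeasure_eq_ennreal_measure less_top)
    then have "ennreal (real (card Z) * m) \<le> ennreal (measure P F)"
      using mpos by (simp add: ennreal_of_nat_eq_real_of_nat ennreal_mult)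
    then show ?thesis using mpos by (simp add: field_simps)
  qed
  have "\<forall>Z. packing Z \<longrightarrow> card Z \<le> nat \<lfloor>measure P F / m\<rfloor>"
    using bound by (simp add: le_nat_floor)
  moreover have "packing {}" by (simp add: packing_def disjoint_family_on_def)
  ultimately obtain Z where Z: "packing Z" "\<And>Z'. packing Z' \<Longrightarrow> card Z' \<le> card Z"
    using ex_has_greatest_nat[of packing "{}" card "Suc (nat \<lfloor>measure P F / m\<rfloor>)"]
    by (metis less_Suc_eq_le)
  have cover: "\<exists>a\<in>Z. ?q x \<in> ?q ` ((+) a ` K)" for x
  proof -
    have "\<exists>a\<in>Z. \<exists>\<nu>\<in>\<Delta>. x - a + \<nu> \<in> U"
    proof (cases "x \<in> Z")
      case True
      then show ?thesis using UK(2) zero_mem by (intro bexI[of _ x] bexI[of _ 0]) auto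
    next
      case False
      have "\<not> packing (insert x Z)"
        using Z(2)[of "insert x Z"] False Z(1) by (auto simp: packing_def)
      then have "\<not> disjoint_family_on S (insert x Z)" using Z(1) by (auto simp: packing_def)
      then obtain a where a: "a \<in> Z" "S x \<inter> S a \<noteq> {}"
        using Z(1) False unfolding packing_def disjoint_family_on_def by blast
      then obtain y \<nu> \<mu> where y: "\<nu> \<in> \<Delta>" "\<mu> \<in> \<Delta>" "y + \<nu> - x \<in> W" "y + \<mu> - a \<in> W"
        by (auto simp: S_def)
      have "(y + \<mu> - a) - (y + \<nu> - x) = x - a + (\<mu> - \<nu>)" by (simp add: algebra_simps)
      then have "x - a + (\<mu> - \<nu>) \<in> U" using W(3)[OF y(4,3)] by metis
      then show ?thesis using a diff_mem[OF y(2,1)] by blast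
    qed
    then obtain a \<nu> where a: "a \<in> Z" "\<nu> \<in> \<Delta>" "x - a + \<nu> \<in> K" using UK(3) by blast
    have "?q x = ?q (a + (x - a + \<nu>))" using a(2) minus_mem unfolding coset_eq by simp
    then show ?thesis using a by blast
  qed
  have cont: "continuous_map euclidean (quotient_topology \<Delta>) ?q"
    by (auto simp: continuous_map_def openin_quotient_topology topspace_quotient_topology cosets_def)
  have "compactin (quotient_topology \<Delta>) (\<Union>a\<in>Z. ?q ` ((+) a ` K))"
  proof (rule compactin_Union)
    show "finite ((\<lambda>a. ?q ` ((+) a ` K)) ` Z)" using Z(1) by (simp add: packing_def)
    fix S assume "S \<in> (\<lambda>a. ?q ` ((+) a ` K)) ` Z"
    then obtain a where a: "S = ?q ` ((+) a ` K)" by blast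
    have "compact ((+) a ` K)"
      using UK(4) by (intro compact_continuous_image continuous_intros)
    then show "compactin (quotient_topology \<Delta>) S"
      unfolding a by (intro image_compactin[OF _ cont]) simp
  qed
  moreover have "(\<Union>a\<in>Z. ?q ` ((+) a ` K)) = topspace (quotient_topology \<Delta>)"
    using cover by (auto simp: topspace_quotient_topology cosets_def)
  ultimately show ?thesis by (simp add: compact_space_def)
qed

end

section \<open>Time-frequency shifts\<close>

locale phase_space =
  fixes M :: "'a::{topological_ab_group_add, t2_space, second_countable_topology} measure"
    and N :: "'a character measure"
  assumes locally_compact: "locally_compact_space (euclidean :: 'a topology)"
    and haar_M: "haar_measure euclidean M"
    and dual_N: "dual_haar_measure M N"
begin

lemma haar_N: "haar_measure euclidean N"
  using dual_N by (simp add: dual_haar_measure_def)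

lemma sets_M [measurable_cong]: "sets M = sets borel" and space_M: "space M = UNIV"
  and sets_N [measurable_cong]: "sets N = sets borel" and space_N: "space N = UNIV"
  using haar_sets[OF haar_M] haar_sets[OF haar_N] by auto

lemma compact_nhd_M:
  obtains U K :: "'a set" where "open U" "0 \<in> U" "U \<subseteq> K" "compact K"
  using compact_closed_neighbourhood[OF locally_compact open_UNIV UNIV_I[of 0]] by metis

lemma sigma_finite_M: "sigma_finite_measure M"
proof -
  obtain U K :: "'a set" where "open U" "0 \<in> U" "U \<subseteq> K" "compact K" by (rule compact_nhd_M)
  then show ?thesis using haar_sigma_finite(1)[OF haar_M second_countable_euclidean] by blast
qed

lemma sigma_finite_N: "sigma_finite_measure N"
proof -
  obtain U K :: "'a character set" where "open U" "0 \<in> U" "U \<subseteq> K" "compact K"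
    using compact_neighbourhood_character[OF locally_compact] by metis
  then show ?thesis
    using haar_sigma_finite(1)[OF haar_N second_countable_character[OF locally_compact]] by blast
qed

sublocale M: sigma_finite_measure M by (rule sigma_finite_M)
sublocale N: sigma_finite_measure N by (rule sigma_finite_N)
sublocale MN: pair_sigma_finite M N ..
sublocale MM: pair_sigma_finite M M ..

lemma sets_MN: "sets (M \<Otimes>\<^sub>M N) = sets borel"
proof -
  have "sets (M \<Otimes>\<^sub>M N) = sets (borel \<Otimes>\<^sub>M borel)"
    by (intro sets_pair_measure_cong sets_M sets_N)
  then show ?thesis
    using sets_borel_prod[OF second_countable_euclidean second_countable_character[OF locally_compact]]
    by simp
qed

text \<open>
  Phase space with the product measure satisfies all hypotheses of the quotient theory; the topological
  ones rest on the properties of the dual group established above.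
\<close>
lemma discrete_quotient_MN:
  assumes "is_subgroup \<Delta>" "discrete \<Delta>"
  shows "discrete_quotient (M \<Otimes>\<^sub>M N) \<Delta>"
proof (rule discrete_quotient.intro)
  let ?P = "M \<Otimes>\<^sub>M N"
  show "sets ?P = sets borel" by (rule sets_MN)
  show "sigma_finite_measure ?P" by (rule MN.P.sigma_finite_measure_axioms)
  have shift: "distr ?P borel (\<lambda>x. x + a) = ?P" for a
  proof -
    have [measurable]: "(\<lambda>x. x + fst a) \<in> measurable M borel" "(\<lambda>x. x + snd a) \<in> measurable N borel"
      unfolding measurable_cong_sets[OF sets_M refl] measurable_cong_sets[OF sets_N refl]
      by (intro borel_measurable_continuous_onI continuous_intros)+
    have "?P = distr M borel (\<lambda>x. x + fst a) \<Otimes>\<^sub>M distr N borel (\<lambda>x. x + snd a)"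
      by (simp only: haar_shift[OF haar_M] haar_shift[OF haar_N])
    also have "\<dots> = distr ?P (borel \<Otimes>\<^sub>M borel) (\<lambda>(x, y). (x + fst a, y + snd a))"
      by (rule pair_measure_distr) (simp_all add: haar_shift[OF haar_N] sigma_finite_N)
    also have "\<dots> = distr ?P borel (\<lambda>x. x + a)"
      by (rule distr_cong[OF refl])
        (auto simp: plus_prod_def sets_borel_prod[OF second_countable_euclidean second_countable_character[OF locally_compact]])
    finally show ?thesis ..
  qed
  show "emeasure ?P ((+) a ` A) = emeasure ?P A" if A: "A \<in> sets borel" for a A
  proof -
    have m: "(\<lambda>x. x + - a) \<in> measurable ?P borel"
      unfolding measurable_cong_sets[OF sets_MN refl]
      by (intro borel_measurable_continuous_onI continuous_intros)
    have "emeasure ?P A = emeasure (distr ?P borel (\<lambda>x. x + - a)) A" by (simp only: shift)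
    also have "\<dots> = emeasure ?P ((\<lambda>x. x + - a) -` A \<inter> space ?P)" by (rule emeasure_distr[OF m A])
    also have "(\<lambda>x. x + - a) -` A \<inter> space ?P = (+) a ` A"
      by (simp only: vimage_add_uminus space_pair_measure space_M space_N UNIV_Times_UNIV Int_UNIV_right)
    finally show ?thesis ..
  qed
  have "emeasure M UNIV \<noteq> 0" "emeasure N UNIV \<noteq> 0"
    using haar_M haar_N by (auto simp: haar_measure_def)
  moreover have "emeasure ?P (UNIV \<times> UNIV) = emeasure M UNIV * emeasure N UNIV"
    by (rule N.emeasure_pair_measure_Times) (simp_all add: sets_M sets_N)
  ultimately show "emeasure ?P UNIV \<noteq> 0" by simp
  show "second_countable (euclidean :: ('a \<times> 'a character) topology)"
    by (intro second_countable_euclidean_prod second_countable_euclidean second_countable_character locally_compact)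
  show "\<exists>U K. open U \<and> 0 \<in> U \<and> U \<subseteq> K \<and> compact K \<and> emeasure ?P U < \<infinity>"
  proof -
    obtain U K :: "'a set" where U: "open U" "0 \<in> U" "U \<subseteq> K" "compact K" by (rule compact_nhd_M)
    obtain V L :: "'a character set" where V: "open V" "0 \<in> V" "V \<subseteq> L" "compact L"
      using compact_neighbourhood_character[OF locally_compact] by metis
    have "emeasure ?P (U \<times> V) = emeasure M U * emeasure N V"
      using U V by (intro N.emeasure_pair_measure_Times) (simp_all add: sets_M sets_N)
    also have "\<dots> < \<infinity>"
      using haar_sigma_finite(2)[OF haar_M second_countable_euclidean U]
        haar_sigma_finite(2)[OF haar_N second_countable_character[OF locally_compact] V]
      by (simp add: ennreal_mult_less_top)
    finally show ?thesis
      using U V by (intro exI[of _ "U \<times> V"] exI[of _ "K \<times> L"])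
        (auto intro: open_Times compact_Times simp: zero_prod_def)
  qed
qed (fact assms)+

lemma nn_integral_M_shift:
  "\<phi> \<in> borel_measurable borel \<Longrightarrow> (\<integral>\<^sup>+x. \<phi> (x + a) \<partial>M) = (\<integral>\<^sup>+x. \<phi> x \<partial>M)"
  by (rule nn_integral_translate) (simp_all add: sets_M haar_translate[OF haar_M])

lemma integral_M_shift:
  fixes \<phi> :: "'a \<Rightarrow> complex"
  assumes "\<phi> \<in> borel_measurable borel"
  shows "(\<integral>x. \<phi> (x + a) \<partial>M) = (\<integral>x. \<phi> x \<partial>M)"
proof -
  have m: "(\<lambda>x. x + a) \<in> measurable M borel"
    unfolding measurable_cong_sets[OF sets_M refl]
    by (intro borel_measurable_continuous_onI continuous_intros)
  have "(\<integral>x. \<phi> x \<partial>M) = (\<integral>x. \<phi> x \<partial>distr M borel (\<lambda>x. x + a))" by (simp add: haar_shift[OF haar_M])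
  also have "\<dots> = (\<integral>x. \<phi> (x + a) \<partial>M)" by (rule integral_distr[OF m assms])
  finally show ?thesis ..
qed

lemma L2_borel: "f \<in> L2 M \<Longrightarrow> f \<in> borel_measurable borel"
  using L2_measurable measurable_cong_sets[OF sets_M refl] by blast

lemma cnj_borel: "cnj \<in> borel_measurable borel"
  by (intro borel_measurable_continuous_onI continuous_intros)

lemma minus_borel: "(\<lambda>x. x - a) \<in> borel_measurable (borel :: 'a measure)"
  by (intro borel_measurable_continuous_onI continuous_intros)

lemma char_borel: "char_app \<gamma> \<in> borel_measurable borel"
  by (intro borel_measurable_continuous_onI char_app_continuous)

lemma tf_shift_apply: "tf_shift \<nu> f x = char_app (snd \<nu>) x * f (x - fst \<nu>)"
  by (simp add: tf_shift_def modulation_def translation_def)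

lemma tf_shift_L2:
  assumes f: "f \<in> L2 M"
  shows "tf_shift \<nu> f \<in> L2 M"
proof (rule L2_I)
  note L2_borel[OF f, measurable] minus_borel[measurable] char_borel[measurable]
  have eq: "tf_shift \<nu> f = (\<lambda>x. char_app (snd \<nu>) x * f (x - fst \<nu>))" by (simp add: fun_eq_iff tf_shift_apply)
  show "tf_shift \<nu> f \<in> borel_measurable M" unfolding eq by measurable
  have "(\<integral>\<^sup>+x. ennreal ((cmod (tf_shift \<nu> f x))\<^sup>2) \<partial>M) = (\<integral>\<^sup>+x. ennreal ((cmod (f (x + - fst \<nu>)))\<^sup>2) \<partial>M)"
    by (simp add: eq norm_mult)
  also have "\<dots> = (\<integral>\<^sup>+x. ennreal ((cmod (f x))\<^sup>2) \<partial>M)"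
    by (rule nn_integral_M_shift) measurable
  also have "\<dots> < \<infinity>" using nn_integral_L2[OF f] by simp
  finally show "(\<integral>\<^sup>+x. ennreal ((cmod (tf_shift \<nu> f x))\<^sup>2) \<partial>M) < \<infinity>" .
qed

lemma tf_shift_inner:
  assumes "f \<in> L2 M" "h \<in> L2 M"
  shows "L2_inner M (tf_shift \<nu> f) (tf_shift \<nu> h) = L2_inner M f h"
proof -
  note L2_borel[OF assms(1), measurable] L2_borel[OF assms(2), measurable] cnj_borel[measurable]
  have "tf_shift \<nu> f x * cnj (tf_shift \<nu> h x) = f (x + - fst \<nu>) * cnj (h (x + - fst \<nu>))" for x
  proof -
    have "tf_shift \<nu> f x * cnj (tf_shift \<nu> h x)
       = (char_app (snd \<nu>) x * cnj (char_app (snd \<nu>) x)) * (f (x - fst \<nu>) * cnj (h (x - fst \<nu>)))"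
      by (simp only: tf_shift_apply complex_cnj_mult mult_ac)
    then show ?thesis by simp
  qed
  then show ?thesis
    unfolding L2_inner_def by (simp only:) (rule integral_M_shift, measurable)
qed

lemma tf_shift_norm:
  assumes "f \<in> L2 M"
  shows "(L2_norm M (tf_shift \<nu> f))\<^sup>2 = (L2_norm M f)\<^sup>2"
  using tf_shift_inner[OF assms assms, of \<nu>] unfolding L2_inner_self by (simp only: of_real_eq_iff)

lemma tf_shift_zero: "tf_shift 0 f = f"
  by (simp add: fun_eq_iff tf_shift_apply char_app_zero)

lemma tf_shift_lin: "tf_shift \<nu> (\<lambda>x. f x + c * h x) = (\<lambda>x. tf_shift \<nu> f x + c * tf_shift \<nu> h x)"
  by (simp add: fun_eq_iff tf_shift_apply algebra_simps)

text \<open>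
  Time-frequency shifts form a projective representation. The phase has modulus one, so it disappears
  from squared coefficients and from products of a coefficient with a conjugated one.
\<close>
lemma tf_shift_comp:
  "tf_shift \<nu> (tf_shift \<mu> f) = (\<lambda>x. cnj (char_app (snd \<mu>) (fst \<nu>)) * tf_shift (\<nu> + \<mu>) f x)"
proof
  fix x
  have "char_app (snd \<mu>) (x - fst \<nu>) = char_app (snd \<mu>) x * cnj (char_app (snd \<mu>) (fst \<nu>))"
    using char_app_add_arg[of "snd \<mu>" x "- fst \<nu>"] by (simp add: char_app_minus_arg)
  then show "tf_shift \<nu> (tf_shift \<mu> f) x = cnj (char_app (snd \<mu>) (fst \<nu>)) * tf_shift (\<nu> + \<mu>) f x"
    by (simp add: tf_shift_apply char_app_plus diff_diff_add mult_ac)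
qed

lemma tf_shift_surj:
  assumes "f \<in> L2 M"
  obtains f' where "f' \<in> L2 M" "tf_shift \<nu> f' = f"
proof
  \<comment> \<open>the inverse of a time-frequency shift is the opposite shift, corrected by a phase\<close>
  let ?c = "char_app (snd (- \<nu>)) (fst \<nu>)"
  show "(\<lambda>x. 0 + ?c * tf_shift (- \<nu>) f x) \<in> L2 M"
    using L2_scale[OF tf_shift_L2[OF assms]] by simp
  have "tf_shift \<nu> (\<lambda>x. 0 + ?c * tf_shift (- \<nu>) f x) = (\<lambda>x. ?c * tf_shift \<nu> (tf_shift (- \<nu>) f) x)"
    by (subst tf_shift_lin) (simp add: fun_eq_iff tf_shift_apply)
  also have "\<dots> = (\<lambda>x. (?c * cnj ?c) * tf_shift (\<nu> + - \<nu>) f x)"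
    by (simp only: tf_shift_comp mult.assoc)
  also have "\<dots> = f" by (simp add: tf_shift_zero)
  finally show "tf_shift \<nu> (\<lambda>x. 0 + ?c * tf_shift (- \<nu>) f x) = f" .
qed

lemma inner_tf_shift_add:
  assumes f: "f \<in> L2 M" and k: "k \<in> L2 M"
  shows "L2_inner M (tf_shift \<xi> f) (tf_shift (\<xi> + \<nu>) k)
    = cnj (char_app (snd \<nu>) (fst \<xi>)) * L2_inner M f (tf_shift \<nu> k)"
proof -
  let ?c = "char_app (snd \<nu>) (fst \<xi>)"
  have "L2_inner M f (tf_shift \<nu> k) = L2_inner M (tf_shift \<xi> f) (tf_shift \<xi> (tf_shift \<nu> k))"
    by (rule tf_shift_inner[OF f tf_shift_L2[OF k], symmetric])
  also have "\<dots> = ?c * L2_inner M (tf_shift \<xi> f) (tf_shift (\<xi> + \<nu>) k)"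
    by (simp only: tf_shift_comp L2_inner_scale_right complex_cnj_cnj)
  finally have "cnj ?c * L2_inner M f (tf_shift \<nu> k)
    = (?c * cnj ?c) * L2_inner M (tf_shift \<xi> f) (tf_shift (\<xi> + \<nu>) k)"
    by (simp only: mult_ac)
  then show ?thesis by simp
qed

lemma minus_pair_borel: "(\<lambda>p :: 'a \<times> 'a. fst p - snd p) \<in> borel_measurable (borel \<Otimes>\<^sub>M borel)"
  unfolding borel_prod by (intro borel_measurable_continuous_onI continuous_intros)

lemma char_pair_borel: "(\<lambda>p :: 'a \<times> 'a character. char_app (snd p) (fst p)) \<in> borel_measurable (borel \<Otimes>\<^sub>M borel)"
  unfolding measurable_cong_sets[OF sets_borel_prod[OF second_countable_euclidean second_countable_character[OF locally_compact]] refl]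
  by (intro borel_measurable_continuous_onI char_app_jointly_continuous locally_compact)

lemma inner_tf_shift_measurable:
  assumes f: "f \<in> L2 M" and k: "k \<in> L2 M"
  shows "(\<lambda>\<xi>. L2_inner M f (tf_shift \<xi> k)) \<in> borel_measurable (M \<Otimes>\<^sub>M N)"
proof -
  note L2_borel[OF f, measurable] L2_borel[OF k, measurable] cnj_borel[measurable]
  have [measurable]: "(\<lambda>q. snd q - fst (fst q)) \<in> borel_measurable ((M \<Otimes>\<^sub>M N) \<Otimes>\<^sub>M M)"
    using measurable_compose[OF _ minus_pair_borel, of "\<lambda>q. (snd q, fst (fst q))" "(M \<Otimes>\<^sub>M N) \<Otimes>\<^sub>M M"]
    by simp
  have [measurable]: "(\<lambda>q. char_app (snd (fst q)) (snd q)) \<in> borel_measurable ((M \<Otimes>\<^sub>M N) \<Otimes>\<^sub>M M)"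
    using measurable_compose[OF _ char_pair_borel, of "\<lambda>q. (snd q, snd (fst q))" "(M \<Otimes>\<^sub>M N) \<Otimes>\<^sub>M M"]
    by simp
  have "(\<lambda>q. f (snd q) * cnj (char_app (snd (fst q)) (snd q) * k (snd q - fst (fst q))))
      \<in> borel_measurable ((M \<Otimes>\<^sub>M N) \<Otimes>\<^sub>M M)"
    by measurable
  then have "(\<lambda>(\<xi>, y). f y * cnj (tf_shift \<xi> k y)) \<in> borel_measurable ((M \<Otimes>\<^sub>M N) \<Otimes>\<^sub>M M)"
    by (simp add: tf_shift_apply case_prod_beta)
  then show ?thesis
    unfolding L2_inner_def by (rule M.borel_measurable_lebesgue_integral)
qed

text \<open>
  Substituting \<open>y + x\<close> for \<open>y\<close> before exchanging the integrals leads to \<open>|f (x + y)|\<^sup>2 |k y|\<^sup>2\<close>, whose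
  integral over \<open>x\<close> is independent of \<open>y\<close> by translation invariance.
\<close>
lemma nn_integral_convolution_square:
  assumes f: "f \<in> L2 M" and k: "k \<in> L2 M"
  shows "(\<integral>\<^sup>+x. \<integral>\<^sup>+y. ennreal ((cmod (f y * cnj (k (y - x))))\<^sup>2) \<partial>M \<partial>M)
    = ennreal ((L2_norm M f)\<^sup>2 * (L2_norm M k)\<^sup>2)"
proof -
  note L2_borel[OF f, measurable] L2_borel[OF k, measurable] cnj_borel[measurable] minus_borel[measurable]
  have [measurable]: "(\<lambda>q. fst q + snd q) \<in> borel_measurable (M \<Otimes>\<^sub>M M)"
  proof -
    have "(\<lambda>q :: 'a \<times> 'a. fst q + snd q) \<in> borel_measurable (borel \<Otimes>\<^sub>M borel)"
      unfolding borel_prod by (intro borel_measurable_continuous_onI continuous_intros)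
    then show ?thesis by (simp add: measurable_cong_sets[OF sets_pair_measure_cong[OF sets_M sets_M] refl])
  qed
  have "(\<integral>\<^sup>+y. ennreal ((cmod (f y * cnj (k (y - x))))\<^sup>2) \<partial>M)
      = (\<integral>\<^sup>+y. ennreal ((cmod (f (x + y)))\<^sup>2) * ennreal ((cmod (k y))\<^sup>2) \<partial>M)" for x
  proof -
    have "(\<integral>\<^sup>+y. ennreal ((cmod (f y * cnj (k (y - x))))\<^sup>2) \<partial>M)
      = (\<integral>\<^sup>+y. ennreal ((cmod (f (y + x) * cnj (k (y + x - x))))\<^sup>2) \<partial>M)"
      by (rule nn_integral_M_shift[symmetric]) measurable
    then show ?thesis
      by (simp add: norm_mult power_mult_distrib ennreal_mult add.commute)
  qed
  then have "(\<integral>\<^sup>+x. \<integral>\<^sup>+y. ennreal ((cmod (f y * cnj (k (y - x))))\<^sup>2) \<partial>M \<partial>M)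
      = (\<integral>\<^sup>+x. \<integral>\<^sup>+y. ennreal ((cmod (f (x + y)))\<^sup>2) * ennreal ((cmod (k y))\<^sup>2) \<partial>M \<partial>M)"
    by simp
  also have "\<dots> = (\<integral>\<^sup>+y. \<integral>\<^sup>+x. ennreal ((cmod (f (x + y)))\<^sup>2) * ennreal ((cmod (k y))\<^sup>2) \<partial>M \<partial>M)"
  proof -
    have "(\<lambda>q. ennreal ((cmod (f (fst q + snd q)))\<^sup>2) * ennreal ((cmod (k (snd q)))\<^sup>2)) \<in> borel_measurable (M \<Otimes>\<^sub>M M)"
      by measurable
    from MM.Fubini[OF this] show ?thesis by simp
  qed
  also have "\<dots> = (\<integral>\<^sup>+y. ennreal ((L2_norm M f)\<^sup>2) * ennreal ((cmod (k y))\<^sup>2) \<partial>M)"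
  proof (rule nn_integral_cong)
    fix y
    have [measurable]: "(\<lambda>x. x + y) \<in> borel_measurable M"
      unfolding measurable_cong_sets[OF sets_M refl]
      by (intro borel_measurable_continuous_onI continuous_intros)
    have "(\<integral>\<^sup>+x. ennreal ((cmod (f (x + y)))\<^sup>2) * ennreal ((cmod (k y))\<^sup>2) \<partial>M)
      = (\<integral>\<^sup>+x. ennreal ((cmod (f (x + y)))\<^sup>2) \<partial>M) * ennreal ((cmod (k y))\<^sup>2)"
      by (rule nn_integral_multc) measurable
    also have "(\<integral>\<^sup>+x. ennreal ((cmod (f (x + y)))\<^sup>2) \<partial>M) = (\<integral>\<^sup>+x. ennreal ((cmod (f x))\<^sup>2) \<partial>M)"
      by (rule nn_integral_M_shift) measurable
    finally show "(\<integral>\<^sup>+x. ennreal ((cmod (f (x + y)))\<^sup>2) * ennreal ((cmod (k y))\<^sup>2) \<partial>M)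
      = ennreal ((L2_norm M f)\<^sup>2) * ennreal ((cmod (k y))\<^sup>2)"
      by (simp only: nn_integral_L2[OF f])
  qed
  also have "\<dots> = ennreal ((L2_norm M f)\<^sup>2) * (\<integral>\<^sup>+y. ennreal ((cmod (k y))\<^sup>2) \<partial>M)"
    by (rule nn_integral_cmult) measurable
  finally show ?thesis by (simp add: nn_integral_L2[OF k] ennreal_mult)
qed

text \<open>
  Plancherel's theorem is applied to \<open>w x\<close>, the function of \<open>y\<close> whose Fourier transform is the
  coefficient at \<open>(x, \<gamma>)\<close>. It is integrable for every \<open>x\<close> and, by \<open>nn_integral_convolution_square\<close>,
  square integrable for almost every \<open>x\<close>.
\<close>
lemma orthogonality_relation:
  assumes f: "f \<in> L2 M" and k: "k \<in> L2 M"
  shows "(\<integral>\<^sup>+\<xi>. ennreal ((cmod (L2_inner M f (tf_shift \<xi> k)))\<^sup>2) \<partial>(M \<Otimes>\<^sub>M N))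
    = ennreal ((L2_norm M f)\<^sup>2 * (L2_norm M k)\<^sup>2)"
proof -
  note L2_borel[OF f, measurable] L2_borel[OF k, measurable] cnj_borel[measurable] minus_borel[measurable]
  define w where "w = (\<lambda>x y. f y * cnj (k (y - x)))"
  have conv: "(\<integral>\<^sup>+x. \<integral>\<^sup>+y. ennreal ((cmod (w x y))\<^sup>2) \<partial>M \<partial>M) = ennreal ((L2_norm M f)\<^sup>2 * (L2_norm M k)\<^sup>2)"
    unfolding w_def by (rule nn_integral_convolution_square[OF f k])
  have wm [measurable]: "w x \<in> borel_measurable M" for x unfolding w_def by measurable
  have wint: "integrable M (w x)" for x
    using L2_inner_integrable[OF f tf_shift_L2[OF k, of "(x, 0)"]]
    by (simp add: w_def tf_shift_apply char_app_zero)
  have four: "L2_inner M f (tf_shift (x, \<gamma>) k) = fourier M (w x) \<gamma>" for x \<gamma>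
    unfolding L2_inner_def fourier_def w_def
    by (rule Bochner_Integration.integral_cong[OF refl]) (simp add: tf_shift_apply mult_ac)
  have "(\<integral>\<^sup>+\<xi>. ennreal ((cmod (L2_inner M f (tf_shift \<xi> k)))\<^sup>2) \<partial>(M \<Otimes>\<^sub>M N))
      = (\<integral>\<^sup>+x. \<integral>\<^sup>+\<gamma>. ennreal ((cmod (L2_inner M f (tf_shift (x, \<gamma>) k)))\<^sup>2) \<partial>N \<partial>M)"
    using N.nn_integral_fst[of "\<lambda>\<xi>. ennreal ((cmod (L2_inner M f (tf_shift \<xi> k)))\<^sup>2)" M]
      inner_tf_shift_measurable[OF f k] by simp
  also have "\<dots> = (\<integral>\<^sup>+x. \<integral>\<^sup>+y. ennreal ((cmod (w x y))\<^sup>2) \<partial>M \<partial>M)"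
  proof (rule nn_integral_cong_AE)
    have "(\<lambda>q. snd q - fst q) \<in> borel_measurable (M \<Otimes>\<^sub>M M)"
      using measurable_compose[OF _ minus_pair_borel, of "\<lambda>q. (snd q, fst q)" "M \<Otimes>\<^sub>M M"] by simp
    then have "(\<lambda>q. ennreal ((cmod (w (fst q) (snd q)))\<^sup>2)) \<in> borel_measurable (M \<Otimes>\<^sub>M M)"
      unfolding w_def by measurable
    then have "(\<lambda>x. \<integral>\<^sup>+y. ennreal ((cmod (w x y))\<^sup>2) \<partial>M) \<in> borel_measurable M"
      using M.borel_measurable_nn_integral_fst by fastforce
    then have "AE x in M. (\<integral>\<^sup>+y. ennreal ((cmod (w x y))\<^sup>2) \<partial>M) \<noteq> \<infinity>"
      using conv by (intro nn_integral_PInf_AE) auto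
    then show "AE x in M. (\<integral>\<^sup>+\<gamma>. ennreal ((cmod (L2_inner M f (tf_shift (x, \<gamma>) k)))\<^sup>2) \<partial>N)
        = (\<integral>\<^sup>+y. ennreal ((cmod (w x y))\<^sup>2) \<partial>M)"
    proof eventually_elim
      case (elim x)
      then have wL2: "w x \<in> L2 M" by (intro L2_I wm) (simp add: less_top)
      then have pl: "fourier M (w x) \<in> L2 N" "L2_norm N (fourier M (w x)) = L2_norm M (w x)"
        using dual_N wint[of x] by (auto simp: dual_haar_measure_def)
      then show ?case
        by (simp add: four nn_integral_L2[OF pl(1)] nn_integral_L2[OF wL2])
    qed
  qed
  also note conv
  finally show ?thesis .
qed

lemma exists_nonzero_L2:
  obtains f where "f \<in> L2 M" "L2_norm M f > 0"
proof -
  obtain A :: "nat \<Rightarrow> 'a set" where A: "range A \<subseteq> sets M" "(\<Union>i. A i) = space M" "\<And>i. emeasure M (A i) \<noteq> \<infinity>"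
    using M.sigma_finite by metis
  have "\<exists>i. emeasure M (A i) \<noteq> 0"
  proof (rule ccontr)
    assume "\<not> (\<exists>i. emeasure M (A i) \<noteq> 0)"
    then have "emeasure M (\<Union>i. A i) = 0" using A(1) by (intro emeasure_UN_eq_0) auto
    then show False using A(2) haar_M by (simp add: haar_measure_def space_M)
  qed
  then obtain i where i: "emeasure M (A i) \<noteq> 0" by blast
  define f where "f = (\<lambda>x. complex_of_real (indicator (A i) x))"
  have Ai [measurable]: "A i \<in> sets M" using A(1) by auto
  have sq: "(cmod (f x))\<^sup>2 = indicator (A i) x" for x by (simp add: f_def indicator_def)
  have nn: "(\<integral>\<^sup>+x. ennreal ((cmod (f x))\<^sup>2) \<partial>M) = emeasure M (A i)"
    by (simp add: sq Ai ennreal_indicator)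
  have fL2: "f \<in> L2 M"
  proof (rule L2_I)
    show "f \<in> borel_measurable M" unfolding f_def by measurable
  qed (use A(3) in \<open>simp add: nn less_top\<close>)
  moreover have "ennreal ((L2_norm M f)\<^sup>2) \<noteq> 0"
    using i nn nn_integral_L2[OF fL2] by simp
  then have "L2_norm M f > 0" using L2_norm_nonneg[of M f] by (auto simp: less_le)
  ultimately show ?thesis using that by blast
qed

end

section \<open>The size of a lattice carrying a Gabor frame\<close>

locale gabor_frame_setting = phase_space M N
  for M :: "'a::{topological_ab_group_add, t2_space, second_countable_topology} measure"
    and N :: "'a character measure" +
  fixes \<Delta> :: "('a \<times> 'a character) set" and g :: "'a \<Rightarrow> complex"
  assumes subgroup: "is_subgroup \<Delta>" and discrete: "discrete \<Delta>"
    and g: "g \<in> L2 M" and frame: "gabor_frame M \<Delta> g"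
begin

sublocale discrete_quotient "M \<Otimes>\<^sub>M N" \<Delta>
  by (rule discrete_quotient_MN[OF subgroup discrete])

definition analysis :: "('a \<Rightarrow> complex) \<Rightarrow> 'a \<times> 'a character \<Rightarrow> complex"
  where "analysis f \<nu> = L2_inner M f (tf_shift \<nu> g)"

lemma frame_bounds:
  obtains A B where "0 < A"
    "\<And>f. f \<in> L2 M \<Longrightarrow> analysis f \<in> L2 (count_space \<Delta>)"
    "\<And>f. f \<in> L2 M \<Longrightarrow> A * (L2_norm M f)\<^sup>2 \<le> (L2_norm (count_space \<Delta>) (analysis f))\<^sup>2"
    "\<And>f. f \<in> L2 M \<Longrightarrow> (L2_norm (count_space \<Delta>) (analysis f))\<^sup>2 \<le> B * (L2_norm M f)\<^sup>2"
proof -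
  obtain A B where AB: "0 < A" "A \<le> B" "\<And>f. f \<in> L2 M \<Longrightarrow>
      ennreal (A * (L2_norm M f)\<^sup>2) \<le> (\<integral>\<^sup>+\<nu>. ennreal ((cmod (analysis f \<nu>))\<^sup>2) \<partial>count_space \<Delta>)"
    "\<And>f. f \<in> L2 M \<Longrightarrow>
      (\<integral>\<^sup>+\<nu>. ennreal ((cmod (analysis f \<nu>))\<^sup>2) \<partial>count_space \<Delta>) \<le> ennreal (B * (L2_norm M f)\<^sup>2)"
    using frame unfolding gabor_frame_def analysis_def by blast
  have L2: "analysis f \<in> L2 (count_space \<Delta>)" if f: "f \<in> L2 M" for f
    using AB(4)[OF f] by (intro L2_I) (auto intro: le_less_trans)
  show ?thesis
  proof (rule that[OF AB(1) L2])
    fix f assume f: "f \<in> L2 M"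
    show "A * (L2_norm M f)\<^sup>2 \<le> (L2_norm (count_space \<Delta>) (analysis f))\<^sup>2"
      using AB(3)[OF f] by (simp add: nn_integral_L2[OF L2[OF f]])
    have "0 \<le> B * (L2_norm M f)\<^sup>2" using AB(1,2) by simp
    then show "(L2_norm (count_space \<Delta>) (analysis f))\<^sup>2 \<le> B * (L2_norm M f)\<^sup>2"
      using AB(4)[OF f] by (intro L2_norm_sq_le_nn L2 f)
  qed
qed

lemma analysis_L2: "f \<in> L2 M \<Longrightarrow> analysis f \<in> L2 (count_space \<Delta>)"
  using frame_bounds by blast

text \<open>
  The vector \<open>u\<close> is \<open>S\<^sup>-\<^sup>1 f\<close> for the frame operator \<open>S\<close>, whose sesquilinear form is the inner product of
  coefficient sequences.
\<close>
lemma frame_operator_surj: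
  assumes f: "f \<in> L2 M"
  obtains u where "u \<in> L2 M"
    "\<And>w. w \<in> L2 M \<Longrightarrow> L2_inner (count_space \<Delta>) (analysis u) (analysis w) = L2_inner M f w"
proof -
  obtain A B where AB: "0 < A"
    "\<And>f. f \<in> L2 M \<Longrightarrow> A * (L2_norm M f)\<^sup>2 \<le> (L2_norm (count_space \<Delta>) (analysis f))\<^sup>2"
    "\<And>f. f \<in> L2 M \<Longrightarrow> (L2_norm (count_space \<Delta>) (analysis f))\<^sup>2 \<le> B * (L2_norm M f)\<^sup>2"
    using frame_bounds by metis
  have lin: "analysis (\<lambda>x. f x + c * h x) = (\<lambda>y. analysis f y + c * analysis h y)"
    if "f \<in> L2 M" "h \<in> L2 M" for f h c
    using that
    by (simp add: fun_eq_iff analysis_def L2_inner_add_left L2_scale tf_shift_L2 g L2_inner_scale_left)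
  show ?thesis
    using L2_Lax_Milgram[of M analysis "count_space \<Delta>", OF analysis_L2 lin AB f] that by blast
qed

text \<open>
  The frame operator commutes with \<open>\<pi>(\<nu>)\<close> for \<open>\<nu> \<in> \<Delta>\<close>: shifting both arguments shifts both coefficient
  sequences by \<open>\<nu>\<close> and multiplies them by the same phases.
\<close>
lemma analysis_covariant:
  assumes \<nu>: "\<nu> \<in> \<Delta>" and u: "u \<in> L2 M" and v: "v \<in> L2 M"
  shows "L2_inner (count_space \<Delta>) (analysis (tf_shift \<nu> u)) (analysis (tf_shift \<nu> v))
    = L2_inner (count_space \<Delta>) (analysis u) (analysis v)"
proof -
  have bij: "bij_betw (\<lambda>\<mu>. \<nu> + \<mu>) \<Delta> \<Delta>"
  proof (rule bij_betw_byWitness[where f' = "\<lambda>\<mu>. \<mu> - \<nu>"])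
    show "(\<lambda>\<mu>. \<nu> + \<mu>) ` \<Delta> \<subseteq> \<Delta>" using add_mem[OF \<nu>] by blast
    show "(\<lambda>\<mu>. \<mu> - \<nu>) ` \<Delta> \<subseteq> \<Delta>" using diff_mem[OF _ \<nu>] by blast
  qed auto
  have "analysis (tf_shift \<nu> u) (\<nu> + \<mu>) * cnj (analysis (tf_shift \<nu> v) (\<nu> + \<mu>))
      = analysis u \<mu> * cnj (analysis v \<mu>)" for \<mu>
  proof -
    let ?c = "char_app (snd \<mu>) (fst \<nu>)"
    have "analysis (tf_shift \<nu> u) (\<nu> + \<mu>) * cnj (analysis (tf_shift \<nu> v) (\<nu> + \<mu>))
      = (?c * cnj ?c) * (analysis u \<mu> * cnj (analysis v \<mu>))"
      unfolding analysis_def inner_tf_shift_add[OF u g] inner_tf_shift_add[OF v g]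
      by (simp only: complex_cnj_mult complex_cnj_cnj mult_ac)
    then show ?thesis by simp
  qed
  then show ?thesis
    unfolding L2_inner_def
    using integral_bij_count_space[OF bij, of "\<lambda>\<mu>. analysis (tf_shift \<nu> u) \<mu> * cnj (analysis (tf_shift \<nu> v) \<mu>)"]
    by simp
qed

text \<open>
  With \<open>h = S\<^sup>-\<^sup>1 g\<close> and \<open>u = S\<^sup>-\<^sup>1 f\<close> this is \<open>\<langle>f, \<pi>(\<nu>) S\<^sup>-\<^sup>1 g\<rangle> = \<langle>S\<^sup>-\<^sup>1 f, \<pi>(\<nu>) g\<rangle>\<close>: the operator \<open>S\<^sup>-\<^sup>1\<close> is
  self-adjoint and commutes with \<open>\<pi>(\<nu>)\<close>.
\<close>
lemma dual_window_coefficient: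
  assumes h: "h \<in> L2 M"
      "\<And>w. w \<in> L2 M \<Longrightarrow> L2_inner (count_space \<Delta>) (analysis h) (analysis w) = L2_inner M g w"
    and u: "u \<in> L2 M"
      "\<And>w. w \<in> L2 M \<Longrightarrow> L2_inner (count_space \<Delta>) (analysis u) (analysis w) = L2_inner M f w"
    and f: "f \<in> L2 M" and \<nu>: "\<nu> \<in> \<Delta>"
  shows "L2_inner M f (tf_shift \<nu> h) = analysis u \<nu>"
proof -
  obtain f' where f': "f' \<in> L2 M" "tf_shift \<nu> f' = f" using tf_shift_surj[OF f] by blast
  obtain u' where u': "u' \<in> L2 M" "tf_shift \<nu> u' = u" using tf_shift_surj[OF u(1)] by blast
  have "L2_inner M f (tf_shift \<nu> h) = L2_inner (count_space \<Delta>) (analysis u) (analysis (tf_shift \<nu> h))"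
    by (rule u(2)[symmetric]) (rule tf_shift_L2[OF h(1)])
  also have "\<dots> = L2_inner (count_space \<Delta>) (analysis u') (analysis h)"
    using analysis_covariant[OF \<nu> u'(1) h(1)] by (simp only: u'(2))
  also have "\<dots> = cnj (L2_inner M g u')"
    using h(2)[OF u'(1)] by (metis L2_inner_cnj)
  also have "\<dots> = L2_inner M u' g" by (rule L2_inner_cnj)
  also have "\<dots> = L2_inner M u (tf_shift \<nu> g)"
    using tf_shift_inner[OF u'(1) g, of \<nu>] by (simp only: u'(2))
  finally show ?thesis by (simp only: analysis_def)
qed

text \<open>
  The expansion \<open>\<Sum>\<^sub>\<nu> \<langle>f, \<pi>(\<xi> + \<nu>) g\<rangle> cnj \<langle>f, \<pi>(\<xi> + \<nu>) h\<rangle> = \<parallel>f\<parallel>\<^sup>2\<close>, in polarised form. Write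
  \<open>f = \<pi>(\<xi>) f'\<close>, so that \<open>\<xi>\<close> drops out. The coefficients of \<open>f'\<close> with respect to \<open>g\<close> and \<open>h\<close> are
  the coefficients of \<open>f'\<close> and of \<open>u = S\<^sup>-\<^sup>1 f'\<close> with respect to \<open>g\<close>, and the inner product of these two
  sequences is \<open>\<langle>f', S S\<^sup>-\<^sup>1 f'\<rangle> = \<parallel>f'\<parallel>\<^sup>2\<close>.
\<close>
lemma coefficient_sums:
  assumes h: "h \<in> L2 M"
      "\<And>w. w \<in> L2 M \<Longrightarrow> L2_inner (count_space \<Delta>) (analysis h) (analysis w) = L2_inner M g w"
    and f: "f \<in> L2 M"
  shows "(\<integral>\<^sup>+\<nu>. ennreal ((cmod (L2_inner M f (tf_shift (\<xi> + \<nu>) (\<lambda>x. g x + h x))))\<^sup>2) \<partial>count_space \<Delta>)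
    = (\<integral>\<^sup>+\<nu>. ennreal ((cmod (L2_inner M f (tf_shift (\<xi> + \<nu>) (\<lambda>x. g x - h x))))\<^sup>2) \<partial>count_space \<Delta>)
      + ennreal (4 * (L2_norm M f)\<^sup>2)"
proof -
  obtain f' where f': "f' \<in> L2 M" "tf_shift \<xi> f' = f" using tf_shift_surj[OF f] by blast
  obtain u where u: "u \<in> L2 M"
    "\<And>w. w \<in> L2 M \<Longrightarrow> L2_inner (count_space \<Delta>) (analysis u) (analysis w) = L2_inner M f' w"
    using frame_operator_surj[OF f'(1)] by metis
  have red: "cmod (L2_inner M f (tf_shift (\<xi> + \<nu>) k)) = cmod (L2_inner M f' (tf_shift \<nu> k))"
    if k: "k \<in> L2 M" for k \<nu>
    using inner_tf_shift_add[OF f'(1) k, of \<xi> \<nu>] by (simp add: f'(2) norm_mult)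
  have hL2: "h \<in> L2 M" by (rule h)
  have plus: "L2_inner M f' (tf_shift \<nu> (\<lambda>x. g x + h x)) = analysis f' \<nu> + analysis u \<nu>" if "\<nu> \<in> \<Delta>" for \<nu>
    using dual_window_coefficient[OF h u f'(1) that] tf_shift_lin[of \<nu> g 1 h]
      L2_inner_add_right[OF tf_shift_L2[OF g] tf_shift_L2[OF hL2] f'(1)]
    by (simp add: analysis_def)
  have minus: "L2_inner M f' (tf_shift \<nu> (\<lambda>x. g x - h x)) = analysis f' \<nu> - analysis u \<nu>" if "\<nu> \<in> \<Delta>" for \<nu>
    using dual_window_coefficient[OF h u f'(1) that] tf_shift_lin[of \<nu> g "- 1" h]
      L2_inner_diff_right[OF tf_shift_L2[OF g] tf_shift_L2[OF hL2] f'(1)]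
    by (simp add: analysis_def)
  let ?D = "count_space \<Delta>"
  have aL2: "analysis f' \<in> L2 ?D" "analysis u \<in> L2 ?D" by (intro analysis_L2 f' u)+
  have 1: "(\<integral>\<^sup>+\<nu>. ennreal ((cmod (L2_inner M f (tf_shift (\<xi> + \<nu>) (\<lambda>x. g x + h x))))\<^sup>2) \<partial>?D)
      = ennreal ((L2_norm ?D (\<lambda>\<nu>. analysis f' \<nu> + analysis u \<nu>))\<^sup>2)"
    unfolding red[OF L2_add[OF g hL2]] nn_integral_L2[OF L2_add[OF aL2], symmetric]
    by (rule nn_integral_cong) (simp add: plus)
  have 2: "(\<integral>\<^sup>+\<nu>. ennreal ((cmod (L2_inner M f (tf_shift (\<xi> + \<nu>) (\<lambda>x. g x - h x))))\<^sup>2) \<partial>?D)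
      = ennreal ((L2_norm ?D (\<lambda>\<nu>. analysis f' \<nu> - analysis u \<nu>))\<^sup>2)"
    unfolding red[OF L2_diff[OF g hL2]] nn_integral_L2[OF L2_diff[OF aL2], symmetric]
    by (rule nn_integral_cong) (simp add: minus)
  have "L2_inner ?D (analysis f') (analysis u) = cnj (L2_inner M f' f')"
    using u(2)[OF f'(1)] by (metis L2_inner_cnj)
  then have "Re (L2_inner ?D (analysis f') (analysis u)) = (L2_norm M f')\<^sup>2"
    by (simp add: L2_inner_self)
  also have "\<dots> = (L2_norm M f)\<^sup>2" using tf_shift_norm[OF f'(1), of \<xi>] by (simp add: f'(2))
  finally have "(L2_norm ?D (\<lambda>\<nu>. analysis f' \<nu> + analysis u \<nu>))\<^sup>2
      = (L2_norm ?D (\<lambda>\<nu>. analysis f' \<nu> - analysis u \<nu>))\<^sup>2 + 4 * (L2_norm M f)\<^sup>2"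
    by (simp add: L2_norm_add_sq[OF aL2] L2_norm_diff_sq[OF aL2])
  then show ?thesis
    unfolding 1 2 by (simp add: ennreal_plus)
qed

text \<open>
  Integrating \<open>coefficient_sums\<close> over phase space gives \<open>d(\<Delta>) = Re \<langle>g, h\<rangle> = \<parallel>C h\<parallel>\<^sup>2\<close> for the coefficient
  sequence \<open>C h\<close> of \<open>h\<close>, whose entry at \<open>0\<close> is \<open>\<langle>h, g\<rangle>\<close> and has modulus at least \<open>d(\<Delta>)\<close>. Hence
  \<open>d(\<Delta>)\<^sup>2 \<le> d(\<Delta>)\<close>.
\<close>
lemma emeasure_F_le_1: "emeasure (M \<Otimes>\<^sub>M N) F \<le> 1"
proof -
  obtain h where h: "h \<in> L2 M"
      "\<And>w. w \<in> L2 M \<Longrightarrow> L2_inner (count_space \<Delta>) (analysis h) (analysis w) = L2_inner M g w"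
    using frame_operator_surj[OF g] by metis
  obtain f where f: "f \<in> L2 M" "L2_norm M f > 0" by (rule exists_nonzero_L2)
  let ?n = "(L2_norm M f)\<^sup>2" and ?d = "emeasure (M \<Otimes>\<^sub>M N) F"
  have n: "?n > 0" using f(2) by simp
  let ?\<phi> = "\<lambda>k \<xi>. ennreal ((cmod (L2_inner M f (tf_shift \<xi> k)))\<^sup>2)"
  have meas: "?\<phi> k \<in> borel_measurable borel" if "k \<in> L2 M" for k
  proof -
    have "?\<phi> k \<in> borel_measurable (M \<Otimes>\<^sub>M N)" using inner_tf_shift_measurable[OF f(1) that] by measurable
    then show ?thesis by (simp add: measurable_cong_sets[OF sets_MN refl])
  qed
  have "(\<integral>\<^sup>+\<xi>. ?\<phi> (\<lambda>x. g x + h x) \<xi> \<partial>(M \<Otimes>\<^sub>M N))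
      = (\<integral>\<^sup>+\<xi>. ?\<phi> (\<lambda>x. g x - h x) \<xi> \<partial>(M \<Otimes>\<^sub>M N)) + ennreal (4 * ?n) * ?d"
    by (intro nn_integral_periodize_add meas L2_add L2_diff g h(1) coefficient_sums f(1) h(2))
  then have eq: "ennreal (?n * (L2_norm M (\<lambda>x. g x + h x))\<^sup>2)
      = ennreal (?n * (L2_norm M (\<lambda>x. g x - h x))\<^sup>2) + ennreal (4 * ?n) * ?d"
    by (simp only: orthogonality_relation[OF f(1)] L2_add L2_diff g h(1))
  have "?d \<noteq> \<infinity>"
  proof
    assume "?d = \<infinity>"
    then show False using eq n by (simp add: ennreal_mult_top)
  qed
  then obtain d where d: "?d = ennreal d" "d \<ge> 0" by (cases ?d) auto
  have "?n * (L2_norm M (\<lambda>x. g x + h x))\<^sup>2 = ?n * (L2_norm M (\<lambda>x. g x - h x))\<^sup>2 + 4 * ?n * d"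
    using eq n d(2) unfolding d(1)
    by (simp add: ennreal_mult[symmetric] ennreal_plus[symmetric] del: ennreal_plus)
  then have "?n * (L2_norm M (\<lambda>x. g x + h x))\<^sup>2 = ?n * ((L2_norm M (\<lambda>x. g x - h x))\<^sup>2 + 4 * d)"
    by (simp add: algebra_simps)
  then have dRe: "d = Re (L2_inner M g h)"
    using n by (simp add: L2_norm_add_sq[OF g h(1)] L2_norm_diff_sq[OF g h(1)])
  have "ennreal ((cmod (analysis h 0))\<^sup>2) = (\<integral>\<^sup>+\<nu>. ennreal ((cmod (analysis h 0))\<^sup>2) * indicator {0} \<nu> \<partial>count_space \<Delta>)"
    using zero_mem by (simp add: nn_integral_cmult_indicator)
  also have "\<dots> \<le> (\<integral>\<^sup>+\<nu>. ennreal ((cmod (analysis h \<nu>))\<^sup>2) \<partial>count_space \<Delta>)"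
    by (rule nn_integral_mono) (simp add: indicator_def)
  also have "\<dots> = ennreal ((L2_norm (count_space \<Delta>) (analysis h))\<^sup>2)"
    by (rule nn_integral_L2[OF analysis_L2[OF h(1)]])
  finally have "(cmod (analysis h 0))\<^sup>2 \<le> (L2_norm (count_space \<Delta>) (analysis h))\<^sup>2" by simp
  also have "\<dots> = Re (L2_inner (count_space \<Delta>) (analysis h) (analysis h))"
    by (simp add: L2_inner_self)
  also have "\<dots> = d" using h(2)[OF h(1)] dRe by simp
  finally have "(cmod (analysis h 0))\<^sup>2 \<le> d" .
  moreover have "d \<le> cmod (analysis h 0)"
    using complex_Re_le_cmod[of "L2_inner M g h"] dRe
    by (metis L2_inner_cnj analysis_def complex_mod_cnj tf_shift_zero)
  then have "d * d \<le> (cmod (analysis h 0))\<^sup>2"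
    unfolding power2_eq_square using d(2) by (intro mult_mono) auto
  ultimately have "d * d \<le> d" by simp
  then have "d \<le> 1" using d(2) by (cases "d = 0") (auto simp: mult_le_cancel_left1 mult_le_cancel_right1)
  then show ?thesis by (simp add: d(1))
qed

end

theorem theorem5p6:
  fixes M :: "'a::{topological_ab_group_add, t2_space, second_countable_topology} measure"
    and N :: "'a character measure"
    and \<Delta> :: "('a \<times> 'a character) set"
    and g :: "'a \<Rightarrow> complex"
  assumes "locally_compact_space (euclidean :: 'a topology)"
    and "haar_measure euclidean M"
    and "dual_haar_measure M N"
    and "is_subgroup \<Delta>" and "discrete \<Delta>"
    and "g \<in> L2 M"
    and "gabor_frame M \<Delta> g"
  shows "uniform_lattice \<Delta> \<and> lattice_size (M \<Otimes>\<^sub>M N) \<Delta> \<le> 1"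
proof -
  interpret gabor_frame_setting M N \<Delta> g
    using assms by unfold_locales
  have "emeasure (M \<Otimes>\<^sub>M N) F \<le> 1" by (rule emeasure_F_le_1)
  moreover from this have "compact_space (quotient_topology \<Delta>)"
    by (intro compact_quotient) (auto intro: le_less_trans)
  ultimately show ?thesis
    using assms(4,5) by (simp add: uniform_lattice_def lattice_size_eq)
qed

end
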